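(* Let $\mathbb{P}_{\mathbf{\Sigma}}$ be the proper smooth toric Deligne–Mumford stack of dimension $3$ associated to a complete stacky fan $\mathbf{\Sigma}=(\Sigma,\{v_i\}_{i=1}^n)$ in a lattice $N$ of rank $3$. Assume there is at most one pair $\{i,j\}$, $i\ne j$, such that $v_i$ and $v_j$ are collinear. Then there are infinitely many pairwise non-isomorphic $\mathrm{H}$-trivial line bundles on $\mathbb{P}_{\mathbf{\Sigma}}$ if and only if there exists a $\mathbf{\Sigma}$-piecewise linear function $\psi$ with $\dim(\Lambda_\psi)<3$.
   Context: Let $N$ be a free abelian group of rank $m$, $M=\mathrm{Hom}(N,\mathbb{Z})$, $N_{\mathbb{R}}=N\otimes\mathbb{R}$, $M_{\mathbb{R}}=M\otimes\mathbb{R}$. Let $\Sigma$ be a complete simplicial fan in $N_{\mathbb{R}}$ with $n$ rays, and for each $i$ let $v_i\in N$ be a nonzero lattice point on the $i$-th ray; $\mathbf{\Sigma}=(\Sigma,\{v_i\}_{i=1}^n)$ is a complete stacky fan and $\mathbb{P}_{\mathbf{\Sigma}}$ is the associated toric DM stack (Borisov–Chen–Smith). Its Picard group is $\mathbb{Z}^n/\{\sum_i (w\cdot v_i)E_i : w\in M\}$, where $E_1,\dots,E_n$ is the standard basis of $\mathbb{Z}^n$; $\mathcal{O}(\sum r_iE_i)$ denotes the class of $\sum r_iE_i$. For $\mathbf r\in\mathbb{Z}^n$, $Supp(\mathbf r)$ is the simplicial complex on $\{1,\dots,n\}$ whose faces are the subsets $J$ (including $\emptyset$) with $r_i\ge0$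 for all $i\in J$ and $\{v_i:i\in J\}$ contained in a single cone of $\Sigma$. Then $H^j(\mathbb{P}_{\mathbf{\Sigma}},\mathcal L)=\bigoplus \tilde H_{m-j-1}(Supp(\mathbf r))$, summed over all $\mathbf r\in\mathbb{Z}^n$ with $\mathcal O(\sum r_iE_i)\cong\mathcal L$ (reduced simplicial homology with $\mathbb{C}$-coefficients; the complex $\{\emptyset\}$ has $\tilde H_{-1}=\mathbb{C}$). A line bundle $\mathcal L$ is $\mathrm{H}$-trivial if $H^j(\mathbb{P}_{\mathbf{\Sigma}},\mathcal L)=0$ for all $j\ge0$. A $\mathbf{\Sigma}$-piecewise linear function is a continuous $\psi:N_{\mathbb{R}}\to\mathbb{R}$ whose restriction to each cone of $\Sigma$ is linear; for each maximal cone $\sigma$, $\psi_\sigma\in M_{\mathbb{R}}$ denotes the linear function agreeing with $\psi$ on $\sigma$. $\Lambda_\psi\subset M_{\mathbb{R}}$ is the convex hull of $\{\psi_\sigma:\sigma \text{ a maximal cone of }\Sigma\}$.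
   Formalization: The piecewise linear function ψ is required not to be linear on all of N_R; otherwise ψ = 0, with Λ_ψ a point, would always satisfy the right-hand side, and P^3, which has only finitely many H-trivial line bundles, would be a counterexample. *)

theory Defs
  imports "HOL-Analysis.Analysis"
begin

(* The lattice N of rank 3 is identified with the integer points of real^3 (after choosing a
   basis); M_R = Hom(N,R) is identified with real^3 via the inner product.
   Rays are indexed by 0..n-1 (instead of 1..n). A cone of the fan is encoded by the set
   S of indices of its generating rays. *)

definition cone_of :: "(nat \<Rightarrow> real^3) \<Rightarrow> nat set \<Rightarrow> (real^3) set" where
  "cone_of v S = {(\<Sum>i\<in>S. c i *\<^sub>R v i) | c. \<forall>i\<in>S. c i \<ge> 0}"

definition complete_stacky_fan :: "nat \<Rightarrow> (nat \<Rightarrow> real^3) \<Rightarrow> nat set set \<Rightarrow> bool" where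
  "complete_stacky_fan n v C \<longleftrightarrow>
     (\<forall>i<n. v i \<noteq> 0 \<and> (\<forall>k. v i $ k \<in> \<int>)) \<and>
     C \<subseteq> Pow {..<n} \<and>
     (\<forall>S\<in>C. \<forall>T. T \<subseteq> S \<longrightarrow> T \<in> C) \<and>
     (\<forall>i<n. {i} \<in> C) \<and>
     (\<forall>S\<in>C. inj_on v S \<and> independent (v ` S)) \<and>
     (\<forall>S\<in>C. \<forall>T\<in>C. cone_of v S \<inter> cone_of v T = cone_of v (S \<inter> T)) \<and>
     (\<Union>S\<in>C. cone_of v S) = UNIV"

definition maximal_cone :: "nat set set \<Rightarrow> nat set \<Rightarrow> bool" where
  "maximal_cone C S \<longleftrightarrow> S \<in> C \<and> (\<forall>T\<in>C. S \<subseteq> T \<longrightarrow> T = S)"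

definition piecewise_linear :: "(nat \<Rightarrow> real^3) \<Rightarrow> nat set set \<Rightarrow> (real^3 \<Rightarrow> real) \<Rightarrow> bool" where
  "piecewise_linear v C \<psi> \<longleftrightarrow> continuous_on UNIV \<psi> \<and>
     (\<forall>S\<in>C. \<exists>u. \<forall>x\<in>cone_of v S. \<psi> x = u \<bullet> x)"

definition Lambda_psi :: "(nat \<Rightarrow> real^3) \<Rightarrow> nat set set \<Rightarrow> (real^3 \<Rightarrow> real) \<Rightarrow> (real^3) set" where
  "Lambda_psi v C \<psi> = convex hull {u. \<exists>S. maximal_cone C S \<and> (\<forall>x\<in>cone_of v S. \<psi> x = u \<bullet> x)}"

definition Supp :: "nat \<Rightarrow> (nat \<Rightarrow> real^3) \<Rightarrow> nat set set \<Rightarrow> (nat \<Rightarrow> int) \<Rightarrow> nat set set" where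
  "Supp n v C r = {J. J \<subseteq> {..<n} \<and> (\<forall>i\<in>J. r i \<ge> 0) \<and> (\<exists>S\<in>C. \<forall>i\<in>J. v i \<in> cone_of v S)}"

(* simplicial chains with complex coefficients: a chain of K supported on faces of cardinality d
   (i.e. of dimension d-1; d = 0 is the empty face, giving reduced homology) *)
definition chain :: "nat set set \<Rightarrow> nat \<Rightarrow> (nat set \<Rightarrow> complex) \<Rightarrow> bool" where
  "chain K d c \<longleftrightarrow> (\<forall>F. c F \<noteq> 0 \<longrightarrow> F \<in> K \<and> card F = d)"

(* simplicial boundary, faces oriented by the natural order of vertices *)
definition bd :: "nat set \<Rightarrow> (nat set \<Rightarrow> complex) \<Rightarrow> nat set \<Rightarrow> complex" where
  "bd V c F = (\<Sum>x\<in>V - F. (-1) ^ card {y\<in>F. y < x} * c (insert x F))"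

definition acyclic :: "nat set set \<Rightarrow> nat set \<Rightarrow> bool" where
  "acyclic K V \<longleftrightarrow> (\<forall>d c. chain K d c \<and> (\<forall>F. bd V c F = 0) \<longrightarrow>
                              (\<exists>b. chain K (Suc d) b \<and> bd V b = c))"

(* class of O(sum r_i E_i) in Pic: r in Z^n (encoded as functions vanishing outside 0..n-1)
   modulo {(w . v_i)_i : w in M} *)
definition pic_class :: "nat \<Rightarrow> (nat \<Rightarrow> real^3) \<Rightarrow> (nat \<Rightarrow> int) \<Rightarrow> (nat \<Rightarrow> int) set" where
  "pic_class n v r = {r'. (\<forall>i\<ge>n. r' i = 0) \<and>
      (\<exists>w::real^3. (\<forall>k. w $ k \<in> \<int>) \<and> (\<forall>i<n. of_int (r' i) - of_int (r i) = w \<bullet> v i))}"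

(* H-trivial: H^j = sum over r' in the class of reduced homology of Supp(r') vanishes for all j *)
definition H_trivial :: "nat \<Rightarrow> (nat \<Rightarrow> real^3) \<Rightarrow> nat set set \<Rightarrow> (nat \<Rightarrow> int) \<Rightarrow> bool" where
  "H_trivial n v C r \<longleftrightarrow> (\<forall>r'\<in>pic_class n v r. acyclic (Supp n v C r') {..<n})"

definition H_trivial_bundles :: "nat \<Rightarrow> (nat \<Rightarrow> real^3) \<Rightarrow> nat set set \<Rightarrow> (nat \<Rightarrow> int) set set" where
  "H_trivial_bundles n v C =
     {pic_class n v r | r. (\<forall>i\<ge>n. r i = 0) \<and> H_trivial n v C r}"

end

(* Write V for the set of rays and K for the triangulated 2-sphere of the fan. The induced subcomplex
   on a set I of rays is acyclic iff the graphs induced on I and on V - I are both nonempty and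
   connected (Alexander duality, proved here from the fundamental class and H_1(K) = 0). Connectivity
   of such graphs is read off from connected subsets of R^3 through the piecewise linear barycentric
   coordinates h.

   If Lambda_psi lies in a plane, then after subtracting a linear function psi is invariant under
   translation along some e. Either e and -e both span rays, or psi is linear plus a multiple of
   |m . x| for a plane m . x = 0 that is a union of cones. In both cases psi can be made integral, and
   the bundles k psi - E_q, for a suitable ray q on which psi vanishes, are H-trivial.

   Conversely, rescaled representatives of infinitely many H-trivial classes converge to a nonlinear
   psi for which every generic psi + w has connected positive and negative part. Moving w across the
   wall of a ray v_i without antipode shows that a bend of psi at v_i continues straight on the other
   side. So a bent edge whose plane avoids the antipodal pair spreads to the full circle, and then
   |m . x| is piecewise linear on the fan; otherwise all bends contain the antipodal line, and the
   gradients of psi lie in a plane orthogonal to it up to translation. *)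
theory Submission
  imports Defs "HOL-Library.Function_Algebras"
begin

section \<open>Barycentric coordinates on a complete fan\<close>

text \<open>The twist by \<open>- E_q\<close> breaks ties. For \<psi> = |m . x| and w = 0 the
  support of k \<psi> is the whole sphere K; the strict inequality at q removes a vertex and leaves
  an acyclic complex. In the antipodal case it separates the two rays of a line on which k \<psi> +
  w vanishes. Complex coefficients and real values both obstruct integrality. A map to the rationals
  that is linear over the rationals, followed by clearing denominators, turns an unfilled complex
  cycle into integer cocycles, whose potentials come from a logarithm on the simply connected
  punctured space, and turns a real \<psi> into an integral one. Lattice functionals make all
  classes bounded on one fixed maximal cone. Infinitely many classes are then unbounded elsewhere,
  so the rescaled limit vanishes on that cone but not everywhere and is not linear. A wall tells
  more than a generic point: the negative set N and N with i added are both acyclic, which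
  constrains the neighbours of i in N. Bends that do not spread all have planes through a ray with a
  collinear partner; with at most one such pair these planes share a line.\<close>

locale fan =
  fixes n :: nat and v :: "nat \<Rightarrow> real^3" and C :: "nat set set"
  assumes complete_fan: "complete_stacky_fan n v C"
begin

lemma nonzero: "i < n \<Longrightarrow> v i \<noteq> 0"
  and integral: "i < n \<Longrightarrow> v i $ k \<in> \<int>"
  and in_range: "S \<in> C \<Longrightarrow> S \<subseteq> {..<n}"
  and face: "S \<in> C \<Longrightarrow> T \<subseteq> S \<Longrightarrow> T \<in> C"
  and vertex: "i < n \<Longrightarrow> {i} \<in> C"
  and inj_cone: "S \<in> C \<Longrightarrow> inj_on v S"
  and indep_cone: "S \<in> C \<Longrightarrow> independent (v ` S)"
  and cone_Int: "S \<in> C \<Longrightarrow> T \<in> C \<Longrightarrow> cone_of v S \<inter> cone_of v T = cone_of v (S \<inter> T)"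
  and cones_cover: "(\<Union>S\<in>C. cone_of v S) = UNIV"
proof -
  note fan = complete_fan[unfolded complete_stacky_fan_def]
  show "i < n \<Longrightarrow> v i \<noteq> 0" "i < n \<Longrightarrow> v i $ k \<in> \<int>"
    using fan[THEN conjunct1] by blast+
  note fan = fan[THEN conjunct2]
  show "S \<in> C \<Longrightarrow> S \<subseteq> {..<n}"
    using fan[THEN conjunct1] by blast
  note fan = fan[THEN conjunct2]
  show "S \<in> C \<Longrightarrow> T \<subseteq> S \<Longrightarrow> T \<in> C"
    using fan[THEN conjunct1] by blast
  note fan = fan[THEN conjunct2]
  show "i < n \<Longrightarrow> {i} \<in> C"
    using fan[THEN conjunct1] by blast
  note fan = fan[THEN conjunct2]
  show "S \<in> C \<Longrightarrow> inj_on v S" "S \<in> C \<Longrightarrow> independent (v ` S)"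
    using fan[THEN conjunct1] by blast+
  note fan = fan[THEN conjunct2]
  show "S \<in> C \<Longrightarrow> T \<in> C \<Longrightarrow> cone_of v S \<inter> cone_of v T = cone_of v (S \<inter> T)"
    using fan[THEN conjunct1] by blast
  show "(\<Union>S\<in>C. cone_of v S) = UNIV"
    using fan[THEN conjunct2] .
qed

lemma finite_cone: "S \<in> C \<Longrightarrow> finite S"
  using in_range finite_subset by blast

lemma finite_fan: "finite C"
  using in_range finite_subset[of C "Pow {..<n}"] by blast

lemma empty_cone: "{} \<in> C"
  using cones_cover face by blast

lemma card_cone: "S \<in> C \<Longrightarrow> card S \<le> 3"
  using independent_bound[OF indep_cone, of S] card_image[OF inj_cone, of S] by simp

text \<open>Generators of a cone are independent, so values on them can be prescribed freely. The
  linear map is represented by a vector \<open>u\<close>, as \<open>real^3\<close> stands for both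
  N_R and its dual.\<close>

lemma dual_functional:
  assumes "S \<in> C"
  shows "\<exists>u. \<forall>j\<in>S. u \<bullet> v j = g j"
proof -
  obtain L :: "real^3 \<Rightarrow> real" where L: "linear L" "\<forall>x\<in>v ` S. L x = g (inv_into S v x)"
    using linear_independent_extend[OF indep_cone[OF assms], of "\<lambda>x. g (inv_into S v x)"] by auto
  define u where "u = (\<Sum>b\<in>Basis. L b *\<^sub>R b)"
  have "L x = u \<bullet> x" for x
  proof -
    have "L x = L (\<Sum>b\<in>Basis. (x \<bullet> b) *\<^sub>R b)"
      by (simp only: euclidean_representation)
    also have "\<dots> = (\<Sum>b\<in>Basis. (x \<bullet> b) * L b)"
      by (simp add: linear_sum[OF L(1)] linear_scale[OF L(1)])
    also have "\<dots> = u \<bullet> x"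
      unfolding u_def inner_sum_left by (intro sum.cong) (simp_all add: inner_commute)
    finally show ?thesis .
  qed
  then show ?thesis
    using L(2) inj_cone[OF assms] by (intro exI[of _ u]) (auto simp: inv_into_f_f)
qed

lemma sum_cone_unique:
  assumes "S \<in> C" "(\<Sum>i\<in>S. c i *\<^sub>R v i) = (\<Sum>i\<in>S. d i *\<^sub>R v i)" "i \<in> S"
  shows "c i = d i"
proof -
  obtain u where u: "\<forall>j\<in>S. u \<bullet> v j = (if j = i then 1 else 0)"
    using dual_functional[OF assms(1), of "\<lambda>j. if j = i then 1 else 0"] by auto
  have "u \<bullet> (\<Sum>i\<in>S. c i *\<^sub>R v i) = c i" for c :: "nat \<Rightarrow> real"
  proof -
    have "u \<bullet> (\<Sum>i\<in>S. c i *\<^sub>R v i) = (\<Sum>j\<in>S. if j = i then c j else 0)"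
      by (auto simp: inner_sum_right u intro!: sum.cong)
    then show ?thesis
      using assms(3) finite_cone[OF assms(1)] by simp
  qed
  then show ?thesis
    using assms(2) by metis
qed

lemma coord_ex:
  "\<exists>d. (\<forall>i. d i \<ge> 0) \<and> {i. d i \<noteq> 0} \<in> C \<and> x = (\<Sum>i<n. d i *\<^sub>R v i)"
proof -
  obtain S where S: "S \<in> C" "x \<in> cone_of v S"
    using cones_cover by auto
  then obtain c where c: "x = (\<Sum>i\<in>S. c i *\<^sub>R v i)" "\<forall>i\<in>S. c i \<ge> 0"
    unfolding cone_of_def by auto
  define d where "d i = (if i \<in> S then c i else 0)" for i
  have "(\<Sum>i<n. d i *\<^sub>R v i) = (\<Sum>i\<in>S. d i *\<^sub>R v i)"
    using in_range[OF S(1)] by (intro sum.mono_neutral_right) (auto simp: d_def)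
  also have "\<dots> = x"
    by (simp add: c(1) d_def)
  finally have "x = (\<Sum>i<n. d i *\<^sub>R v i)" ..
  moreover have "{i. d i \<noteq> 0} \<in> C"
    by (rule face[OF S(1)]) (auto simp: d_def)
  moreover have "d i \<ge> 0" for i
    using c(2) by (simp add: d_def)
  ultimately show ?thesis
    by blast
qed

text \<open>These are the Courant functions of the fan: \<open>h x i\<close> is piecewise linear in
  \<open>x\<close>, equals 1 at \<open>v i\<close> and 0 at every other generator, and the support
  of \<open>h x\<close> is the smallest cone that contains \<open>x\<close>.\<close>

definition h :: "real^3 \<Rightarrow> nat \<Rightarrow> real" where
  "h x = (SOME d. (\<forall>i. d i \<ge> 0) \<and> {i. d i \<noteq> 0} \<in> C \<and> x = (\<Sum>i<n. d i *\<^sub>R v i))"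

lemma h_nonneg: "h x i \<ge> 0"
  and h_carrier: "{i. h x i \<noteq> 0} \<in> C"
  and h_sum: "(\<Sum>i<n. h x i *\<^sub>R v i) = x"
proof -
  have *: "(\<forall>i. h x i \<ge> 0) \<and> {i. h x i \<noteq> 0} \<in> C \<and> x = (\<Sum>i<n. h x i *\<^sub>R v i)"
    unfolding h_def by (rule someI_ex[OF coord_ex])
  then show "h x i \<ge> 0" "{i. h x i \<noteq> 0} \<in> C" "(\<Sum>i<n. h x i *\<^sub>R v i) = x"
    by (blast, blast, metis)
qed

text \<open>Two expansions may live on different cones. These meet in the cone over their common
  generators, which gives a third expansion \<open>g'\<close> valid in both; independence within
  either cone identifies it with each of the two.\<close>

lemma h_unique:
  assumes d: "\<And>i. d i \<ge> 0" "{i. d i \<noteq> 0} \<in> C" "x = (\<Sum>i<n. d i *\<^sub>R v i)"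
  shows "h x = d"
proof -
  let ?T = "\<lambda>d :: nat \<Rightarrow> real. {i. d i \<noteq> 0}"
  have eq: "x = (\<Sum>i\<in>?T d. d i *\<^sub>R v i)" if "?T d \<in> C" "x = (\<Sum>i<n. d i *\<^sub>R v i)" for d
    unfolding that(2) using in_range[OF that(1)]
    by (intro sum.mono_neutral_right) auto
  have x: "x = (\<Sum>i\<in>?T d. d i *\<^sub>R v i)" "x = (\<Sum>i\<in>?T (h x). h x i *\<^sub>R v i)"
    using eq d h_carrier h_sum by auto
  then have "x \<in> cone_of v (?T d) \<inter> cone_of v (?T (h x))"
    using d(1) h_nonneg unfolding cone_of_def by blast
  then have "x \<in> cone_of v (?T d \<inter> ?T (h x))"
    using cone_Int d h_carrier by blast
  then obtain g where g: "x = (\<Sum>i\<in>?T d \<inter> ?T (h x). g i *\<^sub>R v i)"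
    unfolding cone_of_def by auto
  define g' where "g' i = (if i \<in> ?T d \<inter> ?T (h x) then g i else 0)" for i
  have g': "x = (\<Sum>i\<in>S. g' i *\<^sub>R v i)" if "S \<in> C" "?T d \<inter> ?T (h x) \<subseteq> S" for S
  proof -
    have "x = (\<Sum>i\<in>?T d \<inter> ?T (h x). g' i *\<^sub>R v i)"
      by (rule trans[OF g]) (auto simp: g'_def intro!: sum.cong)
    also have "\<dots> = (\<Sum>i\<in>S. g' i *\<^sub>R v i)"
      using that finite_cone by (intro sum.mono_neutral_left) (auto simp: g'_def)
    finally show ?thesis .
  qed
  have "d i = g' i" for i
  proof (cases "i \<in> ?T d")
    case True
    then show ?thesis
      using sum_cone_unique[OF d(2), of d g' i] x(1) g'[OF d(2)] by auto
  qed (auto simp: g'_def)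
  moreover have "h x i = g' i" for i
  proof (cases "i \<in> ?T (h x)")
    case True
    then show ?thesis
      using sum_cone_unique[OF h_carrier[of x], of "h x" g' i] x(2) g'[OF h_carrier[of x]] by auto
  qed (auto simp: g'_def)
  ultimately show ?thesis
    by auto
qed

lemma h_pos_in_range: "h x i > 0 \<Longrightarrow> i < n"
  using in_range[OF h_carrier[of x]] by force

lemma h_cone:
  assumes "S \<in> C" "\<And>i. i \<in> S \<Longrightarrow> c i \<ge> 0"
  shows "h (\<Sum>i\<in>S. c i *\<^sub>R v i) = (\<lambda>i. if i \<in> S then c i else 0)"
proof (rule h_unique)
  show "{i. (if i \<in> S then c i else 0) \<noteq> 0} \<in> C"
    by (rule face[OF assms(1)]) (auto split: if_splits)
  show "(\<Sum>i\<in>S. c i *\<^sub>R v i) = (\<Sum>i<n. (if i \<in> S then c i else 0) *\<^sub>R v i)"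
    using in_range[OF assms(1)] by (intro sum.mono_neutral_cong_left) auto
qed (use assms in auto)

lemma h_vertex: "i < n \<Longrightarrow> h (v i) j = (if j = i then 1 else 0)"
  using h_cone[OF vertex, of i "\<lambda>_. 1"] by (auto simp: fun_eq_iff)

lemma h_scale: "t \<ge> 0 \<Longrightarrow> h (t *\<^sub>R x) = (\<lambda>i. t * h x i)"
proof (rule h_unique)
  show "{i. t * h x i \<noteq> 0} \<in> C"
    by (rule face[OF h_carrier[of x]]) auto
  show "t *\<^sub>R x = (\<Sum>i<n. (t * h x i) *\<^sub>R v i)"
    by (subst h_sum[of x, symmetric]) (simp add: scaleR_sum_right)
qed (simp add: h_nonneg)

lemma h_zero: "h 0 i = 0"
  using h_scale[of 0 0] by (simp add: fun_eq_iff)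

lemma h_eq_0_iff: "(\<forall>i. h x i = 0) \<longleftrightarrow> x = 0"
  using h_sum[of x] h_zero by auto

lemma h_pos_ex: "x \<noteq> 0 \<Longrightarrow> \<exists>i<n. h x i > 0"
  using h_eq_0_iff[of x] h_nonneg[of x] h_pos_in_range[of x] by (metis less_eq_real_def)

lemma in_cone_iff:
  assumes "S \<in> C"
  shows "x \<in> cone_of v S \<longleftrightarrow> {i. h x i \<noteq> 0} \<subseteq> S"
proof
  assume "x \<in> cone_of v S"
  then obtain c where "x = (\<Sum>i\<in>S. c i *\<^sub>R v i)" "\<forall>i\<in>S. c i \<ge> 0"
    unfolding cone_of_def by auto
  then show "{i. h x i \<noteq> 0} \<subseteq> S"
    using h_cone[OF assms, of c] by auto
next
  assume S: "{i. h x i \<noteq> 0} \<subseteq> S"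
  have "x = (\<Sum>i\<in>S. h x i *\<^sub>R v i)"
    by (subst h_sum[of x, symmetric], rule sum.mono_neutral_right)
       (use S in_range[OF assms] in auto)
  then show "x \<in> cone_of v S"
    unfolding cone_of_def using h_nonneg by blast
qed

lemma vertex_in_cone_iff: "S \<in> C \<Longrightarrow> i < n \<Longrightarrow> v i \<in> cone_of v S \<longleftrightarrow> i \<in> S"
  by (auto simp: in_cone_iff h_vertex)

lemma ray_inj:
  assumes "i < n" "j < n" "v i = s *\<^sub>R v j" "s \<ge> 0"
  shows "i = j"
proof (rule ccontr)
  assume "i \<noteq> j"
  have "h (v i) i = s * h (v j) i"
    unfolding assms(3) using assms(4) by (simp add: h_scale)
  then show False
    using \<open>i \<noteq> j\<close> h_vertex[OF assms(1), of i] h_vertex[OF assms(2), of i] by simp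
qed

lemma inner_coords: "u \<bullet> x = (\<Sum>i<n. (u \<bullet> v i) * h x i)"
  by (subst h_sum[of x, symmetric]) (simp add: inner_sum_right mult.commute)

text \<open>The dual functionals cut the cone out of its linear span by half-spaces. Closedness lets
  the linear pieces of an interpolation be pasted to a continuous function.\<close>

lemma closed_cone:
  assumes "S \<in> C"
  shows "closed (cone_of v S)"
proof -
  have "\<forall>i. \<exists>u. \<forall>j\<in>S. u \<bullet> v j = (if j = i then 1 else 0)"
    using dual_functional[OF assms] by simp
  then obtain u where u: "\<forall>i. \<forall>j\<in>S. u i \<bullet> v j = (if j = i then 1 else 0)"
    unfolding choice_iff by blast
  have coeff: "u i \<bullet> (\<Sum>j\<in>S. c j *\<^sub>R v j) = c i" if "i \<in> S" for c i
  proof -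
    have "u i \<bullet> (\<Sum>j\<in>S. c j *\<^sub>R v j) = (\<Sum>j\<in>S. if j = i then c j else 0)"
      by (auto simp: inner_sum_right u intro!: sum.cong)
    then show ?thesis
      using that finite_cone[OF assms] by simp
  qed
  have "cone_of v S = span (v ` S) \<inter> (\<Inter>i\<in>S. {x. u i \<bullet> x \<ge> 0})"
  proof (intro equalityI subsetI)
    fix x assume "x \<in> cone_of v S"
    then obtain c where "x = (\<Sum>i\<in>S. c i *\<^sub>R v i)" "\<forall>i\<in>S. c i \<ge> 0"
      unfolding cone_of_def by auto
    then show "x \<in> span (v ` S) \<inter> (\<Inter>i\<in>S. {x. u i \<bullet> x \<ge> 0})"
      by (auto simp: coeff intro!: span_sum span_scale intro: span_base)
  next
    fix x assume x: "x \<in> span (v ` S) \<inter> (\<Inter>i\<in>S. {x. u i \<bullet> x \<ge> 0})"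
    then obtain d where "x = (\<Sum>y\<in>v ` S. d y *\<^sub>R y)"
      using finite_cone[OF assms] by (auto simp: span_finite)
    then have "x = (\<Sum>i\<in>S. d (v i) *\<^sub>R v i)"
      by (simp add: sum.reindex[OF inj_cone[OF assms]])
    then show "x \<in> cone_of v S"
      unfolding cone_of_def using x coeff by (intro CollectI exI[of _ "\<lambda>i. d (v i)"]) auto
  qed
  then show ?thesis
    by (auto intro!: closed_Int closed_INT closed_halfspace_ge)
qed

section \<open>Piecewise linear interpolation of values on the rays\<close>

definition interp :: "(nat \<Rightarrow> real) \<Rightarrow> real^3 \<Rightarrow> real" where
  "interp g x = (\<Sum>i<n. g i * h x i)"

lemma interp_vertex: "i < n \<Longrightarrow> interp g (v i) = g i"
proof -
  assume "i < n"
  then have "interp g (v i) = (\<Sum>j<n. if j = i then g j else 0)"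
    unfolding interp_def by (intro sum.cong) (auto simp: h_vertex)
  then show ?thesis using \<open>i < n\<close> by simp
qed

lemma interp_on_cone:
  assumes "S \<in> C" "\<And>j. j \<in> S \<Longrightarrow> u \<bullet> v j = g j" "x \<in> cone_of v S"
  shows "interp g x = u \<bullet> x"
  unfolding interp_def inner_coords[of u x]
  using assms(2) assms(3)[unfolded in_cone_iff[OF assms(1)]]
  by (intro sum.cong) force+

lemma interp_linear: "interp (\<lambda>i. u \<bullet> v i) x = u \<bullet> x"
  unfolding interp_def inner_coords[of u x] ..

lemma interp_add: "interp (\<lambda>i. f i + g i) x = interp f x + interp g x"
  by (simp add: interp_def distrib_right sum.distrib)

lemma interp_scale: "interp (\<lambda>i. c * f i) x = c * interp f x"
  by (simp add: interp_def sum_distrib_left mult.assoc)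

lemma continuous_interp: "continuous_on A (interp g)"
proof -
  have "continuous_on (\<Union>S\<in>C. cone_of v S) (interp g)"
  proof (rule continuous_on_closed_Union[OF finite_fan closed_cone])
    fix S assume S: "S \<in> C"
    obtain u where "\<forall>j\<in>S. u \<bullet> v j = g j"
      using dual_functional[OF S] by blast
    then show "continuous_on (cone_of v S) (interp g)"
      using interp_on_cone[OF S]
      by (subst continuous_on_cong[OF refl, of _ _ "\<lambda>x. u \<bullet> x"]) (auto intro: continuous_intros)
  qed
  then show ?thesis
    using cones_cover continuous_on_subset by (metis subset_UNIV)
qed

lemma continuous_h: "continuous_on A (\<lambda>x. h x i)"
proof (cases "i < n")
  case True
  have "interp (\<lambda>j. if j = i then 1 else 0) x = h x i" for x
  proof -
    have "interp (\<lambda>j. if j = i then 1 else 0) x = (\<Sum>j<n. if j = i then h x j else 0)"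
      unfolding interp_def by (intro sum.cong) auto
    then show ?thesis using True by simp
  qed
  then show ?thesis
    using continuous_interp[of A "\<lambda>j. if j = i then 1 else 0"] by simp
next
  case False
  then have "h x i = 0" for x
    using h_pos_in_range[of x i] h_nonneg[of x i] by force
  then show ?thesis by simp
qed

text \<open>Coordinates are nonnegative, so a positive value at a point needs a positive value at a
  ray of its carrier. This transfers signs from points of space to vertices of the complex.\<close>

lemma interp_pos: "interp g x > 0 \<Longrightarrow> \<exists>j<n. h x j > 0 \<and> g j > 0"
proof (rule ccontr)
  assume pos: "interp g x > 0" and "\<not> (\<exists>j<n. h x j > 0 \<and> g j > 0)"
  then have "g j * h x j \<le> 0" if "j < n" for j
    using h_nonneg[of x j] that by (metis less_eq_real_def linorder_not_le mult_nonpos_nonneg mult_zero_right)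
  then have "interp g x \<le> 0"
    unfolding interp_def by (intro sum_nonpos) auto
  with pos show False by simp
qed

lemma interp_neg: "interp g x < 0 \<Longrightarrow> \<exists>j<n. h x j > 0 \<and> g j < 0"
  using interp_pos[of "\<lambda>j. - g j" x] interp_scale[of "-1" g x] by auto

lemma interp_zero: "interp g 0 = 0"
  by (simp add: interp_def h_zero)

text \<open>The points with a positive coordinate in \<open>X\<close>, and those with one in
  \<open>Y\<close>, form open sets; on \<open>A\<close> they are disjoint and cover. Connectedness
  leaves only one of them.\<close>

lemma connected_cut:
  assumes "connected A"
    and cover: "\<And>x. x \<in> A \<Longrightarrow> (\<exists>i\<in>X \<union> Y. h x i > 0)"
    and disj: "\<And>x i j. x \<in> A \<Longrightarrow> i \<in> X \<Longrightarrow> j \<in> Y \<Longrightarrow> \<not> (h x i > 0 \<and> h x j > 0)"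
    and "x \<in> A" "\<exists>i\<in>X. h x i > 0" "y \<in> A"
  shows "\<exists>i\<in>X. h y i > 0"
proof -
  have op: "open (\<Union>i\<in>Z. {x. h x i > 0})" for Z
    by (intro open_UN ballI open_Collect_less continuous_h continuous_on_const)
  let ?U = "\<Union>i\<in>X. {x. h x i > 0}" and ?V = "\<Union>i\<in>Y. {x. h x i > 0}"
  have "A \<subseteq> ?U \<union> ?V"
    using cover by fastforce
  moreover have "?U \<inter> ?V \<inter> A = {}"
    using disj by auto
  moreover have "?U \<inter> A \<noteq> {}"
    using assms(4,5) by auto
  ultimately have "?V \<inter> A = {}"
    using connectedD[OF assms(1) op op] by blast
  then show ?thesis
    using \<open>y \<in> A\<close> \<open>A \<subseteq> ?U \<union> ?V\<close> by blast
qed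

text \<open>Connectivity of the subgraph induced on \<open>I\<close>, phrased by cuts.\<close>
definition conn :: "nat set \<Rightarrow> bool" where
  "conn I \<longleftrightarrow> I \<noteq> {} \<and> (\<forall>X\<subseteq>I. X \<noteq> {} \<longrightarrow> (\<forall>i\<in>X. \<forall>j\<in>I - X. {i, j} \<notin> C) \<longrightarrow> X = I)"

lemma conn_ne: "conn I \<Longrightarrow> I \<noteq> {}"
  by (simp add: conn_def)

lemma connD:
  assumes "conn I" "p \<in> I" "P p" "\<And>i j. i \<in> I \<Longrightarrow> j \<in> I \<Longrightarrow> P i \<Longrightarrow> {i, j} \<in> C \<Longrightarrow> P j" "q \<in> I"
  shows "P q"
proof -
  have "{i \<in> I. P i} = I"
    using assms unfolding conn_def by (elim conjE allE[of _ "{i \<in> I. P i}"]) blast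
  then show ?thesis using \<open>q \<in> I\<close> by blast
qed

lemma pair_in_fan: "h x i > 0 \<Longrightarrow> h x j > 0 \<Longrightarrow> {i, j} \<in> C"
  by (rule face[OF h_carrier[of x]]) auto

text \<open>A cut of the graph on \<open>I\<close> would separate \<open>A\<close>: two indices with
  positive coordinates at one point always span an edge, so no point of \<open>A\<close> sees both
  sides.\<close>

lemma conn_connected:
  assumes "connected A" "I \<noteq> {}" "I \<subseteq> {..<n}" "v ` I \<subseteq> A" "\<And>x. x \<in> A \<Longrightarrow> \<exists>j\<in>I. h x j > 0"
  shows "conn I"
  unfolding conn_def
proof (intro conjI allI impI)
  fix X assume X: "X \<subseteq> I" "X \<noteq> {}" "\<forall>i\<in>X. \<forall>j\<in>I - X. {i, j} \<notin> C"
  obtain i where i: "i \<in> X" using X by auto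
  show "X = I"
  proof (rule ccontr)
    assume "X \<noteq> I"
    then obtain j where j: "j \<in> I - X" using X by auto
    have "\<exists>k\<in>X. h (v j) k > 0"
    proof (rule connected_cut[OF assms(1)])
      show "\<exists>i\<in>X \<union> (I - X). h x i > 0" if "x \<in> A" for x
        using assms(5)[OF that] X(1) by (metis Un_Diff_cancel UnCI)
      show "\<not> (h x i > 0 \<and> h x j > 0)" if "x \<in> A" "i \<in> X" "j \<in> I - X" for x i j
        using pair_in_fan[of x i j] X(3) that by blast
      show "v i \<in> A" "v j \<in> A" using i j X(1) assms(4) by blast+
      show "\<exists>ia\<in>X. 0 < h (v i) ia"
        using i X(1) assms(3) by (intro bexI[of _ i]) (auto simp: h_vertex)
    qed
    then show False
      using j assms(3) by (auto simp: h_vertex subset_iff split: if_splits)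
  qed
qed (use assms in auto)

text \<open>The connected set is the union of the segments from a common centre \<open>e\<close> to
  the rays in \<open>I\<close>. The end \<open>t = 1\<close> is a ray of \<open>I\<close> itself,
  which is why only \<open>t < 1\<close> has to be checked.\<close>

lemma conn_starlike:
  assumes "I \<noteq> {}" "I \<subseteq> {..<n}"
    and "\<And>i t. i \<in> I \<Longrightarrow> 0 \<le> t \<Longrightarrow> t < 1 \<Longrightarrow> \<exists>j\<in>I. h (t *\<^sub>R v i + (1 - t) *\<^sub>R e) j > 0"
  shows "conn I"
proof (rule conn_connected)
  let ?A = "\<Union>i\<in>I. closed_segment e (v i)"
  show "connected ?A"
    by (rule connected_Union) (use assms(1) in \<open>auto intro: exI[of _ e]\<close>)
  show "\<exists>j\<in>I. h x j > 0" if x: "x \<in> ?A" for x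
  proof -
    obtain i t where it: "i \<in> I" "0 \<le> t" "t \<le> 1" "x = (1 - t) *\<^sub>R e + t *\<^sub>R v i"
      using x by (auto simp: in_segment)
    show ?thesis
    proof (cases "t = 1")
      case True
      then show ?thesis
        using it assms(2) by (intro bexI[of _ i]) (auto simp: h_vertex)
    next
      case False
      then show ?thesis
        using assms(3)[of i t] it by (auto simp: add.commute)
    qed
  qed
qed (use assms in auto)

end

section \<open>Triangles around edges and vertices\<close>

unbundle cross3_syntax

lemma cross_decomposition:
  fixes a b x :: "real^3"
  defines "c \<equiv> a \<times> b"
  shows "(c \<bullet> c) *\<^sub>R x = (x \<bullet> (b \<times> c)) *\<^sub>R a + (x \<bullet> (c \<times> a)) *\<^sub>R b + (x \<bullet> c) *\<^sub>R c"
  unfolding c_def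
  by (simp add: vec_eq_iff forall_3 cross3_def inner_vec_def sum_3, algebra)

lemma in_plane_cross:
  fixes a b x :: "real^3"
  assumes "a \<times> b \<noteq> 0" "(a \<times> b) \<bullet> x = 0"
  obtains \<alpha> \<beta> where "x = \<alpha> *\<^sub>R a + \<beta> *\<^sub>R b"
proof -
  define c where "c = a \<times> b"
  have cc: "c \<bullet> c \<noteq> 0" using assms by (simp add: c_def)
  have eq: "(c \<bullet> c) *\<^sub>R x = (x \<bullet> (b \<times> c)) *\<^sub>R a + (x \<bullet> (c \<times> a)) *\<^sub>R b"
    using cross_decomposition[of a b x] assms(2) by (simp add: c_def inner_commute)
  have "x = inverse (c \<bullet> c) *\<^sub>R ((c \<bullet> c) *\<^sub>R x)"
    using cc by simp
  then have "x = (inverse (c \<bullet> c) * (x \<bullet> (b \<times> c))) *\<^sub>R a + (inverse (c \<bullet> c) * (x \<bullet> (c \<times> a))) *\<^sub>R b"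
    unfolding eq by (simp add: scaleR_add_right)
  then show thesis by (rule that)
qed

context fan
begin

section \<open>Maximal cones and the two triangles at an edge\<close>

lemma near_cone_interior:
  assumes "S \<in> C"
  shows "\<exists>\<delta>>0. \<forall>z. norm z < \<delta> \<longrightarrow> (\<forall>i\<in>S. h ((\<Sum>i\<in>S. v i) + z) i > 0)"
proof -
  define y where "y = (\<Sum>i\<in>S. v i)"
  let ?U = "\<Inter>i\<in>S. {x. h x i > 0}"
  have "open ?U"
    using finite_cone[OF assms] by (intro open_INT ballI open_Collect_less continuous_h continuous_on_const)
  moreover have "y \<in> ?U"
    using h_cone[OF assms, of "\<lambda>_. 1"] by (auto simp: y_def)
  ultimately obtain d where "d > 0" "ball y d \<subseteq> ?U"
    using openE by blast
  then show ?thesis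
    unfolding y_def[symmetric] by (intro exI[of _ d]) (auto simp: subset_iff dist_norm)
qed

lemma small_multiple:
  fixes m :: "real^3"
  assumes "\<delta> > 0"
  obtains \<epsilon> :: real where "\<epsilon> > 0" "norm (\<epsilon> *\<^sub>R m) < \<delta>"
proof (cases "m = 0")
  case True
  then show thesis
    using assms by (intro that[of 1]) auto
next
  case False
  then show thesis
    using assms by (intro that[of "\<delta> / (2 * norm m)"]) auto
qed

text \<open>An interior point of the cone is pushed slightly out of the span of the generators. The
  old coordinates stay positive by continuity, and a new one must appear.\<close>

lemma extend_step:
  assumes "S \<in> C" "card S < 3"
  shows "\<exists>T\<in>C. S \<subset> T"
proof -
  have "dim (v ` S) \<le> card (v ` S)"
    using finite_cone[OF assms(1)] by (intro dim_le_card') auto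
  then have "dim (v ` S) < 3"
    using assms(2) card_image_le[OF finite_cone[OF assms(1)], of v] by linarith
  then have "span (v ` S) \<noteq> UNIV"
    using dim_span[of "v ` S"] by (auto simp del: dim_span)
  then obtain m where m: "m \<notin> span (v ` S)" by auto
  define y where "y = (\<Sum>i\<in>S. v i)"
  obtain \<delta> where \<delta>: "\<delta> > 0" "\<And>z. norm z < \<delta> \<Longrightarrow> \<forall>i\<in>S. h (y + z) i > 0"
    using near_cone_interior[OF assms(1)] unfolding y_def by blast
  obtain \<epsilon> where \<epsilon>: "\<epsilon> > 0" "norm (\<epsilon> *\<^sub>R m) < \<delta>"
    using small_multiple[OF \<delta>(1)] by metis
  define x where "x = y + \<epsilon> *\<^sub>R m"
  have pos: "\<forall>i\<in>S. h x i > 0"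
    using \<delta>(2)[OF \<epsilon>(2)] by (simp add: x_def)
  have "\<not> {i. h x i \<noteq> 0} \<subseteq> S"
  proof
    assume "{i. h x i \<noteq> 0} \<subseteq> S"
    then have "x \<in> cone_of v S"
      by (simp add: in_cone_iff[OF assms(1)])
    then have "x \<in> span (v ` S)"
      unfolding cone_of_def by (auto intro!: span_sum span_scale intro: span_base)
    moreover have "y \<in> span (v ` S)"
      unfolding y_def by (auto intro!: span_sum intro: span_base)
    ultimately have "\<epsilon> *\<^sub>R m \<in> span (v ` S)"
      using span_diff[of x "v ` S" y] by (simp add: x_def)
    then show False
      using m \<epsilon>(1) span_scale[of "\<epsilon> *\<^sub>R m" "v ` S" "inverse \<epsilon>"] by simp
  qed
  then show ?thesis
    using pos h_carrier[of x] by (intro bexI[of _ "{i. h x i \<noteq> 0}"]) force+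
qed

lemma extend_cone:
  assumes "S \<in> C"
  shows "\<exists>T\<in>C. S \<subseteq> T \<and> card T = 3"
  using assms
proof (induction "3 - card S" arbitrary: S rule: less_induct)
  case less
  show ?case
  proof (cases "card S = 3")
    case False
    then have "card S < 3" using card_cone[OF less.prems] by linarith
    then obtain T where T: "T \<in> C" "S \<subset> T"
      using extend_step less.prems by blast
    then have "card S < card T"
      using psubset_card_mono finite_cone by blast
    then have "3 - card T < 3 - card S" using \<open>card S < 3\<close> by linarith
    from less.hyps[OF this T(1)] show ?thesis
      using T(2) by blast
  qed (use less.prems in blast)
qed

lemma maximal_cone_iff: "maximal_cone C S \<longleftrightarrow> S \<in> C \<and> card S = 3"
proof
  assume "maximal_cone C S"
  then show "S \<in> C \<and> card S = 3"
    using extend_cone[of S] unfolding maximal_cone_def by metis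
next
  assume S: "S \<in> C \<and> card S = 3"
  have "T = S" if "T \<in> C" "S \<subseteq> T" for T
    using card_seteq[OF finite_cone[OF that(1)] that(2)] card_cone[OF that(1)] S by simp
  then show "maximal_cone C S"
    using S unfolding maximal_cone_def by blast
qed

lemma not_parallel:
  assumes "{i, k} \<in> C" "i \<noteq> k"
  shows "v k \<noteq> c *\<^sub>R v i"
proof
  assume "v k = c *\<^sub>R v i"
  moreover obtain u where "\<forall>j\<in>{i, k}. u \<bullet> v j = (if j = k then 1 else 0)"
    using dual_functional[OF assms(1), of "\<lambda>j. if j = k then 1 else 0"] by auto
  ultimately show False using assms(2) by auto
qed

lemma edge_cross_nonzero:
  assumes "{i, k} \<in> C" "i \<noteq> k"
  shows "v i \<times> v k \<noteq> 0"
proof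
  assume "v i \<times> v k = 0"
  then have "collinear {0, v i, v k}"
    by (simp add: cross_eq_0)
  moreover have "v i \<noteq> 0"
    using in_range[OF assms(1)] nonzero by simp
  ultimately show False
    using not_parallel[OF assms] by (auto simp: collinear_lemma)
qed

lemma triangle_off_plane:
  assumes "{i, k, a} \<in> C" "i \<noteq> k" "a \<noteq> i" "a \<noteq> k"
  shows "(v i \<times> v k) \<bullet> v a \<noteq> 0"
proof
  assume 0: "(v i \<times> v k) \<bullet> v a = 0"
  have "v i \<times> v k \<noteq> 0"
    using assms by (intro edge_cross_nonzero face[OF assms(1)]) auto
  from in_plane_cross[OF this 0] obtain \<alpha> \<beta> where "v a = \<alpha> *\<^sub>R v i + \<beta> *\<^sub>R v k" .
  moreover obtain u where "\<forall>j\<in>{i, k, a}. u \<bullet> v j = (if j = a then 1 else 0)"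
    using dual_functional[OF assms(1), of "\<lambda>j. if j = a then 1 else 0"] by auto
  ultimately have "u \<bullet> (\<alpha> *\<^sub>R v i + \<beta> *\<^sub>R v k) = 1" "u \<bullet> v i = 0" "u \<bullet> v k = 0"
    using assms by auto
  then show False by (simp add: inner_add_right)
qed

text \<open>The point \<open>v i + v k\<close>, moved slightly along the normal to the side chosen
  by the sign of \<open>s\<close>, has a carrier that contains the edge and, by
  \<open>interp_pos\<close>, a ray on that side.\<close>

lemma edge_side_ex:
  assumes "{i, k} \<in> C" "i \<noteq> k" "s \<noteq> 0"
  shows "\<exists>a. {i, k, a} \<in> C \<and> s * ((v i \<times> v k) \<bullet> v a) > 0"
proof -
  let ?m = "v i \<times> v k"
  obtain \<delta> where \<delta>: "\<delta> > 0" "\<And>z. norm z < \<delta> \<Longrightarrow> \<forall>j\<in>{i, k}. h (v i + v k + z) j > 0"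
    using near_cone_interior[OF assms(1)] assms(2) by auto
  obtain \<epsilon> where \<epsilon>: "\<epsilon> > 0" "norm (\<epsilon> *\<^sub>R (s *\<^sub>R ?m)) < \<delta>"
    using small_multiple[OF \<delta>(1)] by metis
  define x where "x = v i + v k + \<epsilon> *\<^sub>R (s *\<^sub>R ?m)"
  have pos: "\<forall>j\<in>{i, k}. h x j > 0"
    using \<delta>(2)[OF \<epsilon>(2)] by (simp add: x_def)
  have mx: "?m \<bullet> x = \<epsilon> * s * (?m \<bullet> ?m)"
    by (simp add: x_def inner_add_right dot_cross_self)
  have "s * (?m \<bullet> x) = \<epsilon> * (s * s) * (?m \<bullet> ?m)"
    unfolding mx by simp
  also have "\<dots> > 0"
  proof -
    have "s * s > 0" using assms(3) by (metis not_real_square_gt_zero)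
    then show ?thesis
      using \<epsilon>(1) edge_cross_nonzero[OF assms(1,2)] by simp
  qed
  finally have "interp (\<lambda>j. s * (?m \<bullet> v j)) x > 0"
    by (simp add: interp_scale interp_linear)
  then obtain a where a: "h x a > 0" "s * (?m \<bullet> v a) > 0"
    using interp_pos by blast
  then have "{i, k, a} \<in> C"
    using pos by (intro face[OF h_carrier[of x]]) auto
  then show ?thesis using a by blast
qed

text \<open>Two triangles on one side of an edge would overlap: a point far enough along the edge
  lies in both cones and gets two different coordinate expansions.\<close>

lemma edge_side_unique:
  assumes "{i, k, a} \<in> C" "{i, k, b} \<in> C" "i \<noteq> k"
    and s: "s * ((v i \<times> v k) \<bullet> v a) > 0" "s * ((v i \<times> v k) \<bullet> v b) > 0"
  shows "a = b"
proof (rule ccontr)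
  assume "a \<noteq> b"
  let ?m = "v i \<times> v k"
  have ne: "a \<noteq> i" "a \<noteq> k" "b \<noteq> i" "b \<noteq> k"
    using s by (auto simp: dot_cross_self)
  define \<gamma> where "\<gamma> = (?m \<bullet> v a) / (?m \<bullet> v b)"
  have \<gamma>: "\<gamma> > 0" "?m \<bullet> v b \<noteq> 0"
    using s by (auto simp: \<gamma>_def zero_less_mult_iff zero_less_divide_iff)
  have "?m \<bullet> (v a - \<gamma> *\<^sub>R v b) = 0"
    using \<gamma>(2) by (simp add: inner_diff_right \<gamma>_def)
  moreover have "?m \<noteq> 0"
    using assms(3) by (intro edge_cross_nonzero face[OF assms(1)]) auto
  ultimately obtain \<alpha> \<beta> where ab: "v a - \<gamma> *\<^sub>R v b = \<alpha> *\<^sub>R v i + \<beta> *\<^sub>R v k"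
    using in_plane_cross by blast
  \<comment> \<open>Large enough to make the coefficients \<open>K + \<alpha>\<close> and
    \<open>K + \<beta>\<close> of the expansion through \<open>b\<close> nonnegative.\<close>
  define K where "K = \<bar>\<alpha>\<bar> + \<bar>\<beta>\<bar>"
  have K: "K \<ge> 0" "K + \<alpha> \<ge> 0" "K + \<beta> \<ge> 0" by (auto simp: K_def)
  define y where "y = v a + K *\<^sub>R (v i + v k)"
  define c where "c j = (if j = a then 1 else K)" for j
  define d where "d j = (if j = b then \<gamma> else if j = i then K + \<alpha> else K + \<beta>)" for j
  have "y = (\<Sum>j\<in>{i, k, a}. c j *\<^sub>R v j)"
    using ne assms(3) by (simp add: y_def c_def scaleR_add_right)
  then have 1: "h y b = 0"
    using h_cone[OF assms(1), of c] K(1) \<open>a \<noteq> b\<close> ne by (auto simp: c_def)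
  have "v a = \<gamma> *\<^sub>R v b + (\<alpha> *\<^sub>R v i + \<beta> *\<^sub>R v k)"
    using ab by (simp add: algebra_simps)
  then have "y = (\<Sum>j\<in>{i, k, b}. d j *\<^sub>R v j)"
    using ne assms(3) by (simp add: y_def d_def algebra_simps)
  then have "h y b = \<gamma>"
    using h_cone[OF assms(2), of d] K \<gamma>(1) by (auto simp: d_def)
  then show False using 1 \<gamma>(1) by simp
qed

lemma edge_triangles:
  assumes "{i, k} \<in> C" "i \<noteq> k"
  obtains a b where "{i, k, a} \<in> C" "{i, k, b} \<in> C"
    "(v i \<times> v k) \<bullet> v a > 0" "(v i \<times> v k) \<bullet> v b < 0"
    "\<forall>x. {i, k, x} \<in> C \<longrightarrow> x \<noteq> i \<longrightarrow> x \<noteq> k \<longrightarrow> x = a \<or> x = b"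
proof -
  obtain a where a: "{i, k, a} \<in> C" "(v i \<times> v k) \<bullet> v a > 0"
    using edge_side_ex[OF assms, of 1] by auto
  obtain b where b: "{i, k, b} \<in> C" "(v i \<times> v k) \<bullet> v b < 0"
    using edge_side_ex[OF assms, of "-1"] by auto
  have "x = a \<or> x = b" if x: "{i, k, x} \<in> C" "x \<noteq> i" "x \<noteq> k" for x
    using triangle_off_plane[OF x(1) assms(2) x(2,3)]
      edge_side_unique[OF x(1) a(1) assms(2), of 1] edge_side_unique[OF x(1) b(1) assms(2), of "-1"] a b
    by (cases "(v i \<times> v k) \<bullet> v x > 0") auto
  then show thesis using a b that by blast
qed

lemma edge_range: "{i, k} \<in> C \<Longrightarrow> i < n \<and> k < n"
  using in_range by blast

lemma n_pos: "n > 0"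
proof -
  obtain i where "i < n"
    using h_pos_ex[of "axis 1 1"] by (auto simp: axis_eq_0_iff)
  then show ?thesis by simp
qed

section \<open>Connectedness of the whole graph, of the graph without a vertex, and of vertex
  links\<close>

lemma conn_all: "conn {..<n}"
proof (rule conn_connected)
  show "connected (- {0 :: real^3})"
    by (rule connected_punctured_universe) simp
qed (use n_pos nonzero h_pos_ex in auto)

text \<open>The star is centred at \<open>- v p\<close>: a segment from another ray to this point
  never meets the ray of \<open>p\<close>, so each of its points has a carrier with a vertex besides
  \<open>p\<close>.\<close>

lemma conn_delete:
  assumes "p < n"
  shows "conn ({..<n} - {p})"
proof (rule conn_starlike)
  \<comment> \<open>The case \<open>t = 0\<close> is stated for arbitrary \<open>i\<close>, since it
    also shows that the set is not empty, before any \<open>i\<close> in it is known.\<close>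
  have *: "\<exists>j\<in>{..<n} - {p}. h (t *\<^sub>R v i + (1 - t) *\<^sub>R (- v p)) j > 0"
    if it: "t = 0 \<or> i \<in> {..<n} - {p}" "0 \<le> t" "t < 1" for i t
  proof (rule ccontr)
    assume neg: "\<not> ?thesis"
    define x where "x = t *\<^sub>R v i + (1 - t) *\<^sub>R (- v p)"
    have "h x j = 0" if "j \<noteq> p" for j
      using neg h_nonneg[of x j] h_pos_in_range[of x j] that unfolding x_def[symmetric]
      by (metis DiffI empty_iff insertE lessThan_iff less_eq_real_def)
    then have "x = (\<Sum>j<n. if j = p then h x p *\<^sub>R v p else 0)"
      by (subst h_sum[of x, symmetric]) (intro sum.cong, auto)
    also have "\<dots> = h x p *\<^sub>R v p" using assms by simp
    finally have x: "t *\<^sub>R v i = (h x p + 1 - t) *\<^sub>R v p"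
      by (simp add: x_def algebra_simps)
    show False
    proof (cases "t = 0")
      case True
      then show False
        using x h_nonneg[of x p] nonzero[OF assms] by simp
    next
      case False
      then have "v i = inverse t *\<^sub>R (t *\<^sub>R v i)" by simp
      also have "\<dots> = ((h x p + 1 - t) / t) *\<^sub>R v p"
        unfolding x by (simp add: divide_inverse mult.commute)
      finally have "v i = ((h x p + 1 - t) / t) *\<^sub>R v p" .
      then have "i = p"
        by (rule ray_inj[rotated 2]) (use it False assms h_nonneg[of x p] in auto)
      then show False using it False by simp
    qed
  qed
  show "{..<n} - {p} \<noteq> {}"
    using *[of 0 p] by auto
  show "\<exists>j\<in>{..<n} - {p}. h (t *\<^sub>R v i + (1 - t) *\<^sub>R (- v p)) j > 0"
    if "i \<in> {..<n} - {p}" "0 \<le> t" "t < 1" for i t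
    using * that by blast
qed auto

text \<open>The link of a vertex is connected. This is read off from a punctured disc around
  \<open>v x\<close> in the plane through \<open>v x\<close> orthogonal to \<open>v x\<close>, where
  each point has positive coordinates at \<open>x\<close> and at some neighbour of
  \<open>x\<close>.\<close>

lemma constant_around_vertex:
  assumes x: "x < n"
    and F: "\<And>k a b. {x, k, a} \<in> C \<Longrightarrow> {x, k, b} \<in> C \<Longrightarrow> card {x, k, a} = 3 \<Longrightarrow> card {x, k, b} = 3
      \<Longrightarrow> F {x, k, a} = F {x, k, b}"
    and ST: "S \<in> C" "T \<in> C" "card S = 3" "card T = 3" "x \<in> S" "x \<in> T"
  shows "F S = F T"
proof -
  let ?L = "{k. k \<noteq> x \<and> {x, k} \<in> C}"
  \<comment> \<open>Neighbours of \<open>x\<close> on some triangle where \<open>F\<close> has the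
    value \<open>F S\<close>; this set is shown to be closed under adjacency in the link.\<close>
  define P where "P = {k\<in>?L. \<exists>a. {x, k, a} \<in> C \<and> card {x, k, a} = 3 \<and> F {x, k, a} = F S}"
  obtain \<delta> where \<delta>: "\<delta> > 0" "\<And>z. norm z < \<delta> \<Longrightarrow> h (v x + z) x > 0"
    using near_cone_interior[OF vertex[OF x]] by auto
  define B where "B = {z. v x \<bullet> z = v x \<bullet> v x} \<inter> ball (v x) \<delta>"
  let ?A = "B - {v x}"
  have vx: "v x \<bullet> v x > 0" using nonzero[OF x] by simp
  have "aff_dim B = 2"
  proof -
    have "aff_dim B = aff_dim {z. v x \<bullet> z = v x \<bullet> v x}"
      unfolding B_def using \<delta>(1) by (intro aff_dim_convex_Int_open) (auto simp: convex_hyperplane)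
    then show ?thesis using nonzero[OF x] by (simp add: aff_dim_hyperplane)
  qed
  then have A: "connected ?A"
    by (intro path_connected_imp_connected path_connected_punctured_convex)
       (auto simp: B_def convex_hyperplane intro: convex_Int)
  have link: "\<exists>k\<in>?L. h z k > 0" and pos: "h z x > 0" if z: "z \<in> ?A" for z
  proof -
    have "norm (z - v x) < \<delta>" using z by (simp add: B_def dist_norm norm_minus_commute)
    from \<delta>(2)[OF this] show p: "h z x > 0" by simp
    have "\<exists>k. k \<noteq> x \<and> h z k > 0"
    proof (rule ccontr)
      assume "\<not> ?thesis"
      then have "h z k = 0" if "k \<noteq> x" for k
        using h_nonneg[of z k] that by force
      then have "z = (\<Sum>j<n. if j = x then h z x *\<^sub>R v x else 0)"
        by (subst h_sum[of z, symmetric]) (intro sum.cong, auto)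
      then have zz: "z = h z x *\<^sub>R v x" using x by simp
      then have "v x \<bullet> v x = h z x * (v x \<bullet> v x)"
        using z unfolding B_def by (metis (mono_tags, lifting) DiffD1 IntD1 inner_scaleR_right mem_Collect_eq)
      then have "h z x = 1" using vx by simp
      then show False using zz z by simp
    qed
    then show "\<exists>k\<in>?L. h z k > 0"
      using p pair_in_fan by blast
  qed
  have pt: "\<exists>z\<in>?A. h z k > 0 \<and> (\<forall>j. j \<noteq> x \<longrightarrow> j \<noteq> k \<longrightarrow> h z j = 0)" if k: "k \<in> ?L" for k
  proof -
    define c where "c = (v x \<bullet> v k) / (v x \<bullet> v x)"
    define y where "y = v k - c *\<^sub>R v x"
    have y0: "y \<noteq> 0"
      using not_parallel[of x k c] k by (auto simp: y_def)
    \<comment> \<open>The second bound forces \<open>\<epsilon> * c < 1\<close>, so that the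
      coordinate \<open>1 - \<epsilon> * c\<close> of \<open>z\<close> at \<open>x\<close> is
      positive.\<close>
    define \<delta>' where "\<delta>' = min \<delta> (norm y / (\<bar>c\<bar> + 1))"
    have "\<delta>' > 0" using \<delta>(1) y0 by (simp add: \<delta>'_def add_nonneg_pos)
    then obtain \<epsilon> where \<epsilon>: "\<epsilon> > 0" "norm (\<epsilon> *\<^sub>R y) < \<delta>'"
      using small_multiple by metis
    define z where "z = v x + \<epsilon> *\<^sub>R y"
    have "\<epsilon> * norm y < norm y / (\<bar>c\<bar> + 1)"
      using \<epsilon> by (simp add: \<delta>'_def)
    then have "(\<epsilon> * (\<bar>c\<bar> + 1)) * norm y < 1 * norm y"
      by (simp add: field_simps add_nonneg_pos)
    then have "\<epsilon> * (\<bar>c\<bar> + 1) < 1"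
      using y0 by (simp only: mult_less_cancel_right) simp
    then have "\<epsilon> * c < 1"
      using \<epsilon>(1) by (smt (verit) mult_left_mono)
    moreover have "z = (1 - \<epsilon> * c) *\<^sub>R v x + \<epsilon> *\<^sub>R v k"
      by (simp add: z_def y_def algebra_simps)
    then have "z = (\<Sum>j\<in>{x, k}. (if j = k then \<epsilon> else 1 - \<epsilon> * c) *\<^sub>R v j)"
      using k by simp
    ultimately have hz: "h z = (\<lambda>j. if j \<in> {x, k} then if j = k then \<epsilon> else 1 - \<epsilon> * c else 0)"
      using h_cone[of "{x, k}" "\<lambda>j. if j = k then \<epsilon> else 1 - \<epsilon> * c"] k \<epsilon>(1) by auto
    have "v x \<bullet> y = 0" using vx by (simp add: y_def c_def inner_diff_right)
    then have "z \<in> ?A"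
      using \<epsilon> y0 by (simp add: B_def z_def \<delta>'_def dist_norm inner_add_right)
    then show ?thesis using hz \<epsilon>(1) by (intro bexI[of _ z]) auto
  qed
  have rep: "\<exists>k\<in>?L. \<exists>a. T = {x, k, a}" if T: "T \<in> C" "card T = 3" "x \<in> T" for T
  proof -
    have "card (T - {x}) = 2" using T by simp
    then obtain k a where ka: "T - {x} = {k, a}" "k \<noteq> a" by (auto simp: card_2_iff)
    then have T': "T = {x, k, a}" using T(3) by auto
    then have "{x, k} \<in> C" by (intro face[OF T(1)]) auto
    then show ?thesis using ka T' by (intro bexI[of _ k] exI[of _ a]) auto
  qed
  obtain k a where k: "k \<in> ?L" "S = {x, k, a}" using rep[of S] ST by auto
  obtain q b where q: "q \<in> ?L" "T = {x, q, b}" using rep[of T] ST by auto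
  have kP: "k \<in> P" using k ST by (auto simp: P_def)
  obtain z where z: "z \<in> ?A" "h z k > 0" using pt[OF k(1)] by blast
  obtain z' where z': "z' \<in> ?A" "\<And>j. j \<noteq> x \<Longrightarrow> j \<noteq> q \<Longrightarrow> h z' j = 0" using pt[OF q(1)] by blast
  have "\<exists>i\<in>P. h z' i > 0"
  proof (rule connected_cut[OF A])
    show "\<exists>i\<in>P \<union> (?L - P). h w i > 0" if "w \<in> ?A" for w
      using link[OF that] by blast
    show "\<not> (h w i > 0 \<and> h w j > 0)" if w: "w \<in> ?A" "i \<in> P" "j \<in> ?L - P" for w i j
    proof
      assume "h w i > 0 \<and> h w j > 0"
      then have C: "{x, i, j} \<in> C"
        using pos[OF w(1)] by (intro face[OF h_carrier[of w]]) auto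
      have c3: "card {x, i, j} = 3" using w by (auto simp: P_def card_insert_if)
      obtain a where "{x, i, a} \<in> C" "card {x, i, a} = 3" "F {x, i, a} = F S"
        using w(2) by (auto simp: P_def)
      then have "F {x, i, j} = F S" using F[OF C _ c3] by metis
      then have "j \<in> P" using w(3) C c3 unfolding P_def
        by (simp add: insert_commute exI[of _ i])
      then show False using w(3) by blast
    qed
  qed (use z z' kP in auto)
  then obtain i where "i \<in> P" "h z' i > 0" by blast
  then have "q \<in> P" using z'(2)[of i] by (cases "i = q") (auto simp: P_def)
  then obtain c where "{x, q, c} \<in> C" "card {x, q, c} = 3" "F {x, q, c} = F S"
    by (auto simp: P_def)
  then show ?thesis using F[of q c b] q(2) ST by simp
qed

text \<open>Neighbouring vertices share a triangle, so values that agree around each vertex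
  propagate through the connected graph. This serves both coefficients of 2-cycles and gradients of
  piecewise linear functions.\<close>

lemma constant_on_triangles:
  assumes F: "\<And>x k a b. {x, k, a} \<in> C \<Longrightarrow> {x, k, b} \<in> C \<Longrightarrow> card {x, k, a} = 3 \<Longrightarrow> card {x, k, b} = 3
      \<Longrightarrow> F {x, k, a} = F {x, k, b}"
    and ST: "S \<in> C" "T \<in> C" "card S = 3" "card T = 3"
  shows "F S = F T"
proof -
  obtain p q where pq: "p \<in> S" "q \<in> T" using ST by fastforce
  have around: "F S' = F T'"
    if "x < n" "S' \<in> C" "T' \<in> C" "card S' = 3" "card T' = 3" "x \<in> S'" "x \<in> T'" for x S' T'
    by (rule constant_around_vertex[OF that(1) _ that(2-)]) (rule F)
  have range: "p < n" "q < n" using pq ST in_range by blast+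
  define Q where "Q x \<longleftrightarrow> (\<forall>T\<in>C. card T = 3 \<longrightarrow> x \<in> T \<longrightarrow> F T = F S)" for x
  have "Q q"
  proof (rule connD[OF conn_all])
    show "Q p" unfolding Q_def
      using around[OF range(1) _ ST(1) _ ST(3)] pq by blast
    fix i j assume ij: "i \<in> {..<n}" "j \<in> {..<n}" "Q i" "{i, j} \<in> C"
    obtain T where T: "T \<in> C" "{i, j} \<subseteq> T" "card T = 3"
      using extend_cone[OF ij(4)] by blast
    then have "F T = F S" using ij(3) by (auto simp: Q_def)
    then show "Q j" unfolding Q_def
      using around[of j _ T] ij(2) T by auto
  qed (use range in auto)
  then show ?thesis using ST pq by (auto simp: Q_def)
qed

end

section \<open>Simplicial homology of induced subcomplexes\<close>

lemma sum_antisymmetric: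
  fixes t :: "'a \<Rightarrow> 'a \<Rightarrow> complex"
  assumes "\<And>x y. x \<in> A \<Longrightarrow> y \<in> A \<Longrightarrow> t x y = - t y x"
  shows "(\<Sum>x\<in>A. \<Sum>y\<in>A. t x y) = 0"
proof -
  have "(\<Sum>x\<in>A. \<Sum>y\<in>A. t x y) = (\<Sum>x\<in>A. \<Sum>y\<in>A. - t y x)"
    using assms by (intro sum.cong refl)
  also have "\<dots> = - (\<Sum>x\<in>A. \<Sum>y\<in>A. t y x)"
    by (simp add: sum_negf)
  also have "(\<Sum>x\<in>A. \<Sum>y\<in>A. t y x) = (\<Sum>x\<in>A. \<Sum>y\<in>A. t x y)"
    by (rule sum.swap)
  finally show ?thesis by simp
qed

text \<open>The incidence sign of the vertex \<open>x\<close> in the edge spanned by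
  \<open>x\<close> and \<open>y\<close>, as produced by the ordering convention of
  \<open>bd\<close>.\<close>

definition sg :: "nat \<Rightarrow> nat \<Rightarrow> complex" where
  "sg x y = (if x < y then - 1 else 1)"

lemma sg_sq [simp]: "sg x y * sg x y = 1"
  and sg_swap: "x \<noteq> y \<Longrightarrow> sg y x = - sg x y"
  and sg_nonzero [simp]: "sg x y \<noteq> 0"
  by (auto simp: sg_def)

lemma bd_empty: "bd V c {} = (\<Sum>x\<in>V. c {x})"
  by (simp add: bd_def)

lemma bd_vertex: "bd V c {x} = (\<Sum>y\<in>V - {x}. sg x y * c {x, y})"
proof -
  have "{z \<in> {x}. z < y} = (if x < y then {x} else {})" for y
    by auto
  then show ?thesis
    unfolding bd_def by (intro sum.cong) (auto simp: sg_def insert_commute)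
qed

lemma bd_add: "bd V (\<lambda>F. a F + b F) F = bd V a F + bd V b F"
  by (simp add: bd_def sum.distrib distrib_left)

lemma bd_scale: "bd V (\<lambda>F. z * b F) F = z * bd V b F"
  by (simp add: bd_def sum_distrib_left mult.left_commute)

lemma bd_diff: "bd V (\<lambda>F. a F - b F) F = bd V a F - bd V b F"
  by (simp add: bd_def sum_subtractf right_diff_distrib)

lemma bd_sum: "bd V (\<lambda>F. \<Sum>i\<in>A. b i F) F = (\<Sum>i\<in>A. bd V (b i) F)"
  unfolding bd_def by (subst sum.swap) (simp add: sum_distrib_left)

lemma bd_nonzeroE:
  assumes "bd V c F \<noteq> 0"
  obtains x where "x \<in> V" "x \<notin> F" "c (insert x F) \<noteq> 0"
  using assms unfolding bd_def by (metis (no_types, lifting) DiffE mult_zero_right sum.not_neutral_contains_not_neutral)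

text \<open>Inserting two vertices in either order reaches the same face with opposite signs, so the
  double sum is antisymmetric.\<close>

lemma bd_bd:
  assumes "finite F"
  shows "bd V (bd V c) F = 0"
proof -
  let ?e = "\<lambda>F x. (-1 :: complex) ^ card {y\<in>F. y < x}"
  let ?t = "\<lambda>x y. if x = y then 0 else ?e F x * ?e F y * sg x y * c (insert y (insert x F))"
  have e: "?e (insert x F) y = ?e F y * sg x y" if "x \<notin> F" for x y
  proof -
    have "{z \<in> insert x F. z < y} = (if x < y then insert x {z\<in>F. z < y} else {z\<in>F. z < y})"
      by auto
    then show ?thesis using assms that by (simp only: split: if_split) (simp add: sg_def)
  qed
  have "bd V (bd V c) F = (\<Sum>x\<in>V - F. \<Sum>y\<in>V - insert x F.
      ?e F x * (?e (insert x F) y * c (insert y (insert x F))))"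
    unfolding bd_def by (simp add: sum_distrib_left)
  also have "\<dots> = (\<Sum>x\<in>V - F. \<Sum>y\<in>V - F. ?t x y)"
  proof (rule sum.cong[OF refl])
    fix x assume x: "x \<in> V - F"
    show "(\<Sum>y\<in>V - insert x F. ?e F x * (?e (insert x F) y * c (insert y (insert x F))))
      = (\<Sum>y\<in>V - F. ?t x y)"
    proof (cases "finite V")
      case True
      have "?e F x * (?e (insert x F) y * c (insert y (insert x F))) = ?t x y"
        if "y \<in> V - insert x F" for y
        using x that by (subst e) auto
      then show ?thesis
        using x True by (intro sum.mono_neutral_cong_left) auto
    next
      \<comment> \<open>For infinite \<open>V\<close> both index sets are infinite and both sums are
        0 by default.\<close>
      case False
      then show ?thesis
        using assms by (simp add: Diff_infinite_finite)
    qed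
  qed
  also have "\<dots> = 0"
  proof (rule sum_antisymmetric)
    fix x y
    show "?t x y = - ?t y x"
      using sg_swap[of x y] by (simp add: insert_commute)
  qed
  finally show ?thesis .
qed

lemma bd_edge:
  assumes "finite V" "a \<in> V" "b \<in> V" "a \<noteq> b"
  shows "bd V (\<lambda>F. if F = {a, b} then z else 0) F
    = (if F = {a} then sg a b * z else if F = {b} then sg b a * z else 0)"
proof (cases "\<exists>x. F = {x}")
  case True
  then obtain x where F: "F = {x}" by blast
  have "bd V (\<lambda>F. if F = {a, b} then z else 0) {x}
      = (\<Sum>y\<in>V - {x}. if y = (if x = a then b else a) then (if x = a \<or> x = b then sg x y * z else 0) else 0)"
    unfolding bd_vertex using assms(4) by (intro sum.cong) (auto simp: doubleton_eq_iff)
  also have "\<dots> = (if x = a then sg a b * z else if x = b then sg b a * z else 0)"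
    using assms by auto
  finally show ?thesis using F by auto
next
  case False
  have "bd V (\<lambda>F. if F = {a, b} then z else 0) F = 0"
  proof (rule ccontr)
    assume "\<not> ?thesis"
    then obtain x where "x \<notin> F" "insert x F = {a, b}"
      by (rule bd_nonzeroE) (auto split: if_splits)
    then have "F = {a, b} - {x}" "x \<in> {a, b}" by auto
    then show False using False assms(4) by auto
  qed
  then show ?thesis using False by auto
qed

lemma acyclicD:
  assumes "acyclic L V" "chain L d c" "\<And>F. bd V c F = 0"
  obtains b where "chain L (Suc d) b" "bd V b = c"
proof -
  have "chain L d c \<and> (\<forall>F. bd V c F = 0)" using assms by simp
  with assms(1) have "\<exists>b. chain L (Suc d) b \<and> bd V b = c"
    unfolding acyclic_def by (elim allE impE)
  then show thesis using that by auto
qed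

definition vertex_diff :: "nat \<Rightarrow> nat \<Rightarrow> nat set \<Rightarrow> complex" where
  "vertex_diff p q F = (if F = {p} then 1 else if F = {q} then - 1 else 0)"

lemma bd_vertex_diff:
  assumes "finite V" "p \<in> V" "q \<in> V" "p \<noteq> q"
  shows "bd V (vertex_diff p q) F = 0"
proof (cases "F = {}")
  case True
  have "bd V (vertex_diff p q) {} = (\<Sum>x\<in>V. (if x = p then 1 else 0) + (if x = q then - 1 else 0))"
    unfolding bd_empty vertex_diff_def using assms by (intro sum.cong) auto
  then show ?thesis using assms True by (simp add: sum.distrib)
next
  case False
  show ?thesis
  proof (rule ccontr)
    assume "bd V (vertex_diff p q) F \<noteq> 0"
    then obtain x where "x \<notin> F" "insert x F = {p} \<or> insert x F = {q}"
      by (rule bd_nonzeroE) (auto simp: vertex_diff_def split: if_splits)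
    then show False using False by blast
  qed
qed

context fan
begin

section \<open>Orientation of triangles and the fundamental cycle\<close>

abbreviation K :: "nat set \<Rightarrow> nat set set" where
  "K I \<equiv> {J\<in>C. J \<subseteq> I}"

text \<open>The sign of the determinant of the generators in increasing order, which compares the
  vertex order with the orientation of space. Taken as coefficients on all triangles, these signs
  form the fundamental cycle of the sphere.\<close>

definition om :: "nat set \<Rightarrow> complex" where
  "om S = (let l = sorted_list_of_set S in of_real (sgn ((v (l ! 0) \<times> v (l ! 1)) \<bullet> v (l ! 2))))"

lemma om_sorted:
  assumes "i < j" "j < k"
  shows "om {i, j, k} = of_real (sgn ((v i \<times> v j) \<bullet> v k))"
proof -
  have "sorted_list_of_set (set [i, j, k]) = [i, j, k]"
    using assms by (intro sorted_list_of_set.idem_if_sorted_distinct) auto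
  then show ?thesis by (simp add: om_def)
qed

text \<open>The position of \<open>x\<close> in the vertex order enters both signs and cancels. What
  remains is the side of the edge's plane on which \<open>x\<close> lies, hence opposite signs for
  the two triangles at an edge.\<close>

lemma om_edge:
  assumes "i < k" "x \<noteq> i" "x \<noteq> k"
  shows "(-1) ^ card {y\<in>{i, k}. y < x} * om {i, k, x} = of_real (sgn ((v i \<times> v k) \<bullet> v x))"
proof -
  consider "x < i" | "i < x" "x < k" | "k < x" using assms by linarith
  then show ?thesis
  proof cases
    case 1
    then have eq: "{y\<in>{i, k}. y < x} = {}" "{i, k, x} = {x, i, k}" using assms by auto
    then show ?thesis
      unfolding eq using om_sorted[OF 1 assms(1)] cross_triple[of "v x" "v i" "v k"] by simp
  next
    case 2
    then have eq: "{y\<in>{i, k}. y < x} = {i}" "{i, k, x} = {i, x, k}" using assms by auto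
    have "(v i \<times> v x) \<bullet> v k = - ((v i \<times> v k) \<bullet> v x)"
      by (simp add: cross3_simps)
    then show ?thesis
      unfolding eq using om_sorted[OF 2] by (simp add: sgn_minus)
  next
    case 3
    then have eq: "{y\<in>{i, k}. y < x} = {i, k}" using assms by auto
    then show ?thesis
      unfolding eq using om_sorted[OF assms(1) 3] assms by simp
  qed
qed

lemma triangle_cases:
  assumes "card S = 3"
  obtains i j k where "S = {i, j, k}" "i < j" "j < (k :: nat)"
proof -
  obtain l where l: "sorted l" "distinct l" "set l = S"
    using assms finite_distinct_list[of S] finite_sorted_distinct_unique[of S]
    by (metis card.infinite zero_neq_numeral)
  then have "length l = 3" using assms distinct_card by metis
  then obtain i j k where "l = [i, j, k]"
    by (auto simp: numeral_3_eq_3 length_Suc_conv)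
  then show thesis using l by (intro that[of i j k]) auto
qed

lemma om_sq:
  assumes "S \<in> C" "card S = 3"
  shows "om S * om S = 1"
proof -
  obtain i j k where S: "S = {i, j, k}" "i < j" "j < k"
    using triangle_cases[OF assms(2)] .
  have "(v i \<times> v j) \<bullet> v k \<noteq> 0"
    using assms(1) S by (intro triangle_off_plane) auto
  then show ?thesis
    unfolding S(1) om_sorted[OF S(2,3)] by (auto simp: sgn_if)
qed

text \<open>By \<open>om_edge\<close> the boundary at an edge compares the values of
  \<open>c\<close> times \<open>om\<close> on its two triangles. A 2-chain is thus a cycle when this
  product does not jump across any edge.\<close>

lemma bd_triangles:
  assumes c: "\<And>F. c F \<noteq> 0 \<Longrightarrow> F \<in> C \<and> card F = 3"
    and ik: "{i, k} \<in> C" "i < k"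
    and ab: "{i, k, a} \<in> C" "{i, k, b} \<in> C" "(v i \<times> v k) \<bullet> v a > 0" "(v i \<times> v k) \<bullet> v b < 0"
  shows "bd {..<n} c {i, k} = c {i, k, a} * om {i, k, a} - c {i, k, b} * om {i, k, b}"
proof -
  have ne: "a \<noteq> i" "a \<noteq> k" "b \<noteq> i" "b \<noteq> k" "a \<noteq> b" "i \<noteq> k"
    using ab ik by (auto simp: dot_cross_self)
  have only: "x = a \<or> x = b" if "x \<noteq> i" "x \<noteq> k" "{i, k, x} \<in> C" for x
  proof -
    obtain a' b' where *: "\<forall>x. {i, k, x} \<in> C \<longrightarrow> x \<noteq> i \<longrightarrow> x \<noteq> k \<longrightarrow> x = a' \<or> x = b'"
      by (rule edge_triangles[OF ik(1) ne(6)])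
    show ?thesis using *[rule_format, OF that(3,1,2)] *[rule_format, OF ab(1) ne(1,2)]
        *[rule_format, OF ab(2) ne(3,4)] ne(5) by auto
  qed
  have summand: "(-1) ^ card {y\<in>{i, k}. y < x} * c (insert x {i, k})
      = c {i, k, x} * om {i, k, x} * of_real (sgn ((v i \<times> v k) \<bullet> v x))"
    if "x \<noteq> i" "x \<noteq> k" for x
  proof (cases "c {i, k, x} = 0")
    case False
    then have "om {i, k, x} * om {i, k, x} = 1" using c om_sq by blast
    then have "c {i, k, x} * om {i, k, x} * ((-1) ^ card {y\<in>{i, k}. y < x} * om {i, k, x})
        = (-1) ^ card {y\<in>{i, k}. y < x} * c {i, k, x}"
      by (simp add: algebra_simps)
    then show ?thesis
      unfolding om_edge[OF ik(2) that] by (auto simp: insert_commute)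
  qed (simp add: insert_commute)
  have "bd {..<n} c {i, k} = (\<Sum>x\<in>{..<n} - {i, k}. c {i, k, x} * om {i, k, x} * of_real (sgn ((v i \<times> v k) \<bullet> v x)))"
    unfolding bd_def by (intro sum.cong refl summand) auto
  also have "\<dots> = (\<Sum>x\<in>{a, b}. c {i, k, x} * om {i, k, x} * of_real (sgn ((v i \<times> v k) \<bullet> v x)))"
  proof (rule sum.mono_neutral_right)
    show "{a, b} \<subseteq> {..<n} - {i, k}"
      using in_range[OF ab(1)] in_range[OF ab(2)] ne by auto
    show "\<forall>x\<in>{..<n} - {i, k} - {a, b}. c {i, k, x} * om {i, k, x} * of_real (sgn ((v i \<times> v k) \<bullet> v x)) = 0"
      using only c by fastforce
  qed simp
  also have "\<dots> = c {i, k, a} * om {i, k, a} - c {i, k, b} * om {i, k, b}"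
    using ne ab by simp
  finally show ?thesis .
qed

lemma bd_zero_across_edge:
  assumes c: "\<And>F. c F \<noteq> 0 \<Longrightarrow> F \<in> C \<and> card F = 3"
    and "bd {..<n} c {i, k} = 0"
    and T: "{i, k, a} \<in> C" "{i, k, b} \<in> C" "card {i, k, a} = 3" "card {i, k, b} = 3"
  shows "c {i, k, a} * om {i, k, a} = c {i, k, b} * om {i, k, b}"
proof -
  have *: "c {i, k, a} * om {i, k, a} = c {i, k, b} * om {i, k, b}"
    if "bd {..<n} c {i, k} = 0" "{i, k, a} \<in> C" "{i, k, b} \<in> C" "card {i, k, a} = 3" "card {i, k, b} = 3" "i < k" for i k
  proof -
    have ik: "{i, k} \<in> C" "i \<noteq> k" using that by (auto intro: face)
    have ne: "a \<noteq> i" "a \<noteq> k" "b \<noteq> i" "b \<noteq> k" using that(4,5) by (auto simp: card_insert_if split: if_splits)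
    obtain a' b' where *: "{i, k, a'} \<in> C" "{i, k, b'} \<in> C" "(v i \<times> v k) \<bullet> v a' > 0" "(v i \<times> v k) \<bullet> v b' < 0"
      "\<forall>x. {i, k, x} \<in> C \<longrightarrow> x \<noteq> i \<longrightarrow> x \<noteq> k \<longrightarrow> x = a' \<or> x = b'"
      by (rule edge_triangles[OF ik])
    have "c {i, k, a'} * om {i, k, a'} = c {i, k, b'} * om {i, k, b'}"
      using bd_triangles[OF c ik(1) that(6) *(1-4)] that(1) by simp
    then show ?thesis using *(5)[rule_format, OF that(2) ne(1,2)] *(5)[rule_format, OF that(3) ne(3,4)] by auto
  qed
  have "i \<noteq> k" using T(3) by (auto simp: card_insert_if split: if_splits)
  then show ?thesis
    using *[of i k] *[of k i] assms by (cases "i < k") (auto simp: insert_commute)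
qed

text \<open>The top homology of the sphere is one-dimensional: every 2-cycle is a multiple of the
  fundamental cycle.\<close>

lemma cycle_constant:
  assumes c: "\<And>F. c F \<noteq> 0 \<Longrightarrow> F \<in> C \<and> card F = 3" and "\<And>F. bd {..<n} c F = 0"
    and ST: "S \<in> C" "T \<in> C" "card S = 3" "card T = 3"
  shows "c S * om S = c T * om T"
proof (rule constant_on_triangles[OF _ ST])
  fix x k a b
  assume "{x, k, a} \<in> C" "{x, k, b} \<in> C" "card {x, k, a} = 3" "card {x, k, b} = 3"
  then show "c {x, k, a} * om {x, k, a} = c {x, k, b} * om {x, k, b}"
    by (intro bd_zero_across_edge[OF c assms(2)])
qed

text \<open>A piece of the fundamental cycle, selected by the indicator \<open>P\<close>, has
  boundary only where \<open>P\<close> jumps. If all jumps occur at edges inside \<open>I\<close>,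
  this boundary is a chain of \<open>K I\<close>.\<close>

lemma om_chain_bd:
  assumes "\<And>S. P S \<in> {0, 1 :: complex}"
  defines "c \<equiv> \<lambda>F. if F \<in> C \<and> card F = 3 then P F * om F else 0"
  assumes const: "\<And>i k a b. {i, k, a} \<in> C \<Longrightarrow> {i, k, b} \<in> C \<Longrightarrow> card {i, k, a} = 3 \<Longrightarrow> card {i, k, b} = 3
     \<Longrightarrow> \<not> {i, k} \<subseteq> I \<Longrightarrow> P {i, k, a} = P {i, k, b}"
  shows "chain (K I) 2 (bd {..<n} c)"
  unfolding chain_def
proof (intro allI impI)
  fix F assume nz: "bd {..<n} c F \<noteq> 0"
  then obtain x where x: "x \<in> {..<n}" "x \<notin> F" "c (insert x F) \<noteq> 0"
    by (rule bd_nonzeroE)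
  then have T: "insert x F \<in> C" "card (insert x F) = 3"
    by (auto simp: c_def split: if_splits)
  then have F: "F \<in> C" "finite F"
    using face[OF T(1)] finite_cone by auto
  then have cF: "card F = 2" using T(2) x(2) by simp
  have "F \<subseteq> I"
  proof (rule ccontr)
    assume FI: "\<not> F \<subseteq> I"
    obtain p q where pq: "F = {p, q}" "p \<noteq> q" using cF by (auto simp: card_2_iff)
    obtain i k where ik: "F = {i, k}" "i < k"
    proof (cases "p < q")
      case True then show thesis using that pq by blast
    next
      case False then show thesis using that[of q p] pq by auto
    qed
    have ik': "{i, k} \<in> C" "i \<noteq> k" using F ik by auto
    obtain a b where ab: "{i, k, a} \<in> C" "{i, k, b} \<in> C" "(v i \<times> v k) \<bullet> v a > 0" "(v i \<times> v k) \<bullet> v b < 0"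
      by (rule edge_triangles[OF ik'])
    have ne: "a \<noteq> i" "a \<noteq> k" "b \<noteq> i" "b \<noteq> k"
      using ab by (auto simp: dot_cross_self)
    then have c3: "card {i, k, a} = 3" "card {i, k, b} = 3" using ik by auto
    have nz': "c F \<noteq> 0 \<Longrightarrow> F \<in> C \<and> card F = 3" for F by (auto simp: c_def split: if_splits)
    have "c {i, k, a} * om {i, k, a} = P {i, k, a} * (om {i, k, a} * om {i, k, a})"
      "c {i, k, b} * om {i, k, b} = P {i, k, b} * (om {i, k, b} * om {i, k, b})"
      using ab c3 by (auto simp: c_def)
    then have "bd {..<n} c F = P {i, k, a} - P {i, k, b}"
      unfolding ik(1) using bd_triangles[OF nz' ik'(1) ik(2) ab] om_sq ab c3 by simp
    also have "\<dots> = 0" using const[OF ab(1,2) c3] FI ik(1) by simp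
    finally show False using nz by simp
  qed
  then show "F \<in> K I \<and> card F = 2" using F cF by auto
qed

section \<open>From acyclic subcomplexes to connected graphs\<close>

lemma chain_vertex_diff:
  assumes "p \<in> I" "q \<in> I" "I \<subseteq> {..<n}"
  shows "chain (K I) (Suc 0) (vertex_diff p q)"
  using assms vertex by (auto simp: chain_def vertex_diff_def split: if_splits)

text \<open>Reduced homology in degree -1 detects emptiness, and in degree 0 it detects
  components.\<close>

lemma acyclic_imp_conn:
  assumes ac: "acyclic (K I) {..<n}" and I: "I \<subseteq> {..<n}"
  shows "conn I"
  unfolding conn_def
proof (intro conjI allI impI)
  let ?c = "\<lambda>F. if F = {} then 1 else 0 :: complex"
  have "chain (K I) 0 ?c" by (auto simp: chain_def empty_cone)
  moreover have "bd {..<n} ?c F = 0" for F by (simp add: bd_def)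
  ultimately obtain b where b: "chain (K I) (Suc 0) b" "bd {..<n} b = ?c"
    by (rule acyclicD[OF ac])
  have "bd {..<n} b {} \<noteq> 0" using b(2) by simp
  then obtain x where "b {x} \<noteq> 0" by (rule bd_nonzeroE)
  then show "I \<noteq> {}" using b(1) unfolding chain_def by blast
next
  fix X assume X: "X \<subseteq> I" "X \<noteq> {}" "\<forall>i\<in>X. \<forall>j\<in>I - X. {i, j} \<notin> C"
  show "X = I"
  proof (rule ccontr)
    assume "X \<noteq> I"
    then obtain p q where pq: "p \<in> X" "q \<in> I" "q \<notin> X" using X by blast
    let ?c = "vertex_diff p q"
    have pqn: "p \<in> {..<n}" "q \<in> {..<n}" "p \<noteq> q" "p \<in> I" using pq X(1) I by auto
    obtain b where b: "chain (K I) (Suc (Suc 0)) b" "bd {..<n} b = ?c"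
      by (rule acyclicD[OF ac chain_vertex_diff[OF pqn(4) pq(2) I] bd_vertex_diff[OF finite_lessThan pqn(1-3)]])
    have fX: "finite X" by (rule finite_subset[OF X(1) finite_subset[OF I]]) simp
    \<comment> \<open>No edge of \<open>b\<close> leaves \<open>X\<close>, so the boundary of
      \<open>b\<close> summed over \<open>X\<close> cancels edge by edge, whereas the same sum for
      [p] - [q] is 1.\<close>
    have "(\<Sum>x\<in>X. bd {..<n} b {x}) = (\<Sum>x\<in>X. \<Sum>y\<in>X. if x = y then 0 else sg x y * b {x, y})"
    proof (rule sum.cong[OF refl])
      fix x assume x: "x \<in> X"
      have zero: "b {x, y} = 0" if "y \<notin> X" for y
      proof (rule ccontr)
        assume "b {x, y} \<noteq> 0"
        then have "{x, y} \<in> C" "y \<in> I" using b(1) unfolding chain_def by auto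
        then show False using X(3) x that by blast
      qed
      show "bd {..<n} b {x} = (\<Sum>y\<in>X. if x = y then 0 else sg x y * b {x, y})"
        unfolding bd_vertex using X(1) I zero fX
        by (intro sum.mono_neutral_cong) auto
    qed
    also have "\<dots> = 0"
    proof (rule sum_antisymmetric)
      fix x y
      show "(if x = y then 0 else sg x y * b {x, y}) = - (if y = x then 0 else sg y x * b {y, x})"
        using sg_swap[of x y] by (simp add: insert_commute)
    qed
    finally have "(\<Sum>x\<in>X. ?c {x}) = 0" by (simp add: b(2))
    moreover have "(\<Sum>x\<in>X. ?c {x}) = (\<Sum>x\<in>X. if x = p then 1 else 0)"
      using pq by (intro sum.cong) (auto simp: vertex_diff_def)
    ultimately show False using pq fX by simp
  qed
qed

text \<open>This half of Alexander duality uses the fundamental cycle. If nothing is left outside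
  \<open>I\<close>, that cycle is a nonzero class in degree 2; if the outside splits, the part of it
  near one piece has a boundary in \<open>K I\<close> that cannot be filled there.\<close>

lemma acyclic_imp_conn_compl:
  assumes ac: "acyclic (K I) {..<n}"
  shows "conn ({..<n} - I)"
  unfolding conn_def
proof (intro conjI allI impI)
  show "{..<n} - I \<noteq> {}"
  proof
    assume "{..<n} - I = {}"
    then have nI: "{..<n} \<subseteq> I" by blast
    let ?c = "\<lambda>F. if F \<in> C \<and> card F = 3 then 1 * om F else 0"
    have KC: "K I = C" using in_range nI by blast
    have "chain (K {}) 2 (bd {..<n} ?c)"
      by (rule om_chain_bd) auto
    then have "bd {..<n} ?c F = 0" for F
      unfolding chain_def by (metis (mono_tags, lifting) card.empty mem_Collect_eq subset_empty zero_neq_numeral)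
    then have c0: "bd {..<n} ?c F = 0" for F by blast
    have c3: "chain (K I) 3 ?c" unfolding KC by (auto simp: chain_def)
    obtain b where b: "chain (K I) (Suc 3) b" "bd {..<n} b = ?c"
      by (rule acyclicD[OF ac c3 c0])
    have b0: "b F = 0" for F
      using b(1) card_cone[of F] unfolding chain_def KC by fastforce
    have "?c F = 0" for F
    proof -
      have "bd {..<n} b F = 0" by (simp add: bd_def b0)
      then show ?thesis by (simp only: b(2))
    qed
    moreover obtain T where "T \<in> C" "card T = 3" using extend_cone[OF empty_cone] by blast
    ultimately show False using om_sq[of T] by (metis mult_zero_left mult_1 zero_neq_one)
  qed
next
  fix A assume A: "A \<subseteq> {..<n} - I" "A \<noteq> {}" "\<forall>i\<in>A. \<forall>j\<in>{..<n} - I - A. {i, j} \<notin> C"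
  show "A = {..<n} - I"
  proof (rule ccontr)
    assume "A \<noteq> {..<n} - I"
    then obtain p q where pq: "p \<in> A" "q \<in> {..<n} - I - A" using A by blast
    \<comment> \<open>Selects the triangles that touch the piece \<open>A\<close>. Of an edge with a
      vertex outside \<open>I\<close>, either both triangles are selected or neither.\<close>
    define P :: "nat set \<Rightarrow> complex" where "P S = (if S \<inter> A = {} then 0 else 1)" for S
    let ?c = "\<lambda>F. if F \<in> C \<and> card F = 3 then P F * om F else 0"
    have sep: "S \<inter> A = {}" if "S \<in> C" "y \<in> S" "y \<notin> I" "y \<notin> A" for S y
    proof (rule ccontr)
      assume "S \<inter> A \<noteq> {}"
      then obtain z where z: "z \<in> S" "z \<in> A" by blast
      then have "{z, y} \<in> C" using that by (intro face[OF that(1)]) auto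
      then show False using A(3) z that in_range by blast
    qed
    have ch: "chain (K I) 2 (bd {..<n} ?c)"
    proof (rule om_chain_bd)
      fix i k a b
      assume *: "{i, k, a} \<in> C" "{i, k, b} \<in> C" "\<not> {i, k} \<subseteq> I"
      show "P {i, k, a} = P {i, k, b}"
      proof (cases "{i, k} \<inter> A = {}")
        case True
        then obtain y where "y \<in> {i, k}" "y \<notin> I" "y \<notin> A" using *(3) by blast
        then show ?thesis
          using sep[OF *(1), of y] sep[OF *(2), of y] unfolding P_def by auto
      qed (auto simp: P_def)
    qed (simp add: P_def)
    have cyc: "bd {..<n} (bd {..<n} ?c) F = 0" for F
    proof (cases "finite F")
      case False
      show ?thesis
      proof (rule ccontr)
        assume "bd {..<n} (bd {..<n} ?c) F \<noteq> 0"
        then obtain x where "bd {..<n} ?c (insert x F) \<noteq> 0" by (rule bd_nonzeroE)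
        then have "card (insert x F) = 2"
          using ch[unfolded chain_def, THEN spec, of "insert x F"] by simp
        then show False using False by simp
      qed
    qed (rule bd_bd)
    obtain b where "chain (K I) (Suc 2) b" and b2: "bd {..<n} b = bd {..<n} ?c"
      by (rule acyclicD[OF ac ch cyc])
    then have b: "chain (K I) 3 b"
      by (simp only: Suc_numeral) simp
    \<comment> \<open>If \<open>b\<close> filled the boundary inside \<open>K I\<close>, this
      difference would be a 2-cycle with coefficient 0 at a triangle around \<open>q\<close> and a
      nonzero one at a triangle around \<open>p\<close>.\<close>
    let ?d = "\<lambda>F. ?c F - b F"
    obtain S T where S: "S \<in> C" "{p} \<subseteq> S" "card S = 3" and T: "T \<in> C" "{q} \<subseteq> T" "card T = 3"
      using extend_cone vertex pq A(1) by (metis DiffD1 lessThan_iff subsetD)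
    have "?d S * om S = ?d T * om T"
    proof (rule cycle_constant[OF _ _ S(1) T(1) S(3) T(3)])
      show "F \<in> C \<and> card F = 3" if "?d F \<noteq> 0" for F
        using that b unfolding chain_def by (auto split: if_splits)
      show "bd {..<n} ?d F = 0" for F
        by (simp add: bd_diff b2)
    qed
    moreover have "b S = 0" "b T = 0"
      using b S T pq A(1) unfolding chain_def by blast+
    moreover have "P S = 1" "P T = 0"
      using S(2) pq sep[OF T(1), of q] T(2) by (auto simp: P_def)
    ultimately have "om S * om S = 0" using S T by simp
    then show False using om_sq[OF S(1,3)] by simp
  qed
qed

text \<open>Otherwise the edge \<open>{i, k}\<close> would lie on a cycle of the complex but on none of its triangles.\<close>
lemma acyclic_edge_in_triangle:
  assumes ac: "acyclic (K N) {..<n}" "acyclic (K (insert i N)) {..<n}"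
    and N: "N \<subseteq> {..<n}" "i \<notin> N" and k: "k \<in> N" "k' \<in> N" "k \<noteq> k'" "{i, k} \<in> C" "{i, k'} \<in> C"
  shows "\<exists>x\<in>N. x \<noteq> k \<and> {i, k, x} \<in> C"
proof -
  let ?c = "vertex_diff k k'"
  have kn: "k \<in> {..<n}" "k' \<in> {..<n}" "i \<in> {..<n}" using k(1,2) N(1) in_range[OF k(4)] by auto
  obtain e where e: "chain (K N) (Suc (Suc 0)) e" "bd {..<n} e = ?c"
    by (rule acyclicD[OF ac(1) chain_vertex_diff[OF k(1,2) N(1)] bd_vertex_diff[OF finite_lessThan kn(1,2) k(3)]])
  \<comment> \<open>The chain \<open>e\<close> with boundary [k] - [k'] is closed up through
    \<open>i\<close>: with these signs the two edges contribute [i] - [k] and [k'] - [i].\<close>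
  let ?d1 = "\<lambda>F. if F = {i, k} then - sg k i else 0" and ?d2 = "\<lambda>F. if F = {i, k'} then sg k' i else 0"
  let ?d = "\<lambda>F. e F + (?d1 F + ?d2 F)"
  have ne: "i \<noteq> k" "i \<noteq> k'" using N k by auto
  have cyc: "bd {..<n} ?d F = 0" for F
    unfolding bd_add e(2)
    using bd_edge[OF finite_lessThan kn(3,1) ne(1), of "- sg k i" F]
      bd_edge[OF finite_lessThan kn(3,2) ne(2), of "sg k' i" F] ne k(3)
    by (auto simp: vertex_diff_def sg_swap[of k i] sg_swap[of k' i])
  have ch: "chain (K (insert i N)) 2 ?d"
    unfolding chain_def
  proof (intro allI impI)
    fix F assume "?d F \<noteq> 0"
    then consider "e F \<noteq> 0" | "F = {i, k}" | "F = {i, k'}" by (auto split: if_splits)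
    then show "F \<in> K (insert i N) \<and> card F = 2"
    proof cases
      case 1
      then show ?thesis using e(1) unfolding chain_def by auto
    qed (use k ne in auto)
  qed
  obtain b where b: "chain (K (insert i N)) (Suc 2) b" "bd {..<n} b = ?d"
    by (rule acyclicD[OF ac(2) ch cyc])
  have "e {i, k} = 0" using e(1) N(2) unfolding chain_def by blast
  then have "?d {i, k} \<noteq> 0" using k(3) ne by (auto simp: doubleton_eq_iff)
  then have "bd {..<n} b {i, k} \<noteq> 0" by (simp only: b(2) not_False_eq_True)
  then obtain x where x: "x \<notin> {i, k}" "b (insert x {i, k}) \<noteq> 0" by (rule bd_nonzeroE)
  then show ?thesis
    using b(1) unfolding chain_def by (intro bexI[of _ x]) (auto simp: insert_commute)
qed

end

section \<open>Vanishing of the first homology of the sphere\<close>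

lemma rational_functional:
  fixes s :: "rat \<Rightarrow> 'b::ab_group_add \<Rightarrow> 'b"
  assumes "vector_space s" "module.subspace s B" "c \<notin> B"
  obtains \<phi> :: "'b \<Rightarrow> rat" where "\<And>x y. \<phi> (x + y) = \<phi> x + \<phi> y" "\<And>q x. \<phi> (s q x) = q * \<phi> x"
    "\<And>x. x \<in> B \<Longrightarrow> \<phi> x = 0" "\<phi> c \<noteq> 0"
proof -
  interpret A: vector_space s by fact
  interpret Q: vector_space "(*) :: rat \<Rightarrow> rat \<Rightarrow> rat"
    by unfold_locales (auto simp: algebra_simps)
  interpret P: vector_space_pair s "(*) :: rat \<Rightarrow> rat \<Rightarrow> rat" ..
  obtain T where T: "T \<subseteq> B" "A.independent T" "B \<subseteq> A.span T"
    using A.maximal_independent_subset by blast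
  have "A.span T \<subseteq> B"
    using T(1) assms(2) by (rule A.span_minimal)
  \<comment> \<open>A basis of \<open>B\<close> stays independent when \<open>c\<close> is adjoined,
    so a functional can be 0 on \<open>B\<close> and 1 at \<open>c\<close>.\<close>
  then have cT: "c \<notin> A.span T" using assms(3) by blast
  then have "A.independent (insert c T)"
    using T(2) by (rule A.independent_insertI)
  from P.linear_independent_extend[OF this, of "\<lambda>x. if x = c then 1 else 0"]
  obtain g where g: "Vector_Spaces.linear s (*) g" "\<forall>x\<in>insert c T. g x = (if x = c then 1 else 0)"
    by auto
  have "c \<notin> T" using cT A.span_base by blast
  then have "g x = 0" if "x \<in> T" for x using g(2) that by auto
  then have "g x = 0" if "x \<in> B" for x
    using P.linear_eq_0_on_span[OF g(1)] T(3) that by blast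
  moreover have "g c \<noteq> 0" using g(2) by simp
  ultimately show thesis
    using P.linear_add[OF g(1)] P.linear_scale[OF g(1)] by (intro that[of g]) auto
qed

lemma sum_fun_apply: "(\<Sum>i\<in>A. f i) x = (\<Sum>i\<in>A. f i x)"
  for f :: "'a \<Rightarrow> 'b \<Rightarrow> 'c::comm_monoid_add"
  by (induction A rule: infinite_finite_induct) auto

lemma common_denominator:
  fixes f :: "'a \<Rightarrow> rat"
  assumes "finite A"
  obtains d :: nat where "d > 0" "\<And>x. x \<in> A \<Longrightarrow> of_nat d * f x \<in> \<int>"
proof -
  have "\<exists>d::nat. d > 0 \<and> (\<forall>x\<in>A. of_nat d * f x \<in> \<int>)"
    using assms
  proof (induction A)
    case empty
    then show ?case by auto
  next
    case (insert x A)
    then obtain d where d: "d > 0" "\<forall>x\<in>A. of_nat d * f x \<in> \<int>" by blast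
    obtain p q where pq: "f x = of_int p / of_int q" "q > 0"
      by (metis quotient_of_div quotient_of_denom_pos surj_pair)
    have q: "of_nat (nat q) = (of_int q :: rat)" using pq(2) by simp
    have "of_nat (d * nat q) * f x = of_int (int d * p)"
      using pq q by simp
    then have "of_nat (d * nat q) * f x \<in> \<int>" by (metis Ints_of_int)
    moreover have "of_nat (d * nat q) * f y \<in> \<int>" if "y \<in> A" for y
    proof -
      have eq: "of_nat (d * nat q) * f y = of_int q * (of_nat d * f y)"
        unfolding of_nat_mult q by (simp add: mult_ac)
      show ?thesis unfolding eq using d(2) that by (simp add: Ints_mult)
    qed
    ultimately show ?case
      using d(1) pq(2) by (intro exI[of _ "d * nat q"]) auto
  qed
  then show thesis using that by blast
qed

context fan
begin

text \<open>A cocycle with integer values glues to a circle-valued map on the punctured space,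
  and a continuous logarithm of that map provides the potential.\<close>
lemma integer_cocycle_potential:
  fixes a :: "nat \<Rightarrow> nat \<Rightarrow> real"
  assumes int: "\<And>i j. {i, j} \<in> C \<Longrightarrow> a i j \<in> \<int>"
    and cocycle: "\<And>i j k. {i, j, k} \<in> C \<Longrightarrow> a i j + a j k = a i k"
  obtains g where "\<And>i j. {i, j} \<in> C \<Longrightarrow> a i j = g j - g i"
proof -
  define tot where "tot x = (\<Sum>k<n. h x k)" for x
  \<comment> \<open>The average of \<open>a i j\<close> with the barycentric weights. Replacing
    \<open>i\<close> by another vertex \<open>k\<close> of the carrier changes it by the integer
    \<open>a i k\<close>, which the circle does not see.\<close>
  define F where "F i x = (\<Sum>j<n. a i j * h x j) / tot x" for i x
  define m where "m x = (SOME i. h x i > 0)" for x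
  define E where "E x = cis (2 * pi * F (m x) x)" for x
  have tot: "tot x > 0" if "h x i > 0" for x i
    unfolding tot_def using that h_nonneg h_pos_in_range[OF that]
    by (intro sum_pos2[of _ i]) auto
  have E: "E x = cis (2 * pi * F i x)" if "h x i > 0" for x i
  proof -
    have m: "h x (m x) > 0" unfolding m_def using that by (rule someI)
    have "(\<Sum>j<n. a i j * h x j) = (\<Sum>j<n. a i (m x) * h x j + a (m x) j * h x j)"
    proof (rule sum.cong[OF refl])
      fix j
      show "a i j * h x j = a i (m x) * h x j + a (m x) j * h x j"
      proof (cases "h x j = 0")
        case False
        then have "{i, m x, j} \<in> C"
          using m that by (intro face[OF h_carrier[of x]]) auto
        then show ?thesis using cocycle[of i "m x" j] by (metis distrib_right)
      qed simp
    qed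
    then have "F i x = a i (m x) + F (m x) x"
      using tot[OF that] unfolding F_def tot_def
      by (simp add: sum.distrib sum_distrib_left[symmetric] add_divide_distrib)
    moreover have "a i (m x) \<in> \<int>"
      by (rule int[OF pair_in_fan[OF that m]])
    then obtain z :: int where "a i (m x) = of_int z"
      by (auto elim: Ints_cases)
    ultimately have "cis (2 * pi * F i x) = cis (2 * pi * of_int z) * E x"
      unfolding E_def cis_mult by (simp only: distrib_left)
    then show ?thesis by (simp add: cis_multiple_2pi)
  qed
  have contF: "continuous_on {x. h x i > 0} (F i)" for i
    unfolding F_def tot_def
    by (intro continuous_intros continuous_h) (use tot in \<open>fastforce simp: tot_def\<close>)
  have "continuous_on (\<Union>i\<in>UNIV. {x. h x i > 0}) E"
  proof (rule continuous_on_open_UN)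
    fix i
    show "open {x. h x i > 0}"
      by (intro open_Collect_less continuous_h continuous_on_const)
    show "continuous_on {x. h x i > 0} E"
      by (subst continuous_on_cong[OF refl E]) (auto simp: cis_conv_exp intro!: continuous_intros contF)
  qed
  then have contE: "continuous_on (- {0}) E"
    by (rule continuous_on_subset) (use h_pos_ex in blast)
  \<comment> \<open>The punctured space is simply connected, so \<open>E\<close> has a continuous
    logarithm; its imaginary part at the rays is 2 pi times the potential.\<close>
  obtain L where L: "continuous_on (- {0}) L" "\<And>x. x \<in> - {0} \<Longrightarrow> E x = exp (L x)"
  proof (rule continuous_logarithm_on_simply_connected[OF contE])
    show "simply_connected (- {0 :: real^3})"
      by (rule simply_connected_punctured_universe) simp
    show "locally path_connected (- {0 :: real^3})"
      by (rule open_imp_locally_path_connected) (simp add: open_Compl)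
  qed (auto simp: E_def)
  have "a i j = Im (L (v j)) / (2 * pi) - Im (L (v i)) / (2 * pi)" if ij: "{i, j} \<in> C" for i j
  proof (cases "i = j")
    case True
    then show ?thesis using cocycle[of i i i] ij by simp
  next
    case False
    have range: "i < n" "j < n" using in_range[OF ij] by auto
    \<comment> \<open>Along the edge from \<open>v i\<close> to \<open>v j\<close> the phase of
      \<open>E\<close> is exactly linear with slope \<open>2 * pi * a i j\<close>, so the logarithm
      can be compared with it.\<close>
    define p where "p t = (1 - t) *\<^sub>R v i + t *\<^sub>R v j" for t :: real
    have hp: "h (p t) k = (if k = i then 1 - t else if k = j then t else 0)" if "t \<in> {0..1}" for t k
    proof -
      have "p t = (\<Sum>k\<in>{i, j}. (if k = i then 1 - t else t) *\<^sub>R v k)"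
        using False by (simp add: p_def)
      then show ?thesis
        using h_cone[OF ij, of "\<lambda>k. if k = i then 1 - t else t"] that by auto
    qed
    have p0: "p t \<noteq> 0" if "t \<in> {0..1}" for t
      using hp[OF that] h_eq_0_iff[of "p t"] False by (metis diff_0_right zero_neq_one)
    have Ep: "E (p t) = cis (2 * pi * (a i j * t))" if t: "t \<in> {0..1}" for t
    proof -
      have tt: "tot (p t) = 1"
      proof -
        have "tot (p t) = (\<Sum>k<n. (if k = i then 1 - t else 0) + (if k = j then t else 0))"
          unfolding tot_def using False by (intro sum.cong) (auto simp: hp[OF t])
        then show ?thesis using range by (simp add: sum.distrib)
      qed
      have Fp: "F l (p t) = a l i * (1 - t) + a l j * t" for l
      proof -
        have "F l (p t) = (\<Sum>k<n. (if k = i then a l i * (1 - t) else 0) + (if k = j then a l j * t else 0))"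
          unfolding F_def tt using False by (simp, intro sum.cong) (auto simp: hp[OF t])
        then show ?thesis using range by (simp add: sum.distrib)
      qed
      have aii: "a i i = 0" "a j j = 0"
        using cocycle[of i i i] cocycle[of j j j] vertex range by auto
      show ?thesis
      proof (cases "t = 1")
        case True
        obtain z :: int where "a i j = of_int z" using int[OF ij] by (auto elim: Ints_cases)
        then show ?thesis
          using E[of "p t" j] Fp[of j] hp[OF t, of j] False True aii by (simp add: cis_multiple_2pi)
      next
        case False
        then show ?thesis
          using E[of "p t" i] Fp[of i] hp[OF t, of i] t aii by simp
      qed
    qed
    \<comment> \<open>Logarithm minus linear phase. It takes values in the discrete set of multiples
      of 2 pi i, hence is constant, and its two ends give the potential difference.\<close>
    define D where "D t = L (p t) - \<i> * of_real (2 * pi * (a i j * t))" for t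
    have exp_D: "exp (D t) = 1" if "t \<in> {0..1}" for t
      using L(2)[of "p t"] p0[OF that] Ep[OF that]
      by (simp add: D_def exp_diff cis_conv_exp)
    have "continuous_on {0..1} (\<lambda>t. L (p t))"
      by (rule continuous_on_compose2[OF L(1)]) (use p0 in \<open>auto simp: p_def intro!: continuous_intros\<close>)
    then have contD: "continuous_on {0..1} D"
      unfolding D_def by (intro continuous_intros)
    have "D constant_on {0..1}"
    proof (rule continuous_discrete_range_constant[OF _ contD])
      fix t :: real assume t: "t \<in> {0..1}"
      have "2 * pi \<le> norm (D s - D t)" if s: "s \<in> {0..1}" "D s \<noteq> D t" for s
      proof -
        obtain y z :: int where yz: "Re (D s) = 0" "Re (D t) = 0"
          "Im (D s) = of_int (2 * y) * pi" "Im (D t) = of_int (2 * z) * pi"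
          using exp_D[OF s(1)] exp_D[OF t] unfolding exp_eq_1 by blast
        then have "y \<noteq> z" using s(2) by (auto simp: complex_eq_iff)
        then have "1 \<le> \<bar>real_of_int (y - z)\<bar>" by linarith
        then have "2 * pi * 1 \<le> 2 * pi * \<bar>real_of_int (y - z)\<bar>"
          by (intro mult_left_mono) auto
        also have "\<dots> = \<bar>Im (D s - D t)\<bar>"
        proof -
          have "Im (D s - D t) = 2 * pi * real_of_int (y - z)"
            using yz by (simp add: algebra_simps)
          then show ?thesis by (simp only: abs_mult) simp
        qed
        also have "\<dots> \<le> norm (D s - D t)" by (rule abs_Im_le_cmod)
        finally show ?thesis by simp
      qed
      then show "\<exists>e>0. \<forall>s. s \<in> {0..1} \<and> D s \<noteq> D t \<longrightarrow> e \<le> norm (D s - D t)"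
        by (intro exI[of _ "2 * pi"]) auto
    qed simp
    then have "D 0 = D 1" unfolding constant_on_def by force
    then have "Im (L (v i)) = Im (L (v j)) - 2 * pi * a i j"
      by (simp add: D_def p_def complex_eq_iff)
    then show ?thesis by (simp add: field_simps)
  qed
  then show thesis by (rule that)
qed

lemma rational_cocycle_potential:
  fixes a :: "nat \<Rightarrow> nat \<Rightarrow> rat"
  assumes cocycle: "\<And>i j k. {i, j, k} \<in> C \<Longrightarrow> a i j + a j k = a i k"
  obtains g :: "nat \<Rightarrow> real" where "g 0 = 0" "\<And>i j. {i, j} \<in> C \<Longrightarrow> of_rat (a i j) = g j - g i"
proof -
  obtain d :: nat where d: "d > 0" "\<And>x. x \<in> Sigma {..<n} (\<lambda>_. {..<n}) \<Longrightarrow> of_nat d * (case x of (i, j) \<Rightarrow> a i j) \<in> \<int>"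
    by (rule common_denominator[of "Sigma {..<n} (\<lambda>_. {..<n})" "\<lambda>(i, j). a i j"]) auto
  obtain g where g: "\<And>i j. {i, j} \<in> C \<Longrightarrow> of_rat (of_nat d * a i j) = (g j - g i :: real)"
  proof (rule integer_cocycle_potential)
    fix i j assume "{i, j} \<in> C"
    then have "of_nat d * a i j \<in> \<int>" using d(2)[of "(i, j)"] in_range by auto
    then obtain z where "of_nat d * a i j = of_int z" by (auto elim: Ints_cases)
    then show "real_of_rat (of_nat d * a i j) \<in> \<int>" by simp
  next
    fix i j k assume "{i, j, k} \<in> C"
    then show "real_of_rat (of_nat d * a i j) + of_rat (of_nat d * a j k) = of_rat (of_nat d * a i k)"
      unfolding cocycle[symmetric, of i j k, OF \<open>{i, j, k} \<in> C\<close>] by (simp add: of_rat_add of_rat_mult distrib_left)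
  qed blast
  show thesis
  \<comment> \<open>Denominators are divided out again. The normalisation at vertex 0 makes the
    potential unique on the connected graph, so that in \<open>H1_zero\<close> it becomes additive
    in the coefficient.\<close>
  proof (rule that[of "\<lambda>i. (g i - g 0) / of_nat d"])
    fix i j assume "{i, j} \<in> C"
    from g[OF this] show "real_of_rat (a i j) = (g j - g 0) / of_nat d - (g i - g 0) / of_nat d"
      using d(1) by (simp add: of_rat_mult field_simps)
  qed simp
qed

text \<open>Normalised so that the boundary is \<open>z\<close> at \<open>j\<close> and \<open>- z\<close> at \<open>i\<close>.\<close>
definition oedge :: "complex \<Rightarrow> nat \<Rightarrow> nat \<Rightarrow> nat set \<Rightarrow> complex" where
  "oedge z i j F = (if i \<noteq> j \<and> F = {i, j} then sg j i * z else 0)"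

lemma oedge_swap: "oedge z j i = - oedge z i j"
proof
  fix F
  have F: "F = {j, i} \<longleftrightarrow> F = {i, j}" by blast
  show "oedge z j i F = (- oedge z i j) F"
  proof (cases "i = j")
    case False
    show ?thesis
      unfolding oedge_def F uminus_apply sg_swap[OF False] using False by simp
  qed (simp add: oedge_def)
qed

lemma bd_triangle:
  assumes "i < j" "j < k" "k < n"
  shows "bd {..<n} (\<lambda>F. if F = {i, j, k} then z else 0) = oedge z i j + oedge z j k + oedge z k i"
proof
  fix F
  let ?t = "\<lambda>F. if F = {i, j, k} then z else 0"
  have ne: "i \<noteq> j" "j \<noteq> k" "i \<noteq> k" using assms by auto
  have one: "bd {..<n} ?t F = (-1) ^ card {y\<in>F. y < x} * z"
    if x: "insert x F = {i, j, k}" "x \<notin> F" for x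
  proof -
    have "x \<in> {i, j, k}" using x(1) by blast
    then have "x < n" using assms by auto
    have "bd {..<n} ?t F = (\<Sum>y\<in>{..<n} - F. if y = x then (-1) ^ card {y\<in>F. y < x} * z else 0)"
      unfolding bd_def
    proof (rule sum.cong[OF refl])
      fix y assume y: "y \<in> {..<n} - F"
      show "(-1) ^ card {z\<in>F. z < y} * ?t (insert y F) = (if y = x then (-1) ^ card {y\<in>F. y < x} * z else 0)"
      proof (cases "y = x")
        case False
        then have "insert y F \<noteq> insert x F" using x(2) y by blast
        then show ?thesis using False x(1) by simp
      qed (use x(1) in simp)
    qed
    then show ?thesis using x(2) \<open>x < n\<close> by simp
  qed
  consider "F = {i, j}" | "F = {j, k}" | "F = {i, k}" | "F \<noteq> {i, j}" "F \<noteq> {j, k}" "F \<noteq> {i, k}" by blast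
  then show "bd {..<n} ?t F = (oedge z i j + oedge z j k + oedge z k i) F"
  proof cases
    case 1
    have eq: "{y\<in>F. y < k} = {i, j}" using 1 assms by auto
    then show ?thesis
      using one[of k, unfolded eq] 1 ne assms by (simp add: insert_commute oedge_def sg_def doubleton_eq_iff)
  next
    case 2
    have eq: "{y\<in>F. y < i} = {}" using 2 assms by auto
    then show ?thesis
      using one[of i, unfolded eq] 2 ne assms by (simp add: insert_commute oedge_def sg_def doubleton_eq_iff)
  next
    case 3
    have eq: "{y\<in>F. y < j} = {i}" using 3 assms by auto
    then show ?thesis
      using one[of j, unfolded eq] 3 ne assms by (simp add: insert_commute oedge_def sg_def doubleton_eq_iff)
  next
    case 4
    have "bd {..<n} ?t F = 0"
    proof (rule ccontr)
      assume "bd {..<n} ?t F \<noteq> 0"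
      then obtain x where x: "x \<notin> F" "insert x F = {i, j, k}"
        by (rule bd_nonzeroE) (auto split: if_splits)
      then have "F = {i, j, k} - {x}" "x \<in> {i, j, k}" by auto
      then show False using 4 ne by auto
    qed
    then show ?thesis using 4 by (simp add: oedge_def insert_commute)
  qed
qed

text \<open>A cycle that bounds nothing is detected by an additive map to the rationals that vanishes on
  boundaries. On the edges with a fixed complex coefficient this map is a rational cocycle, hence a
  coboundary, so its value on the cycle telescopes to zero.\<close>
lemma H1_zero:
  assumes c: "chain C 2 c" "\<And>F. bd {..<n} c F = 0"
  obtains b where "chain C 3 b" "bd {..<n} b = c"
proof -
  define B where "B = {bd {..<n} b | b. chain C 3 b}"
  \<comment> \<open>Chains are taken as a vector space over the rationals rather than the complex
    numbers, so that the separating functional has rational values.\<close>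
  define s where "s q f = (\<lambda>F. of_rat q * f F)" for q :: rat and f :: "nat set \<Rightarrow> complex"
  have vs: "vector_space s"
    by unfold_locales (auto simp: s_def fun_eq_iff of_rat_add of_rat_mult algebra_simps)
  interpret vector_space s by (rule vs)
  have sub: "subspace B"
    unfolding subspace_def
  proof (intro conjI ballI allI)
    have "chain C 3 0" "bd {..<n} 0 = 0" by (auto simp: chain_def bd_def fun_eq_iff)
    then show "0 \<in> B" unfolding B_def by (metis (mono_tags, lifting) mem_Collect_eq)
  next
    fix x y assume "x \<in> B" "y \<in> B"
    then obtain b b' where b: "chain C 3 b" "x = bd {..<n} b" "chain C 3 b'" "y = bd {..<n} b'"
      unfolding B_def by auto
    have "chain C 3 (\<lambda>F. b F + b' F)" using b unfolding chain_def by (metis add.right_neutral add_0)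
    moreover have "bd {..<n} (\<lambda>F. b F + b' F) = x + y"
      using b by (auto simp: fun_eq_iff bd_add)
    ultimately show "x + y \<in> B" unfolding B_def by (metis (mono_tags, lifting) mem_Collect_eq)
  next
    fix x q assume "x \<in> B"
    then obtain b where b: "chain C 3 b" "x = bd {..<n} b" unfolding B_def by auto
    have "chain C 3 (\<lambda>F. of_rat q * b F)" using b unfolding chain_def by (metis mult_zero_right)
    moreover have "bd {..<n} (\<lambda>F. of_rat q * b F) = s q x"
      using b by (auto simp: fun_eq_iff bd_scale s_def)
    ultimately show "s q x \<in> B" unfolding B_def by (metis (mono_tags, lifting) mem_Collect_eq)
  qed
  have "c \<in> B"
  proof (rule ccontr)
    assume "c \<notin> B"
    then obtain \<phi> :: "(nat set \<Rightarrow> complex) \<Rightarrow> rat" where \<phi>: "\<And>x y. \<phi> (x + y) = \<phi> x + \<phi> y"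
      "\<And>x. x \<in> B \<Longrightarrow> \<phi> x = 0" "\<phi> c \<noteq> 0"
      using rational_functional[OF vs sub] by metis
    have \<phi>0: "\<phi> 0 = 0" using \<phi>(1)[of 0 0] by simp
    have \<phi>m: "\<phi> (- x) = - \<phi> x" for x using \<phi>(1)[of x "- x"] \<phi>0 by simp
    have \<phi>_sum: "\<phi> (\<Sum>x\<in>A. f x) = (\<Sum>x\<in>A. \<phi> (f x))" for f and A :: "nat set"
      by (induction A rule: infinite_finite_induct)
         (simp_all only: sum.infinite sum.empty sum.insert \<phi>0 \<phi>(1) not_False_eq_True)
    define a where "a z i j = \<phi> (oedge z i j)" for z i j
    have a_swap: "a z j i = - a z i j" for z i j
      by (simp add: a_def oedge_swap[of z j i] \<phi>m)
    have a_refl: "a z i i = 0" for z i using a_swap[of z i i] by simp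
    have sorted: "a z i j + a z j k + a z k i = 0" if "i < j" "j < k" "{i, j, k} \<in> C" for z i j k
    proof -
      have "k < n" using in_range[OF that(3)] by auto
      have "chain C 3 (\<lambda>F. if F = {i, j, k} then z else 0)"
        using that by (auto simp: chain_def)
      then have "oedge z i j + oedge z j k + oedge z k i \<in> B"
        unfolding B_def bd_triangle[OF that(1,2) \<open>k < n\<close>, symmetric] by blast
      then have "\<phi> (oedge z i j + oedge z j k + oedge z k i) = 0"
        by (rule \<phi>(2))
      then show ?thesis by (simp only: a_def \<phi>(1))
    qed
    have cocycle: "a z i j + a z j k = a z i k" if T: "{i, j, k} \<in> C" for z i j k
    proof (cases "i = j \<or> j = k \<or> i = k")
      case True
      then consider "i = j" | "j = k" | "i = k" by blast
      then show ?thesis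
        by cases (use a_refl[of z] a_swap[of z i j] in simp_all)
    next
      case False
      have P: "{i, k, j} \<in> C" "{j, i, k} \<in> C" "{j, k, i} \<in> C" "{k, i, j} \<in> C" "{k, j, i} \<in> C"
        using T by (simp_all add: insert_commute)
      consider "i < j" "j < k" | "i < k" "k < j" | "j < i" "i < k" | "j < k" "k < i"
        | "k < i" "i < j" | "k < j" "j < i" using False by linarith
      then show ?thesis
        by cases (use sorted[OF _ _ T, of z] sorted[OF _ _ P(1), of z] sorted[OF _ _ P(2), of z]
          sorted[OF _ _ P(3), of z] sorted[OF _ _ P(4), of z] sorted[OF _ _ P(5), of z]
          a_swap[of z i j] a_swap[of z j k] a_swap[of z i k] in auto)
    qed
    have "\<forall>z. \<exists>g :: nat \<Rightarrow> real. g 0 = 0 \<and> (\<forall>i j. {i, j} \<in> C \<longrightarrow> of_rat (a z i j) = g j - g i)"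
    proof
      fix z
      show "\<exists>g :: nat \<Rightarrow> real. g 0 = 0 \<and> (\<forall>i j. {i, j} \<in> C \<longrightarrow> of_rat (a z i j) = g j - g i)"
      proof (rule rational_cocycle_potential[of "a z"])
        show "a z i j + a z j k = a z i k" if "{i, j, k} \<in> C" for i j k
          by (rule cocycle[OF that])
      qed blast
    qed
    then obtain G :: "complex \<Rightarrow> nat \<Rightarrow> real" where
      "\<forall>z. G z 0 = 0 \<and> (\<forall>i j. {i, j} \<in> C \<longrightarrow> of_rat (a z i j) = G z j - G z i)"
      unfolding choice_iff by blast
    then have G: "\<And>z. G z 0 = 0" "\<And>z i j. {i, j} \<in> C \<Longrightarrow> of_rat (a z i j) = G z j - G z i"
      by simp_all
    have a_add: "a (z + w) i j = a z i j + a w i j" for z w i j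
    proof -
      have "oedge (z + w) i j = oedge z i j + oedge w i j"
        by (auto simp: oedge_def fun_eq_iff distrib_left)
      then show ?thesis by (simp add: a_def \<phi>(1))
    qed
    \<comment> \<open>Both sides are potentials of the same cocycle and agree at vertex 0, so they
      agree along the connected graph.\<close>
    have G_add: "G (z + w) i = G z i + G w i" if "i < n" for z w i
    proof (rule connD[OF conn_all, of 0])
      fix i j assume "{i, j} \<in> C" "G (z + w) i = G z i + G w i"
      then show "G (z + w) j = G z j + G w j"
        using G(2)[of i j "z + w"] G(2)[of i j z] G(2)[of i j w] a_add[of z w i j]
        by (simp add: of_rat_add)
    qed (use n_pos that G(1) in auto)
    have G0: "G 0 i = 0" if "i < n" for i using G_add[OF that, of 0 0] by simp
    have Gm: "G (- z) i = - G z i" if "i < n" for z i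
      using G_add[OF that, of z "- z"] G0[OF that] by simp
    have G_sum: "G (\<Sum>x\<in>A. f x) i = (\<Sum>x\<in>A. G (f x) i)" if "i < n" for f i and A :: "nat set"
      by (induction A rule: infinite_finite_induct) (auto simp: G0[OF that] G_add[OF that])
    have c_eq: "c = (\<Sum>i<n. \<Sum>j<n. if i < j then oedge (c {i, j}) i j else 0)"
    proof
      fix F
      show "c F = (\<Sum>i<n. \<Sum>j<n. if i < j then oedge (c {i, j}) i j else 0) F"
      proof (cases "\<exists>p q. F = {p, q} \<and> p < q \<and> q < n")
        case True
        then obtain p q where pq: "F = {p, q}" "p < q" "q < n" by blast
        have "(\<Sum>i<n. \<Sum>j<n. if i < j then oedge (c {i, j}) i j else 0) F
            = (\<Sum>i<n. \<Sum>j<n. if i = p then if j = q then c F else 0 else 0)"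
          unfolding sum_fun_apply using pq
          by (intro sum.cong refl) (auto simp: oedge_def sg_def doubleton_eq_iff)
        also have "\<dots> = (\<Sum>i<n. if i = p then c F else 0)"
          using pq by (intro sum.cong) auto
        finally show ?thesis using pq by simp
      next
        case False
        have "c F = 0"
        proof (rule ccontr)
          assume "c F \<noteq> 0"
          then have F: "F \<in> C" "card F = 2" using c(1) by (auto simp: chain_def)
          then obtain p q where "F = {p, q}" "p \<noteq> q" by (auto simp: card_2_iff)
          then show False using False in_range[OF F(1)] by (metis insert_commute insert_subset lessThan_iff linorder_neqE_nat)
        qed
        moreover have "(\<Sum>i<n. \<Sum>j<n. if i < j then oedge (c {i, j}) i j else 0) F = 0"
          unfolding sum_fun_apply using False
          by (intro sum.neutral ballI) (auto simp: oedge_def)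
        ultimately show ?thesis by simp
      qed
    qed
    have "\<phi> c = (\<Sum>i<n. \<Sum>j<n. if i < j then a (c {i, j}) i j else 0)"
      by (rule trans[OF arg_cong[OF c_eq, of \<phi>]]) (simp only: \<phi>_sum a_def if_distrib[of \<phi>] \<phi>0)
    then have "(of_rat (\<phi> c) :: real) = (\<Sum>i<n. \<Sum>j<n. of_rat (if i < j then a (c {i, j}) i j else 0))"
      by (simp add: of_rat_sum)
    also have "\<dots> = (\<Sum>i<n. \<Sum>j<n. (if i < j then G (c {i, j}) j else 0) - (if i < j then G (c {i, j}) i else 0))"
    proof (intro sum.cong refl)
      fix i j assume ij: "i \<in> {..<n}" "j \<in> {..<n}"
      show "of_rat (if i < j then a (c {i, j}) i j else 0)
          = (if i < j then G (c {i, j}) j else 0) - (if i < j then G (c {i, j}) i else 0)"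
      proof (cases "{i, j} \<in> C")
        case False
        then have "c {i, j} = 0" using c(1) by (auto simp: chain_def)
        moreover have "oedge 0 i j = 0" by (auto simp: oedge_def)
        ultimately show ?thesis using G0 ij by (auto simp: a_def \<phi>0)
      qed (use G(2) in auto)
    qed
    also have "\<dots> = (\<Sum>i<n. \<Sum>j<n. if i < j then G (c {i, j}) j else 0)
        - (\<Sum>i<n. \<Sum>j<n. if i < j then G (c {i, j}) i else 0)"
      by (simp add: sum_subtractf)
    \<comment> \<open>Summation by parts: renaming the ends of each edge collects at
      \<open>i\<close> the values of the additive map \<open>G _ i\<close> on the signed
      coefficients around \<open>i\<close>, that is, its value on the boundary at
      \<open>i\<close>.\<close>
    also have "(\<Sum>i<n. \<Sum>j<n. if i < j then G (c {i, j}) j else 0)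
        = (\<Sum>i<n. \<Sum>j<n. if j < i then G (c {i, j}) i else 0)"
      by (subst sum.swap) (intro sum.cong refl, simp add: insert_commute)
    also have "\<dots> - (\<Sum>i<n. \<Sum>j<n. if i < j then G (c {i, j}) i else 0)
        = (\<Sum>i<n. \<Sum>j<n. (if j < i then G (c {i, j}) i else 0) - (if i < j then G (c {i, j}) i else 0))"
      by (simp add: sum_subtractf)
    also have "\<dots> = (\<Sum>i<n. G (bd {..<n} c {i}) i)"
    proof (intro sum.cong refl)
      fix i assume i: "i \<in> {..<n}"
      have "G (bd {..<n} c {i}) i = (\<Sum>j\<in>{..<n} - {i}. G (sg i j * c {i, j}) i)"
        unfolding bd_vertex using G_sum i by simp
      also have "\<dots> = (\<Sum>j<n. (if j < i then G (c {i, j}) i else 0) - (if i < j then G (c {i, j}) i else 0))"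
        using i Gm by (intro sum.mono_neutral_cong_left) (auto simp: sg_def)
      finally show "(\<Sum>j<n. (if j < i then G (c {i, j}) i else 0) - (if i < j then G (c {i, j}) i else 0))
        = G (bd {..<n} c {i}) i" ..
    qed
    also have "\<dots> = 0" using c(2) G0 by simp
    finally show False using \<phi>(3) by simp
  qed
  then show thesis unfolding B_def using that by blast
qed

text \<open>A base vertex of \<open>I\<close> helps to fill cycles in degrees -1 and 0. In degree 1
  the sphere provides a filling, which is corrected by a multiple of the fundamental cycle; in
  degree 2 a vertex outside \<open>I\<close> forces the cycle, itself such a multiple, to be
  0.\<close>

lemma conn_imp_acyclic:
  assumes I: "conn I" "I \<subseteq> {..<n}" and N: "conn ({..<n} - I)"
  shows "acyclic (K I) {..<n}"
  unfolding acyclic_def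
proof (intro allI impI)
  fix d c assume "chain (K I) d c \<and> (\<forall>F. bd {..<n} c F = 0)"
  then have c: "chain (K I) d c" and cyc: "\<And>F. bd {..<n} c F = 0" by auto
  have fin: "finite F" if "c F \<noteq> 0" for F
    using that c finite_cone unfolding chain_def by blast
  obtain q where q: "q \<in> {..<n} - I" using conn_ne[OF N] by blast
  consider "d = 0" | "d = 1" | "d = 2" | "d = 3" | "d > 3" by linarith
  then show "\<exists>b. chain (K I) (Suc d) b \<and> bd {..<n} b = c"
  proof cases
    case 1
    obtain p where p: "p \<in> I" using conn_ne[OF I(1)] by blast
    define b where "b F = (if F = {p} then c {} else 0)" for F :: "nat set"
    have "bd {..<n} b F = c F" for F
    proof (cases "F = {}")
      case True
      have "bd {..<n} b {} = (\<Sum>x<n. if x = p then c {} else 0)"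
        unfolding bd_empty b_def by (intro sum.cong) auto
      then show ?thesis using True p I(2) by auto
    next
      case False
      have "bd {..<n} b F = 0"
      proof (rule ccontr)
        assume "bd {..<n} b F \<noteq> 0"
        then obtain x where "x \<notin> F" "insert x F = {p}"
          by (rule bd_nonzeroE) (auto simp: b_def split: if_splits)
        then show False using False by blast
      qed
      moreover have "c F = 0"
        using c fin[of F] 1 False unfolding chain_def by (metis card_0_eq)
      ultimately show ?thesis by simp
    qed
    moreover have "chain (K I) (Suc d) b"
      using p I(2) vertex 1 by (auto simp: chain_def b_def split: if_splits)
    ultimately show ?thesis by blast
  next
    case 2
    obtain p where p: "p \<in> I" using conn_ne[OF I(1)] by blast
    have "\<exists>b. chain (K I) 2 b \<and> (\<forall>F. bd {..<n} b F = (if F = {i} then 1 else 0) - (if F = {p} then 1 else 0))"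
      if "i \<in> I" for i
    proof (rule connD[OF I(1) p _ _ that])
      show "\<exists>b. chain (K I) 2 b \<and> (\<forall>F. bd {..<n} b F = (if F = {p} then 1 else 0) - (if F = {p} then 1 else 0))"
        by (intro exI[of _ "\<lambda>F. 0"]) (simp add: chain_def bd_def)
    next
      fix i j assume ij: "i \<in> I" "j \<in> I" "{i, j} \<in> C"
        "\<exists>b. chain (K I) 2 b \<and> (\<forall>F. bd {..<n} b F = (if F = {i} then 1 else 0) - (if F = {p} then 1 else 0))"
      then obtain b where b: "chain (K I) 2 b"
        "\<And>F. bd {..<n} b F = (if F = {i} then 1 else 0) - (if F = {p} then 1 else 0)" by blast
      show "\<exists>b. chain (K I) 2 b \<and> (\<forall>F. bd {..<n} b F = (if F = {j} then 1 else 0) - (if F = {p} then 1 else 0))"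
      proof (cases "i = j")
        case False
        have range: "i \<in> {..<n}" "j \<in> {..<n}" using ij I(2) by auto
        let ?e = "\<lambda>F. if F = {i, j} then sg j i else 0"
        have "bd {..<n} (\<lambda>F. b F + ?e F) F = (if F = {j} then 1 else 0) - (if F = {p} then 1 else 0)" for F
          unfolding bd_add b(2) bd_edge[OF finite_lessThan range False]
          using False sg_swap[OF False] by simp
        moreover have "chain (K I) 2 (\<lambda>F. b F + ?e F)"
          unfolding chain_def
        proof (intro allI impI)
          fix F assume "b F + ?e F \<noteq> 0"
          then consider "b F \<noteq> 0" | "F = {i, j}" by (auto split: if_splits)
          then show "F \<in> K I \<and> card F = 2"
          proof cases
            case 1
            then show ?thesis using b(1) unfolding chain_def by auto
          qed (use ij False in auto)
        qed
        ultimately show ?thesis by blast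
      qed (use ij(4) in simp)
    qed
    then have "\<forall>i\<in>I. \<exists>b. chain (K I) 2 b \<and> (\<forall>F. bd {..<n} b F = (if F = {i} then 1 else 0) - (if F = {p} then 1 else 0))"
      by simp
    from bchoice[OF this] obtain B where B: "\<And>i. i \<in> I \<Longrightarrow> chain (K I) 2 (B i)"
      "\<And>i F. i \<in> I \<Longrightarrow> bd {..<n} (B i) F = (if F = {i} then 1 else 0) - (if F = {p} then 1 else 0)"
      by auto
    have fI: "finite I" by (rule finite_subset[OF I(2)]) simp
    define b where "b F = (\<Sum>i\<in>I. c {i} * B i F)" for F
    have "chain (K I) (Suc d) b"
      unfolding chain_def
    proof (intro allI impI)
      fix F assume "b F \<noteq> 0"
      then obtain i where "i \<in> I" "B i F \<noteq> 0"
        unfolding b_def by (metis (no_types, lifting) mult_zero_right sum.not_neutral_contains_not_neutral)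
      then show "F \<in> K I \<and> card F = Suc d" using B(1) 2 unfolding chain_def by force
    qed
    moreover have "bd {..<n} b F = c F" for F
    proof -
      have "bd {..<n} c {} = (\<Sum>i\<in>I. c {i})"
        unfolding bd_empty using I(2) c unfolding chain_def
        by (intro sum.mono_neutral_right) auto
      \<comment> \<open>The coefficients of a reduced 0-cycle add up to 0, so the contributions of
        all the paths at the base vertex \<open>p\<close> cancel.\<close>
      then have c0: "(\<Sum>i\<in>I. c {i}) = 0" using cyc by simp
      have "bd {..<n} b F = (\<Sum>i\<in>I. c {i} * ((if F = {i} then 1 else 0) - (if F = {p} then 1 else 0)))"
        unfolding b_def bd_sum bd_scale using B(2) by (intro sum.cong) auto
      also have "\<dots> = (\<Sum>i\<in>I. if F = {i} then c {i} else 0) - (\<Sum>i\<in>I. c {i}) * (if F = {p} then 1 else 0)"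
        unfolding sum_distrib_right sum_subtractf[symmetric] by (intro sum.cong) (auto simp: algebra_simps)
      also have "\<dots> = (\<Sum>i\<in>I. if F = {i} then c {i} else 0)"
        by (simp add: c0)
      also have "\<dots> = c F"
      proof (cases "c F = 0")
        case True
        then show ?thesis by (intro trans[OF sum.neutral]) auto
      next
        case False
        then have "F \<subseteq> I" "card F = 1" using c 2 by (auto simp: chain_def)
        then obtain x where "F = {x}" "x \<in> I" by (auto simp: card_1_singleton_iff)
        then show ?thesis using fI by simp
      qed
      finally show ?thesis .
    qed
    ultimately show ?thesis by blast
  next
    case 3
    have "chain C 2 c" using c 3 by (auto simp: chain_def)
    then obtain b where b: "chain C 3 b" "bd {..<n} b = c"
      using H1_zero[OF _ cyc] by metis
    have bC: "b F \<noteq> 0 \<Longrightarrow> F \<in> C \<and> card F = 3" for F using b(1) by (auto simp: chain_def)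
    have around: "b S * om S = b T * om T"
      if "x \<in> {..<n} - I" "S \<in> C" "T \<in> C" "card S = 3" "card T = 3" "x \<in> S" "x \<in> T" for x S T
    proof (rule constant_around_vertex[OF _ _ that(2-)])
      fix k a b' assume *: "{x, k, a} \<in> C" "{x, k, b'} \<in> C" "card {x, k, a} = 3" "card {x, k, b'} = 3"
      have "bd {..<n} b {x, k} = 0"
        using b(2) c that(1) unfolding chain_def by auto
      then show "b {x, k, a} * om {x, k, a} = b {x, k, b'} * om {x, k, b'}"
        by (intro bd_zero_across_edge[OF _ _ *] bC)
    qed (use that in simp)
    obtain T0 where T0: "T0 \<in> C" "{q} \<subseteq> T0" "card T0 = 3"
      using extend_cone[OF vertex] q by blast
    \<comment> \<open>The coefficient of the fundamental cycle in \<open>b\<close> near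
      \<open>q\<close>. The outside of \<open>I\<close> is connected and \<open>c\<close> vanishes
      on every edge touching it, so all triangles touching the outside share this coefficient.
      Subtracting it leaves a filling inside \<open>K I\<close>.\<close>
    define \<gamma> where "\<gamma> = b T0 * om T0"
    have const: "b T * om T = \<gamma>" if T: "T \<in> C" "card T = 3" "x \<in> T" "x \<in> {..<n} - I" for T x
    proof -
      have "\<forall>T\<in>C. card T = 3 \<longrightarrow> x \<in> T \<longrightarrow> b T * om T = \<gamma>"
      proof (rule connD[OF N q _ _ T(4)])
        show "\<forall>T\<in>C. card T = 3 \<longrightarrow> q \<in> T \<longrightarrow> b T * om T = \<gamma>"
          unfolding \<gamma>_def using around[OF q _ T0(1) _ T0(3)] T0(2) by auto
      next
        fix i j assume ij: "i \<in> {..<n} - I" "j \<in> {..<n} - I" "{i, j} \<in> C"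
          "\<forall>T\<in>C. card T = 3 \<longrightarrow> i \<in> T \<longrightarrow> b T * om T = \<gamma>"
        obtain T' where T': "T' \<in> C" "{i, j} \<subseteq> T'" "card T' = 3"
          using extend_cone[OF ij(3)] by blast
        then have "b T' * om T' = \<gamma>" using ij(4) by auto
        then show "\<forall>T\<in>C. card T = 3 \<longrightarrow> j \<in> T \<longrightarrow> b T * om T = \<gamma>"
          using around[OF ij(2) _ T'(1) _ T'(3)] T'(2) by auto
      qed
      then show ?thesis using T by blast
    qed
    define o' where "o' F = (if F \<in> C \<and> card F = 3 then 1 * om F else 0)" for F
    have "chain (K {}) 2 (bd {..<n} o')"
      unfolding o'_def by (rule om_chain_bd) auto
    then have o'0: "bd {..<n} o' F = 0" for F
      unfolding chain_def by (cases "F = {}") auto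
    define b' where "b' F = b F - \<gamma> * o' F" for F
    have "chain (K I) 3 b'"
      unfolding chain_def
    proof (intro allI impI)
      fix F assume nz: "b' F \<noteq> 0"
      then have F: "F \<in> C" "card F = 3" using bC by (auto simp: b'_def o'_def split: if_splits)
      have "F \<subseteq> I"
      proof
        fix x assume x: "x \<in> F"
        show "x \<in> I"
        proof (rule ccontr)
          assume "x \<notin> I"
          then have "b F * om F = \<gamma>" using const[OF F x] x in_range[OF F(1)] by auto
          then have "b F * (om F * om F) = \<gamma> * om F" by (simp add: mult.assoc[symmetric])
          then have "b' F = 0" using F om_sq[OF F] by (simp add: b'_def o'_def)
          then show False using nz by simp
        qed
      qed
      then show "F \<in> K I \<and> card F = 3" using F by simp
    qed
    moreover have "bd {..<n} b' = c"
      unfolding b'_def by (rule ext) (simp add: bd_diff bd_scale o'0 b(2))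
    ultimately show ?thesis using 3 by (intro exI[of _ b']) simp
  next
    case 4
    have cC: "c F \<noteq> 0 \<Longrightarrow> F \<in> C \<and> card F = 3" for F using c 4 by (auto simp: chain_def)
    obtain T0 where T0: "T0 \<in> C" "{q} \<subseteq> T0" "card T0 = 3"
      using extend_cone[OF vertex] q by blast
    have c0: "c T0 = 0" using c T0 q unfolding chain_def by blast
    have "c F = 0" for F
    proof (rule ccontr)
      assume nz: "c F \<noteq> 0"
      then have F: "F \<in> C" "card F = 3" using cC by auto
      have "c F * om F = c T0 * om T0"
        by (rule cycle_constant[OF cC cyc F(1) T0(1) F(2) T0(3)])
      then have "om F = 0" using c0 nz by simp
      then show False using om_sq[OF F] by simp
    qed
    then have "c = (\<lambda>F. 0)" by blast
    then show ?thesis by (intro exI[of _ "\<lambda>F. 0"]) (auto simp: chain_def bd_def)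
  next
    case 5
    have "c F = 0" for F using c 5 card_cone[of F] unfolding chain_def by fastforce
    then have "c = (\<lambda>F. 0)" by blast
    then show ?thesis by (intro exI[of _ "\<lambda>F. 0"]) (auto simp: chain_def bd_def)
  qed
qed

lemma acyclic_iff:
  assumes "I \<subseteq> {..<n}"
  shows "acyclic (K I) {..<n} \<longleftrightarrow> conn I \<and> conn ({..<n} - I)"
  using acyclic_imp_conn acyclic_imp_conn_compl conn_imp_acyclic assms by blast

end

section \<open>Bundles from piecewise linear functions\<close>

text \<open>Cramer's rule. For lattice vectors every coefficient is an integer, which turns
  orthogonality to a ray into an integer relation.\<close>

lemma cramer3:
  fixes a b c x :: "real^3"
  shows "((a \<times> b) \<bullet> c) *\<^sub>R x = ((b \<times> c) \<bullet> x) *\<^sub>R a + ((c \<times> a) \<bullet> x) *\<^sub>R b + ((a \<times> b) \<bullet> x) *\<^sub>R c"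
  by (simp add: vec_eq_iff forall_3 cross3_def inner_vec_def sum_3, algebra)

lemma orthogonal_imp_multiple_cross:
  fixes a b y :: "real^3"
  assumes "a \<times> b \<noteq> 0" "y \<bullet> a = 0" "y \<bullet> b = 0"
  obtains \<sigma> where "y = \<sigma> *\<^sub>R (a \<times> b)"
proof -
  let ?m = "a \<times> b"
  define \<sigma> where "\<sigma> = (?m \<bullet> y) / (?m \<bullet> ?m)"
  define z where "z = y - \<sigma> *\<^sub>R ?m"
  have "?m \<bullet> z = 0" using assms(1) by (simp add: z_def \<sigma>_def inner_diff_right)
  then obtain \<alpha> \<beta> where "z = \<alpha> *\<^sub>R a + \<beta> *\<^sub>R b" using in_plane_cross[OF assms(1)] by metis
  moreover have "z \<bullet> a = 0" "z \<bullet> b = 0"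
    using assms(2,3) by (simp_all add: z_def inner_diff_left dot_cross_self)
  ultimately have "z \<bullet> z = 0" by (metis inner_add_right inner_scaleR_right mult_zero_right add_0)
  then show thesis by (intro that[of \<sigma>]) (simp add: z_def)
qed

lemma midpoint_decomposition:
  fixes a b m :: "real^3"
  assumes "a - b = \<sigma> *\<^sub>R m"
  obtains u where "a = u + (\<sigma> / 2) *\<^sub>R m" "b = u - (\<sigma> / 2) *\<^sub>R m"
proof -
  have "a = (b + (\<sigma> / 2) *\<^sub>R m) + (\<sigma> / 2) *\<^sub>R m"
    unfolding add.assoc scaleR_add_left[symmetric] using assms by (simp add: algebra_simps)
  then show thesis by (intro that[of "b + (\<sigma> / 2) *\<^sub>R m"]) auto
qed

text \<open>An additive, possibly discontinuous map. It replaces real solutions of integer linear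
  equations by rational ones without losing a chosen nonzero entry.\<close>

lemma exists_rational_functional_real:
  fixes y :: real
  assumes "y \<noteq> 0"
  obtains f :: "real \<Rightarrow> rat" where "\<And>a b. f (a + b) = f a + f b" "\<And>z a. f (of_int z * a) = of_int z * f a"
    "f y \<noteq> 0"
proof -
  define s where "s q x = of_rat q * x" for q :: rat and x :: real
  have vs: "vector_space s"
    by unfold_locales (auto simp: s_def of_rat_add of_rat_mult algebra_simps)
  interpret vector_space s by (rule vs)
  obtain \<phi> :: "real \<Rightarrow> rat" where \<phi>: "\<And>x y. \<phi> (x + y) = \<phi> x + \<phi> y" "\<And>q x. \<phi> (s q x) = q * \<phi> x" "\<phi> y \<noteq> 0"
  proof (rule rational_functional[OF vs subspace_single_0, of y])
    show "y \<notin> {0}" using assms by simp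
  qed (rule that)
  show thesis
  proof (rule that[of \<phi>])
    fix z a show "\<phi> (of_int z * a) = of_int z * \<phi> a"
      using \<phi>(2)[of "of_int z" a] by (simp add: s_def)
  qed (use \<phi> in auto)
qed

lemma cross_integral:
  fixes a b c :: "real^3"
  assumes "\<And>k. a $ k \<in> \<int>" "\<And>k. b $ k \<in> \<int>" "\<And>k. c $ k \<in> \<int>"
  shows "(a \<times> b) \<bullet> c \<in> \<int>"
  using assms by (simp add: cross3_def inner_vec_def sum_3)

context fan
begin

text \<open>\<open>v i\<close> lies in the cone over \<open>S\<close> only when \<open>i\<close>
  belongs to \<open>S\<close>, so the support is an induced subcomplex.\<close>

lemma Supp_eq: "Supp n v C r = K {i. i < n \<and> r i \<ge> 0}"
proof (intro equalityI subsetI)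
  fix J assume "J \<in> Supp n v C r"
  then obtain S where S: "J \<subseteq> {..<n}" "\<forall>i\<in>J. r i \<ge> 0" "S \<in> C" "\<forall>i\<in>J. v i \<in> cone_of v S"
    unfolding Supp_def by auto
  then have "J \<subseteq> S" using vertex_in_cone_iff[OF S(3)] by auto
  then show "J \<in> K {i. i < n \<and> r i \<ge> 0}" using face[OF S(3)] S by auto
next
  fix J assume J: "J \<in> K {i. i < n \<and> r i \<ge> 0}"
  then have "\<forall>i\<in>J. v i \<in> cone_of v J" using vertex_in_cone_iff[of J] by auto
  then show "J \<in> Supp n v C r" using J unfolding Supp_def by auto
qed

definition good :: "nat set \<Rightarrow> bool" where
  "good I \<longleftrightarrow> conn I \<and> conn ({..<n} - I)"

lemma H_trivial_iff:
  "H_trivial n v C r \<longleftrightarrow> (\<forall>r'\<in>pic_class n v r. good {i. i < n \<and> r' i \<ge> 0})"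
  unfolding H_trivial_def Supp_eq good_def by (intro ball_cong refl acyclic_iff) auto

text \<open>The twist at \<open>q\<close> makes the inequality there strict, because all values are
  integers. Distinct multiples give distinct classes, as equal ones would make a nonzero multiple of
  \<open>\<psi>\<close> linear.\<close>

lemma infinite_bundles:
  fixes \<psi> :: "nat \<Rightarrow> int"
  assumes nonlin: "\<not> (\<exists>w. \<forall>i<n. of_int (\<psi> i) = w \<bullet> v i)"
    and good: "\<And>k w. k \<ge> 1 \<Longrightarrow> good {i. i < n \<and> k * of_int (\<psi> i) + w \<bullet> v i \<ge> 0
      \<and> (i = q \<longrightarrow> k * of_int (\<psi> i) + w \<bullet> v i > 0)}"
  shows "infinite (H_trivial_bundles n v C)"
proof -
  \<comment> \<open>\<open>Suc k\<close> keeps the multiplier at least 1, as the hypothesis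
    \<open>good\<close> requires.\<close>
  define R where "R k i = (if i < n then int (Suc k) * \<psi> i - (if i = q then 1 else 0) else 0)" for k i
  define f where "f k = pic_class n v (R k)" for k
  have "inj f"
  proof (rule injI, rule ccontr)
    fix k l assume eq: "f k = f l" and ne: "k \<noteq> l"
    have "R k \<in> f k"
      unfolding f_def pic_class_def by (auto simp: R_def intro!: exI[of _ 0])
    then have "R k \<in> pic_class n v (R l)" using eq by (simp add: f_def)
    then obtain w where w: "\<forall>i<n. of_int (R k i) - of_int (R l i) = w \<bullet> v i"
      unfolding pic_class_def by auto
    have "\<forall>i<n. of_int (\<psi> i) = ((1 / (real k - real l)) *\<^sub>R w) \<bullet> v i"
    proof (intro allI impI)
      fix i assume i: "i < n"
      then have "(real k - real l) * of_int (\<psi> i) = w \<bullet> v i"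
        using w[rule_format, OF i] by (simp add: R_def algebra_simps)
      then show "of_int (\<psi> i) = ((1 / (real k - real l)) *\<^sub>R w) \<bullet> v i"
        using ne by (simp add: field_simps)
    qed
    then show False using nonlin by blast
  qed
  moreover have "range f \<subseteq> H_trivial_bundles n v C"
  proof (intro image_subsetI)
    fix k
    have "H_trivial n v C (R k)"
      unfolding H_trivial_iff
    proof
      fix r' assume "r' \<in> pic_class n v (R k)"
      then obtain w where w: "\<forall>i<n. of_int (r' i) - of_int (R k i) = w \<bullet> v i"
        unfolding pic_class_def by auto
      have "r' i \<ge> 0 \<longleftrightarrow> real (Suc k) * of_int (\<psi> i) + w \<bullet> v i \<ge> 0
          \<and> (i = q \<longrightarrow> real (Suc k) * of_int (\<psi> i) + w \<bullet> v i > 0)" if "i < n" for i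
      proof -
        have "real (Suc k) * of_int (\<psi> i) + w \<bullet> v i = of_int (r' i + (if i = q then 1 else 0))"
          using w[rule_format, OF that] that by (simp add: R_def split: if_splits)
        then show ?thesis by (simp only: of_int_0_le_iff of_int_0_less_iff) auto
      qed
      then have "{i. i < n \<and> r' i \<ge> 0} = {i. i < n \<and> real (Suc k) * of_int (\<psi> i) + w \<bullet> v i \<ge> 0
          \<and> (i = q \<longrightarrow> real (Suc k) * of_int (\<psi> i) + w \<bullet> v i > 0)}" by blast
      then show "good {i. i < n \<and> r' i \<ge> 0}" using good[of "real (Suc k)" w] by simp
    qed
    then show "f k \<in> H_trivial_bundles n v C"
      unfolding H_trivial_bundles_def f_def R_def by (intro CollectI exI conjI) auto
  qed
  ultimately show ?thesis
    using range_inj_infinite finite_subset by blast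
qed

text \<open>There are two star centres, one on each side of zero. The segments without their end at
  a ray avoid the value 0, so rays where \<open>\<phi>\<close> vanishes may belong to either
  side.\<close>

lemma good_of_points:
  assumes I: "I \<subseteq> {..<n}" "\<And>i. i < n \<Longrightarrow> \<phi> i > 0 \<Longrightarrow> i \<in> I" "\<And>i. i \<in> I \<Longrightarrow> \<phi> i \<ge> 0"
    and e: "interp \<phi> e > 0" "\<And>i t. i \<in> I \<Longrightarrow> 0 \<le> t \<Longrightarrow> t < 1 \<Longrightarrow> interp \<phi> (t *\<^sub>R v i + (1 - t) *\<^sub>R e) > 0"
    and e': "interp \<phi> e' < 0"
      "\<And>i t. i < n \<Longrightarrow> i \<notin> I \<Longrightarrow> 0 \<le> t \<Longrightarrow> t < 1 \<Longrightarrow> interp \<phi> (t *\<^sub>R v i + (1 - t) *\<^sub>R e') < 0"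
  shows "good I"
  unfolding good_def
proof
  have pos: "\<exists>j\<in>I. h x j > 0" if "interp \<phi> x > 0" for x
    using interp_pos[OF that] I(2) by blast
  have neg: "\<exists>j\<in>{..<n} - I. h x j > 0" if x: "interp \<phi> x < 0" for x
  proof -
    obtain j where j: "j < n" "h x j > 0" "\<phi> j < 0" using interp_neg[OF x] by blast
    then have "j \<notin> I" using I(3)[of j] by auto
    then show ?thesis using j by blast
  qed
  show "conn I"
    by (rule conn_starlike[of I e]) (use pos[OF e(1)] pos[OF e(2)] I(1) in auto)
  show "conn ({..<n} - I)"
    by (rule conn_starlike[of _ e']) (use neg[OF e'(1)] neg[OF e'(2)] in auto)
qed

lemma interp_mult: "t \<ge> 0 \<Longrightarrow> interp g (t *\<^sub>R x) = t * interp g x"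
  by (simp add: interp_def h_scale sum_distrib_left mult_ac)

text \<open>If the interpolation grows at a constant rate along \<open>e\<close>, then
  \<open>e\<close> and \<open>- e\<close> are star centres for the two sides.\<close>

lemma good_of_direction:
  fixes q :: nat
  assumes move: "\<And>x t. interp \<phi> (x + t *\<^sub>R e) = interp \<phi> x + t * \<eta>" and \<eta>: "\<eta> > 0"
  defines "I \<equiv> {i. i < n \<and> \<phi> i \<ge> 0 \<and> (i = q \<longrightarrow> \<phi> i > 0)}"
  shows "good I"
proof (rule good_of_points[of I \<phi> e "- e"])
  have seg: "interp \<phi> (t *\<^sub>R v i + s *\<^sub>R e) = t * \<phi> i + s * \<eta>" if "i < n" "t \<ge> 0" for i t s
    by (simp add: move interp_mult interp_vertex that)
  show "interp \<phi> e > 0" "interp \<phi> (- e) < 0"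
    using move[of 0 1] move[of 0 "-1"] \<eta> by (simp_all add: interp_zero)
  show "0 < interp \<phi> (t *\<^sub>R v i + (1 - t) *\<^sub>R e)" if "i \<in> I" "0 \<le> t" "t < 1" for i t
    using that \<eta> by (subst seg) (auto simp: I_def intro!: add_nonneg_pos)
  show "interp \<phi> (t *\<^sub>R v i + (1 - t) *\<^sub>R (- e)) < 0" if "i < n" "i \<notin> I" "0 \<le> t" "t < 1" for i t
  proof -
    have "\<phi> i \<le> 0" using that by (auto simp: I_def)
    then have "t * \<phi> i \<le> 0" using that by (simp add: mult_nonneg_nonpos)
    moreover have "(1 - t) * \<eta> > 0" using that \<eta> by simp
    moreover have "interp \<phi> (t *\<^sub>R v i + (1 - t) *\<^sub>R (- e)) = t * \<phi> i - (1 - t) * \<eta>"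
      using seg[OF that(1,3), of "- (1 - t)"] by (simp add: algebra_simps)
    ultimately show ?thesis by simp
  qed
qed (auto simp: I_def)

text \<open>Adding \<open>w\<close> either makes the function grow along the line of
  \<open>v p\<close> and \<open>v q\<close>, or leaves it 0 on that line. In the second case the two
  rays are the star centres, since the strict inequality puts \<open>p\<close> and \<open>q\<close>
  on different sides.\<close>

lemma infinite_bundles_antipodal:
  fixes \<psi> :: "nat \<Rightarrow> int"
  assumes p: "p < n" "q < n" and \<beta>: "\<beta> > 0" "v q = - \<beta> *\<^sub>R v p"
    and nonlin: "\<not> (\<exists>w. \<forall>i<n. of_int (\<psi> i) = w \<bullet> v i)"
    and inv: "\<And>x t. interp (\<lambda>i. of_int (\<psi> i)) (x + t *\<^sub>R v p) = interp (\<lambda>i. of_int (\<psi> i)) x"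
  shows "infinite (H_trivial_bundles n v C)"
proof (rule infinite_bundles[OF nonlin])
  fix k :: real and w assume k: "k \<ge> 1"
  define \<phi> where "\<phi> i = k * of_int (\<psi> i) + w \<bullet> v i" for i
  define I where "I = {i. i < n \<and> \<phi> i \<ge> 0 \<and> (i = q \<longrightarrow> \<phi> i > 0)}"
  define \<eta> where "\<eta> = w \<bullet> v p"
  have ip: "interp \<phi> x = k * interp (\<lambda>i. of_int (\<psi> i)) x + w \<bullet> x" for x
    unfolding \<phi>_def interp_add interp_scale interp_linear ..
  have move: "interp \<phi> (x + s *\<^sub>R v p) = interp \<phi> x + s * \<eta>" for x s
    by (simp add: ip inv inner_add_right \<eta>_def)
  have seg: "interp \<phi> (t *\<^sub>R v i + s *\<^sub>R v p) = t * \<phi> i + s * \<eta>" if "i < n" "t \<ge> 0" for i t s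
    by (simp add: move interp_mult interp_vertex that)
  have ray: "interp \<phi> (s *\<^sub>R v p) = s * \<eta>" for s
    using move[of 0 s] by (simp add: interp_zero)
  have \<phi>q: "\<phi> q = - \<beta> * \<eta>" "\<phi> p = \<eta>"
    using ray[of "- \<beta>"] ray[of 1] interp_vertex[OF p(2), of \<phi>] interp_vertex[OF p(1), of \<phi>] \<beta>(2) by auto
  have sI: "I \<subseteq> {..<n}" by (auto simp: I_def)
  show "good {i. i < n \<and> k * of_int (\<psi> i) + w \<bullet> v i \<ge> 0 \<and> (i = q \<longrightarrow> k * of_int (\<psi> i) + w \<bullet> v i > 0)}"
    unfolding \<phi>_def[symmetric] I_def[symmetric]
  proof (cases "\<eta> = 0")
    case False
    show "good I"
      unfolding I_def
    proof (rule good_of_direction)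
      show "interp \<phi> (x + t *\<^sub>R (sgn \<eta> *\<^sub>R v p)) = interp \<phi> x + t * \<bar>\<eta>\<bar>" for x t
        using move[of x "t * sgn \<eta>"] by (simp add: abs_sgn mult_ac)
    qed (use False in simp)
  next
    case True
    have "p \<noteq> q"
    proof
      assume "p = q"
      then have "v p = - \<beta> *\<^sub>R v p" using \<beta>(2) by simp
      then have "v p + \<beta> *\<^sub>R v p = - \<beta> *\<^sub>R v p + \<beta> *\<^sub>R v p"
        by (rule arg_cong[of _ _ "\<lambda>y. y + \<beta> *\<^sub>R v p"])
      then have "(1 + \<beta>) *\<^sub>R v p = 0" by (simp add: scaleR_add_left)
      then show False using \<beta>(1) nonzero[OF p(1)] by simp
    qed
    then have pI: "p \<in> I" using \<phi>q p True by (auto simp: I_def)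
    have qI: "q \<notin> I" using \<phi>q True by (auto simp: I_def)
    have seg0: "interp \<phi> (t *\<^sub>R v i + s *\<^sub>R v p) = t * \<phi> i" if "i < n" "t \<ge> 0" for i t s
      using seg[OF that] True by simp
    have "conn I"
    proof (rule conn_starlike[of I "v p"])
      fix i and t :: real assume i: "i \<in> I" and t: "0 \<le> t" "t < 1"
      define x where "x = t *\<^sub>R v i + (1 - t) *\<^sub>R v p"
      have \<phi>x: "interp \<phi> x \<ge> 0" using seg0[of i t "1 - t"] i t by (auto simp: x_def I_def)
      show "\<exists>j\<in>I. h (t *\<^sub>R v i + (1 - t) *\<^sub>R v p) j > 0"
        unfolding x_def[symmetric]
      proof (rule ccontr)
        \<comment> \<open>Outside \<open>I\<close> the function is negative on the rays except at
          \<open>q\<close>, so \<open>x\<close>, where it is nonnegative, would lie on the ray of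
          \<open>q\<close>. This forces \<open>i = q\<close>, or \<open>v p\<close> onto the ray of
          \<open>q\<close>.\<close>
        assume no: "\<not> (\<exists>j\<in>I. h x j > 0)"
        have neg: "\<phi> j * h x j \<le> 0" and z: "h x j > 0 \<Longrightarrow> j \<noteq> q \<Longrightarrow> \<phi> j * h x j < 0" if "j < n" for j
        proof -
          have "h x j = 0 \<or> j = q \<or> \<phi> j < 0"
          proof (rule ccontr)
            assume *: "\<not> ?thesis"
            then have "j \<in> I" using that by (simp add: I_def)
            moreover have "h x j > 0" using * h_nonneg[of x j] by simp
            ultimately show False using no by blast
          qed
          then show "\<phi> j * h x j \<le> 0"
            using h_nonneg[of x j] \<phi>q True by (auto intro: mult_nonpos_nonneg)
          show "\<phi> j * h x j < 0" if "h x j > 0" "j \<noteq> q"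
            using \<open>h x j = 0 \<or> j = q \<or> \<phi> j < 0\<close> that by (auto intro: mult_neg_pos)
        qed
        have hx: "h x j = 0" if "j < n" "j \<noteq> q" for j
        proof (rule ccontr)
          assume "h x j \<noteq> 0"
          then have "h x j > 0" using h_nonneg[of x j] by simp
          then have "\<phi> j * h x j < 0" using z that by blast
          then have "interp \<phi> x < (\<Sum>i<n. 0)"
            unfolding interp_def by (intro sum_strict_mono_ex1) (use neg that in auto)
          then show False using \<phi>x by simp
        qed
        have "x = (\<Sum>j<n. if j = q then h x q *\<^sub>R v q else 0)"
          by (subst h_sum[of x, symmetric]) (intro sum.cong, use hx in auto)
        then have xq: "x = h x q *\<^sub>R v q" using p by simp
        then have vp: "t *\<^sub>R v i = (h x q * (- \<beta>) - (1 - t)) *\<^sub>R v p"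
          unfolding \<beta>(2) by (simp add: x_def algebra_simps)
        show False
        proof (cases "t = 0")
          case True
          then have "(h x q * (- \<beta>) - (1 - t)) *\<^sub>R v p = 0" using vp by simp
          then have "h x q * (- \<beta>) - (1 - t) = 0" using nonzero[OF p(1)] unfolding scaleR_eq_0_iff by blast
          moreover have "h x q * \<beta> \<ge> 0" using h_nonneg[of x q] \<beta>(1) by simp
          ultimately show False using True by simp
        next
          case False
          define s where "s = (h x q * \<beta> + (1 - t)) / (\<beta> * t)"
          have coeff: "inverse t * (h x q * (- \<beta>) - (1 - t)) = s * (- \<beta>)"
            using False \<beta>(1) by (simp add: s_def field_simps)
          have "v i = inverse t *\<^sub>R (t *\<^sub>R v i)" using False by simp
          also have "\<dots> = s *\<^sub>R v q"
            unfolding vp \<beta>(2) scaleR_scaleR coeff ..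
          finally have "v i = s *\<^sub>R v q" .
          moreover have "s \<ge> 0" using h_nonneg[of x q] \<beta>(1) t False by (simp add: s_def)
          ultimately have "i = q" using i p by (intro ray_inj[of i q s]) (auto simp: I_def)
          then show False using i qI by simp
        qed
      qed
    qed (use pI sI in auto)
    moreover have "conn ({..<n} - I)"
    proof (rule conn_starlike[of _ "v q"])
      fix i and t :: real assume i: "i \<in> {..<n} - I" and t: "0 \<le> t" "t < 1"
      define x where "x = t *\<^sub>R v i + (1 - t) *\<^sub>R v q"
      show "\<exists>j\<in>{..<n} - I. h (t *\<^sub>R v i + (1 - t) *\<^sub>R v q) j > 0"
        unfolding x_def[symmetric]
      proof (cases "t = 0 \<or> i = q")
        case True
        have "x = v q" using True by (auto simp: x_def algebra_simps)
        then show "\<exists>j\<in>{..<n} - I. h x j > 0" using qI p by (intro bexI[of _ q]) (auto simp: h_vertex)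
      next
        case False
        then have "\<phi> i < 0" using i by (auto simp: I_def)
        then have "t * \<phi> i < 0" using False t by (simp add: mult_pos_neg)
        moreover have "interp \<phi> x = t * \<phi> i"
          using seg0[of i t "- (1 - t) * \<beta>"] i t by (simp add: x_def \<beta>(2) algebra_simps)
        ultimately obtain j where "j < n" "h x j > 0" "\<phi> j < 0" using interp_neg[of \<phi> x] by auto
        then show "\<exists>j\<in>{..<n} - I. h x j > 0" by (intro bexI[of _ j]) (auto simp: I_def)
      qed
    qed (use qI p in auto)
    ultimately show "good I" by (simp add: good_def)
  qed
qed

text \<open>If \<open>w\<close> has a component orthogonal to \<open>m\<close>, the function grows
  along it. Otherwise w = s m and everything depends on m . x alone: for |s| at most k the fold
  stays nonnegative, and for larger |s| its sign is that of s (m . x).\<close>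

lemma infinite_bundles_plane:
  assumes m: "m \<noteq> 0" "\<And>i. i < n \<Longrightarrow> m \<bullet> v i \<in> \<int>"
    and q: "q < n" "m \<bullet> v q = 0"
    and abs: "\<And>x. interp (\<lambda>i. \<bar>m \<bullet> v i\<bar>) x = \<bar>m \<bullet> x\<bar>"
  shows "infinite (H_trivial_bundles n v C)"
proof -
  define \<psi> :: "nat \<Rightarrow> int" where "\<psi> i = \<lfloor>\<bar>m \<bullet> v i\<bar>\<rfloor>" for i
  have \<psi>: "of_int (\<psi> i) = \<bar>m \<bullet> v i\<bar>" if "i < n" for i
    using m(2)[OF that] unfolding \<psi>_def by (metis Ints_abs Ints_cases floor_of_int)
  have mm: "m \<bullet> m > 0" using m(1) by simp
  show ?thesis
  proof (rule infinite_bundles[of \<psi> q])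
    show "\<not> (\<exists>w. \<forall>i<n. of_int (\<psi> i) = w \<bullet> v i)"
    proof
      assume "\<exists>w. \<forall>i<n. of_int (\<psi> i) = w \<bullet> v i"
      then obtain w where w: "\<forall>i<n. \<bar>m \<bullet> v i\<bar> = w \<bullet> v i" using \<psi> by auto
      have "\<bar>m \<bullet> x\<bar> = w \<bullet> x" for x
      proof -
        have "interp (\<lambda>i. \<bar>m \<bullet> v i\<bar>) x = interp (\<lambda>i. w \<bullet> v i) x"
          unfolding interp_def using w by (intro sum.cong) auto
        then show ?thesis by (simp add: abs interp_linear)
      qed
      from this[of m] this[of "- m"] show False using mm by simp
    qed
    fix k :: real and w assume k: "k \<ge> 1"
    define \<phi> where "\<phi> i = k * \<bar>m \<bullet> v i\<bar> + w \<bullet> v i" for i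
    define I where "I = {i. i < n \<and> \<phi> i \<ge> 0 \<and> (i = q \<longrightarrow> \<phi> i > 0)}"
    have ip: "interp \<phi> x = k * \<bar>m \<bullet> x\<bar> + w \<bullet> x" for x
      unfolding \<phi>_def interp_add interp_scale interp_linear abs ..
    have "{i. i < n \<and> k * of_int (\<psi> i) + w \<bullet> v i \<ge> 0 \<and> (i = q \<longrightarrow> k * of_int (\<psi> i) + w \<bullet> v i > 0)} = I"
      unfolding I_def \<phi>_def by (auto simp: \<psi>)
    moreover have "good I"
    proof -
      define e where "e = w - ((w \<bullet> m) / (m \<bullet> m)) *\<^sub>R m"
      have me: "m \<bullet> e = 0" using mm by (simp add: e_def inner_diff_right inner_commute)
      have "w \<bullet> e = (e + ((w \<bullet> m) / (m \<bullet> m)) *\<^sub>R m) \<bullet> e" by (simp add: e_def)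
      then have we: "w \<bullet> e = e \<bullet> e" by (simp add: inner_add_left me)
      show "good I"
      proof (cases "e = 0")
        case False
        then have ee: "e \<bullet> e > 0" by simp
        have "interp \<phi> (x + t *\<^sub>R e) = interp \<phi> x + t * (e \<bullet> e)" for x t
          by (simp add: ip inner_add_right me we)
        then show "good I" unfolding I_def using ee by (rule good_of_direction)
      next
        case True
        define s where "s = (w \<bullet> m) / (m \<bullet> m)"
        have w: "w = s *\<^sub>R m" using True by (simp add: e_def s_def)
        have ips: "interp \<phi> x = k * \<bar>m \<bullet> x\<bar> + s * (m \<bullet> x)" for x by (simp add: ip w)
        have \<phi>s: "\<phi> i = k * \<bar>m \<bullet> v i\<bar> + s * (m \<bullet> v i)" for i by (simp add: \<phi>_def w)
        show "good I"
        proof (cases "\<bar>s\<bar> \<le> k")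
          case True
          have "k * \<bar>y\<bar> + s * y \<ge> 0" for y :: real
          proof -
            have "\<bar>s\<bar> * \<bar>y\<bar> \<le> k * \<bar>y\<bar>" using True by (intro mult_right_mono) auto
            moreover have "- (s * y) \<le> \<bar>s\<bar> * \<bar>y\<bar>" using abs_mult[of s y] by linarith
            ultimately show ?thesis by linarith
          qed
          then have "I = {..<n} - {q}" using q by (auto simp: I_def \<phi>s)
          moreover have "conn {q}" unfolding conn_def by auto
          moreover have "{..<n} - ({..<n} - {q}) = {q}" using q by auto
          ultimately show "good I" unfolding good_def using conn_delete[OF q(1)] by simp
        next
          case False
          \<comment> \<open>Orients the normal so that the interpolation of \<open>\<phi>\<close>
            has the sign of m' . x.\<close>
          define m' where "m' = sgn s *\<^sub>R m"
          have s0: "s \<noteq> 0" "\<bar>s\<bar> > k" using False k by auto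
          have m'm: "m' \<bullet> x = sgn s * (m \<bullet> x)" for x by (simp add: m'_def)
          have ips': "interp \<phi> x = k * \<bar>m' \<bullet> x\<bar> + \<bar>s\<bar> * (m' \<bullet> x)" for x
            using s0 by (simp add: ips m'm abs_mult sgn_if)
          have \<phi>s': "\<phi> i = k * \<bar>m' \<bullet> v i\<bar> + \<bar>s\<bar> * (m' \<bullet> v i)" for i
            using s0 by (simp add: \<phi>s m'm abs_mult sgn_if)
          have sign: "k * \<bar>y\<bar> + \<bar>s\<bar> * y > 0 \<longleftrightarrow> y > 0" "k * \<bar>y\<bar> + \<bar>s\<bar> * y < 0 \<longleftrightarrow> y < 0" for y :: real
          proof -
            have "y > 0 \<Longrightarrow> k * \<bar>y\<bar> + \<bar>s\<bar> * y > 0" using k s0 by (simp add: add_pos_pos)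
            moreover have "y < 0 \<Longrightarrow> k * \<bar>y\<bar> + \<bar>s\<bar> * y < 0"
              using s0 by (simp add: mult_less_cancel_right)
            ultimately show "k * \<bar>y\<bar> + \<bar>s\<bar> * y > 0 \<longleftrightarrow> y > 0" "k * \<bar>y\<bar> + \<bar>s\<bar> * y < 0 \<longleftrightarrow> y < 0"
              by (cases "y > 0"; cases "y < 0"; auto)+
          qed
          have m'2: "m' \<bullet> m' > 0" using s0 m(1) by (auto simp: m'_def sgn_if)
          show "good I"
          proof (rule good_of_points[of I \<phi> m' "- m'"])
            show "interp \<phi> m' > 0" "interp \<phi> (- m') < 0"
              unfolding ips' sign using m'2 by auto
            show "0 < interp \<phi> (t *\<^sub>R v i + (1 - t) *\<^sub>R m')" if "i \<in> I" "0 \<le> t" "t < 1" for i t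
            proof -
              have "\<not> m' \<bullet> v i < 0" using that sign(2)[of "m' \<bullet> v i"] by (auto simp: I_def \<phi>s')
              then show ?thesis
                unfolding ips' sign using that m'2 by (auto simp: inner_add_right intro!: add_nonneg_pos)
            qed
            show "interp \<phi> (t *\<^sub>R v i + (1 - t) *\<^sub>R (- m')) < 0" if "i < n" "i \<notin> I" "0 \<le> t" "t < 1" for i t
            proof -
              have "\<not> m' \<bullet> v i > 0" using that sign(1)[of "m' \<bullet> v i"] by (auto simp: I_def \<phi>s')
              then have "t * (m' \<bullet> v i) \<le> 0" using that by (simp add: mult_nonneg_nonpos)
              moreover have "(1 - t) * (m' \<bullet> m') > 0" using that m'2 by simp
              ultimately show ?thesis
                unfolding ips' sign by (simp add: inner_add_right inner_diff_right)
            qed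
          qed (auto simp: I_def)
        qed
      qed
    qed
    ultimately show "good {i. i < n \<and> k * of_int (\<psi> i) + w \<bullet> v i \<ge> 0
      \<and> (i = q \<longrightarrow> k * of_int (\<psi> i) + w \<bullet> v i > 0)}" by simp
  qed
qed

section \<open>Piecewise linear functions with gradients orthogonal to a direction\<close>

definition flat :: "real^3 \<Rightarrow> (nat \<Rightarrow> real) \<Rightarrow> bool" where
  "flat e g \<longleftrightarrow> (\<forall>S\<in>C. \<exists>u. u \<bullet> e = 0 \<and> (\<forall>j\<in>S. u \<bullet> v j = g j))"

lemma flat_uminus: "flat (- e) g \<longleftrightarrow> flat e g"
  by (simp add: flat_def)

lemma flat_scale: "c \<noteq> 0 \<Longrightarrow> flat (c *\<^sub>R e) g \<longleftrightarrow> flat e g"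
  by (simp add: flat_def)

text \<open>Along a line in direction \<open>e\<close> the interpolation is continuous with finitely many values.\<close>
lemma flat_invariant:
  assumes "flat e g"
  shows "interp g (x + t *\<^sub>R e) = interp g x"
proof -
  obtain u where u: "\<forall>S\<in>C. u S \<bullet> e = 0 \<and> (\<forall>j\<in>S. u S \<bullet> v j = g j)"
    using bchoice[OF assms[unfolded flat_def]] by blast
  let ?f = "\<lambda>t. interp g (x + t *\<^sub>R e)"
  have "range ?f \<subseteq> (\<lambda>S. u S \<bullet> x) ` C"
  proof (intro image_subsetI)
    fix t
    obtain S where S: "S \<in> C" "x + t *\<^sub>R e \<in> cone_of v S" using cones_cover by blast
    have "?f t = u S \<bullet> (x + t *\<^sub>R e)"
      by (rule interp_on_cone[OF S(1) _ S(2)]) (use u S(1) in blast)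
    then have "?f t = u S \<bullet> x" using u S(1) by (simp add: inner_add_right)
    then show "?f t \<in> (\<lambda>S. u S \<bullet> x) ` C" using S(1) by blast
  qed
  then have "finite (range ?f)"
    using finite_fan finite_surj by blast
  moreover have "continuous_on UNIV ?f"
    by (rule continuous_on_compose2[OF continuous_interp[of UNIV]]) (auto intro!: continuous_intros)
  ultimately have "?f constant_on UNIV"
    by (intro continuous_finite_range_constant) auto
  then obtain c where "\<And>t. ?f t = c" unfolding constant_on_def by blast
  from this[of t] this[of 0] show ?thesis by simp
qed

lemma near_carrier:
  obtains \<epsilon> where "\<epsilon> > 0" "\<forall>i. h e i > 0 \<longrightarrow> h (e + \<epsilon> *\<^sub>R x) i > 0"
proof -
  let ?T = "{i. h e i \<noteq> 0}"
  have T: "?T \<in> C" by (rule h_carrier)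
  let ?U = "\<Inter>i\<in>?T. {x. h x i > 0}"
  have "open ?U"
    using finite_cone[OF T] by (intro open_INT ballI open_Collect_less continuous_h continuous_on_const)
  moreover have "e \<in> ?U" using h_nonneg[of e] by (auto simp: less_le)
  ultimately obtain d where d: "d > 0" "ball e d \<subseteq> ?U"
    using openE by blast
  obtain \<epsilon> where \<epsilon>: "\<epsilon> > 0" "norm (\<epsilon> *\<^sub>R x) < d" using small_multiple[OF d(1)] by metis
  then have "e + \<epsilon> *\<^sub>R x \<in> ?U" using d(2) by (auto simp: subset_iff dist_norm)
  then show thesis using \<epsilon>(1) that[of \<epsilon>] by auto
qed

text \<open>Invariance along \<open>e\<close> together with scaling moves \<open>x\<close> next to
  \<open>e\<close>, so the linear pieces around \<open>e\<close> determine the interpolation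
  everywhere.\<close>

lemma flat_interp_star:
  assumes fl: "flat e g" and T: "T \<in> C" and u: "\<forall>j\<in>T. u \<bullet> v j = g j"
    and e: "{i. h e i \<noteq> 0} \<subseteq> T" and \<epsilon>: "\<epsilon> > 0" "{i. h (e + \<epsilon> *\<^sub>R x) i \<noteq> 0} \<subseteq> T"
  shows "interp g x = u \<bullet> x"
proof -
  have "interp g (e + \<epsilon> *\<^sub>R x) = u \<bullet> (e + \<epsilon> *\<^sub>R x)"
    by (rule interp_on_cone[OF T]) (use u \<epsilon>(2) in \<open>auto simp: in_cone_iff[OF T]\<close>)
  moreover have "interp g e = u \<bullet> e"
    by (rule interp_on_cone[OF T]) (use u e in \<open>auto simp: in_cone_iff[OF T]\<close>)
  moreover have "interp g e = 0"
    using flat_invariant[OF fl, of 0 1] by (simp add: interp_zero)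
  moreover have "interp g (e + \<epsilon> *\<^sub>R x) = \<epsilon> * interp g x"
    using flat_invariant[OF fl, of "\<epsilon> *\<^sub>R x" 1] \<epsilon>(1) by (simp add: add.commute interp_mult)
  ultimately have "\<epsilon> * interp g x = \<epsilon> * (u \<bullet> x)" by (simp add: inner_add_right)
  then show ?thesis using \<epsilon>(1) by simp
qed

lemma linear_on_vertices:
  assumes "\<And>x. interp g x = u \<bullet> x"
  shows "\<forall>i<n. g i = u \<bullet> v i"
  using assms interp_vertex by metis

text \<open>By invariance only the linear pieces around \<open>e\<close> matter. Inside a triangle
  there is one, so the function is linear; inside an edge there are two, whose gradients differ by a
  multiple of the normal; otherwise \<open>e\<close> spans a ray.\<close>

lemma flat_direction:
  assumes fl: "flat e g" and e: "e \<noteq> 0" and nonlin: "\<not> (\<exists>w. \<forall>i<n. g i = w \<bullet> v i)"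
  shows "(\<exists>p<n. \<exists>\<alpha>>0. e = \<alpha> *\<^sub>R v p) \<or>
    (\<exists>i k. {i, k} \<in> C \<and> i \<noteq> k \<and> (\<forall>x. interp (\<lambda>j. \<bar>(v i \<times> v k) \<bullet> v j\<bar>) x = \<bar>(v i \<times> v k) \<bullet> x\<bar>))"
proof -
  let ?T = "{i. h e i \<noteq> 0}"
  have T: "?T \<in> C" by (rule h_carrier)
  have e_sum: "e = (\<Sum>i\<in>?T. h e i *\<^sub>R v i)"
    by (subst h_sum[of e, symmetric], rule sum.mono_neutral_right) (use in_range[OF T] in auto)
  have carrier: "?T \<subseteq> {i. h (e + \<epsilon> *\<^sub>R x) i \<noteq> 0}" if "\<forall>i. h e i > 0 \<longrightarrow> h (e + \<epsilon> *\<^sub>R x) i > 0" for \<epsilon> x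
    using that h_nonneg[of e] by (force simp: less_le)
  have "card ?T \<noteq> 0"
    using finite_cone[OF T] e h_eq_0_iff[of e] by (auto simp: card_eq_0_iff)
  then consider "card ?T = 1" | "card ?T = 2" | "card ?T = 3" using card_cone[OF T] by linarith
  then show ?thesis
  proof cases
    case 1
    then obtain p where p: "?T = {p}" by (auto simp: card_1_singleton_iff)
    then have "h e p > 0" using h_nonneg[of e p] by auto
    moreover have "e = h e p *\<^sub>R v p" using e_sum unfolding p by simp
    moreover have "p < n" using in_range[OF T] unfolding p by simp
    ultimately show ?thesis by blast
  next
    case 3
    obtain u where u: "\<forall>j\<in>?T. u \<bullet> v j = g j" using dual_functional[OF T] by blast
    have "interp g x = u \<bullet> x" for x
    proof -
      obtain \<epsilon> where \<epsilon>: "\<epsilon> > 0" "\<forall>i. h e i > 0 \<longrightarrow> h (e + \<epsilon> *\<^sub>R x) i > 0" by (rule near_carrier)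
      let ?T' = "{i. h (e + \<epsilon> *\<^sub>R x) i \<noteq> 0}"
      have T': "?T' \<in> C" by (rule h_carrier)
      have "?T = ?T'"
        by (rule card_seteq[OF finite_cone[OF T'] carrier[OF \<epsilon>(2)]]) (use card_cone[OF T'] 3 in auto)
      then show ?thesis
        by (intro flat_interp_star[OF fl T u _ \<epsilon>(1)]) auto
    qed
    then show ?thesis using nonlin linear_on_vertices by blast
  next
    case 2
    then obtain i k where ik: "?T = {i, k}" "i \<noteq> k" by (auto simp: card_2_iff)
    then have ikC: "{i, k} \<in> C" using T by simp
    let ?m = "v i \<times> v k"
    have m0: "?m \<noteq> 0" by (rule edge_cross_nonzero[OF ikC ik(2)])
    obtain a b where ab: "{i, k, a} \<in> C" "{i, k, b} \<in> C" "?m \<bullet> v a > 0" "?m \<bullet> v b < 0"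
      "\<forall>x. {i, k, x} \<in> C \<longrightarrow> x \<noteq> i \<longrightarrow> x \<noteq> k \<longrightarrow> x = a \<or> x = b"
      by (rule edge_triangles[OF ikC ik(2)])
    have "e = h e i *\<^sub>R v i + h e k *\<^sub>R v k" using e_sum unfolding ik(1) using ik(2) by simp
    then have "?m \<bullet> e = ?m \<bullet> (h e i *\<^sub>R v i + h e k *\<^sub>R v k)" by (rule arg_cong)
    then have me: "?m \<bullet> e = 0" by (simp add: inner_add_right dot_cross_self)
    obtain ua where ua: "\<forall>j\<in>{i, k, a}. ua \<bullet> v j = g j" using dual_functional[OF ab(1)] by blast
    obtain ub where ub: "\<forall>j\<in>{i, k, b}. ub \<bullet> v j = g j" using dual_functional[OF ab(2)] by blast
    obtain \<sigma> where \<sigma>: "ua - ub = \<sigma> *\<^sub>R ?m"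
      by (rule orthogonal_imp_multiple_cross[OF m0, of "ua - ub"]) (use ua ub in \<open>auto simp: inner_diff_left\<close>)
    obtain u where ua': "ua = u + (\<sigma> / 2) *\<^sub>R ?m" and ub': "ub = u - (\<sigma> / 2) *\<^sub>R ?m"
      by (rule midpoint_decomposition[OF \<sigma>])
    \<comment> \<open>The mean of the two gradients plus a fold: the sign of m . x tells which of
      the two triangles at the edge carries the moved point \<open>y\<close>.\<close>
    have formula: "interp g x = u \<bullet> x + (\<sigma> / 2) * \<bar>?m \<bullet> x\<bar>" for x
    proof -
      obtain \<epsilon> where \<epsilon>: "\<epsilon> > 0" "\<forall>i. h e i > 0 \<longrightarrow> h (e + \<epsilon> *\<^sub>R x) i > 0" by (rule near_carrier)
      define y where "y = e + \<epsilon> *\<^sub>R x"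
      let ?T' = "{i. h y i \<noteq> 0}"
      have T': "?T' \<in> C" by (rule h_carrier)
      have sub: "{i, k} \<subseteq> ?T'" using carrier[OF \<epsilon>(2)] ik(1) by (simp add: y_def)
      have my: "?m \<bullet> y = \<epsilon> * (?m \<bullet> x)" by (simp add: y_def inner_add_right me)
      have "?T' \<subseteq> {i, k, a} \<or> ?T' \<subseteq> {i, k, b}"
      proof (cases "?T' = {i, k}")
        case False
        then obtain c where c: "c \<in> ?T'" "c \<noteq> i" "c \<noteq> k" using sub by auto
        have c3: "card {i, k, c} = 3" using c ik(2) by auto
        have "{i, k, c} \<subseteq> ?T'" using c(1) sub by blast
        then have "{i, k, c} = ?T'"
          by (intro card_seteq[OF finite_cone[OF T']]) (use c3 card_cone[OF T'] in auto)
        moreover from this have "c = a \<or> c = b" using ab(5) c T' by metis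
        ultimately show ?thesis by auto
      qed auto
      then show ?thesis
      proof
        assume sub: "?T' \<subseteq> {i, k, a}"
        have "interp (\<lambda>j. ?m \<bullet> v j) y \<ge> 0"
        proof (rule ccontr)
          assume "\<not> ?thesis"
          then obtain j where j: "h y j > 0" "?m \<bullet> v j < 0" using interp_neg[of "\<lambda>j. ?m \<bullet> v j" y] by auto
          then have "j \<in> {i, k, a}" using subsetD[OF sub, of j] by simp
          then show False using ab(3) j(2) by (auto simp: dot_cross_self)
        qed
        then have "?m \<bullet> x \<ge> 0" using my \<epsilon>(1) by (simp add: interp_linear zero_le_mult_iff)
        moreover have "interp g x = ua \<bullet> x"
          by (rule flat_interp_star[OF fl ab(1) ua _ \<epsilon>(1)]) (use ik sub in \<open>auto simp: y_def\<close>)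
        ultimately show ?thesis unfolding ua' by (simp add: inner_add_left)
      next
        assume sub: "?T' \<subseteq> {i, k, b}"
        have "interp (\<lambda>j. ?m \<bullet> v j) y \<le> 0"
        proof (rule ccontr)
          assume "\<not> ?thesis"
          then obtain j where j: "h y j > 0" "?m \<bullet> v j > 0" using interp_pos[of "\<lambda>j. ?m \<bullet> v j" y] by auto
          then have "j \<in> {i, k, b}" using subsetD[OF sub, of j] by simp
          then show False using ab(4) j(2) by (auto simp: dot_cross_self)
        qed
        then have "?m \<bullet> x \<le> 0" using my \<epsilon>(1) by (simp add: interp_linear mult_le_0_iff)
        moreover have "interp g x = ub \<bullet> x"
          by (rule flat_interp_star[OF fl ab(2) ub _ \<epsilon>(1)]) (use ik sub in \<open>auto simp: y_def\<close>)
        ultimately show ?thesis unfolding ub' by (simp add: inner_diff_left)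
      qed
    qed
    have \<sigma>0: "\<sigma> \<noteq> 0"
    proof
      assume "\<sigma> = 0"
      then have "interp g x = u \<bullet> x" for x using formula[of x] by simp
      then show False using nonlin linear_on_vertices by blast
    qed
    \<comment> \<open>Interpolating the formula from the rays reproduces the function, so the fold
      is itself piecewise linear once \<open>\<sigma>\<close> is divided out.\<close>
    have "interp (\<lambda>j. \<bar>?m \<bullet> v j\<bar>) x = \<bar>?m \<bullet> x\<bar>" for x
    proof -
      have "g j = u \<bullet> v j + (\<sigma> / 2) * \<bar>?m \<bullet> v j\<bar>" if "j < n" for j
        using formula[of "v j"] interp_vertex[OF that, of g] by simp
      then have "interp g x = interp (\<lambda>j. u \<bullet> v j + (\<sigma> / 2) * \<bar>?m \<bullet> v j\<bar>) x"
        unfolding interp_def by (intro sum.cong) auto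
      then have "u \<bullet> x + (\<sigma> / 2) * \<bar>?m \<bullet> x\<bar> = u \<bullet> x + (\<sigma> / 2) * interp (\<lambda>j. \<bar>?m \<bullet> v j\<bar>) x"
        unfolding interp_add interp_scale interp_linear formula .
      then show ?thesis using \<sigma>0 by simp
    qed
    then show ?thesis using ikC ik(2) by blast
  qed
qed

lemma infinite_bundles_edge_plane:
  assumes ik: "{i, k} \<in> C" "i \<noteq> k"
    and abs: "\<forall>x. interp (\<lambda>j. \<bar>(v i \<times> v k) \<bullet> v j\<bar>) x = \<bar>(v i \<times> v k) \<bullet> x\<bar>"
  shows "infinite (H_trivial_bundles n v C)"
proof (rule infinite_bundles_plane)
  have range: "i < n" "k < n" using edge_range[OF ik(1)] by auto
  show "v i \<times> v k \<noteq> 0" by (rule edge_cross_nonzero[OF ik])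
  show "(v i \<times> v k) \<bullet> v j \<in> \<int>" if "j < n" for j
    by (intro cross_integral integral range that)
  show "i < n" "(v i \<times> v k) \<bullet> v i = 0" using range by (simp_all add: dot_cross_self)
qed (use abs in blast)

lemma triangle_linear_unique:
  assumes "T \<in> C" "card T = 3" "\<And>j. j \<in> T \<Longrightarrow> u \<bullet> v j = u' \<bullet> v j"
  shows "u = u'"
proof -
  obtain i j k where ijk: "T = {i, j, k}" "i < j" "j < k" using triangle_cases[OF assms(2)] .
  have w0: "(u - u') \<bullet> v i = 0" "(u - u') \<bullet> v j = 0" "(u - u') \<bullet> v k = 0"
    using assms(3) ijk(1) by (auto simp: inner_diff_left)
  define D where "D = (v i \<times> v j) \<bullet> v k"
  have D: "D \<noteq> 0" unfolding D_def using assms(1) ijk by (intro triangle_off_plane) auto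
  have "(u - u') \<bullet> (D *\<^sub>R (u - u')) = 0"
    unfolding D_def cramer3[of "v i" "v j" "v k"] by (simp add: inner_add_right w0)
  then show ?thesis using D by simp
qed

text \<open>The condition \<open>flat\<close> in a ray direction is a system of linear equations with integer
  coefficients, so an additive map from the reals to the rationals preserves it.\<close>
lemma flat_integral:
  assumes p: "p < n" and fl: "flat (v p) g" and nonlin: "\<not> (\<exists>w. \<forall>i<n. g i = w \<bullet> v i)"
  obtains \<psi> :: "nat \<Rightarrow> int" where "flat (v p) (\<lambda>i. of_int (\<psi> i))" "\<not> (\<exists>w. \<forall>i<n. of_int (\<psi> i) = w \<bullet> v i)"
proof -
  obtain S0 where S0: "S0 \<in> C" "card S0 = 3" using extend_cone[OF empty_cone] by blast
  obtain u0 where u0: "u0 \<bullet> v p = 0" "\<forall>j\<in>S0. u0 \<bullet> v j = g j" using fl S0(1) unfolding flat_def by blast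
  \<comment> \<open>Subtracting a linear function makes \<open>g'\<close> vanish on a maximal cone.
    A linear function that vanishes there is 0, so nonlinearity is visible at a single ray
    \<open>j0\<close>.\<close>
  define g' where "g' i = g i - u0 \<bullet> v i" for i
  have "\<not> (\<forall>i<n. g' i = 0)"
    using nonlin unfolding g'_def by auto
  then obtain j0 where j0: "j0 < n" "g' j0 \<noteq> 0" by blast
  obtain f :: "real \<Rightarrow> rat" where f: "\<And>a b. f (a + b) = f a + f b" "\<And>z a. f (of_int z * a) = of_int z * f a"
    "f (g' j0) \<noteq> 0"
    by (rule exists_rational_functional_real[OF j0(2)]) blast
  obtain d :: nat where d: "d > 0" "\<And>i. i \<in> {..<n} \<Longrightarrow> of_nat d * f (g' i) \<in> \<int>"
    by (rule common_denominator[of "{..<n}" "\<lambda>i. f (g' i)"]) auto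
  define \<psi> where "\<psi> i = \<lfloor>of_nat d * f (g' i)\<rfloor>" for i
  have \<psi>: "of_int (\<psi> i) = real d * of_rat (f (g' i))" if "i < n" for i
  proof -
    have "of_int (\<psi> i) = of_nat d * f (g' i)"
      using d(2)[of i] that unfolding \<psi>_def by (metis Ints_cases floor_of_int lessThan_iff)
    then have "real_of_rat (of_int (\<psi> i)) = of_rat (of_nat d * f (g' i))" by simp
    then show ?thesis by (simp add: of_rat_mult)
  qed
  have f0: "f 0 = 0" using f(1)[of 0 0] by simp
  have "flat (v p) (\<lambda>i. of_int (\<psi> i))"
    unfolding flat_def
  proof
    fix S assume "S \<in> C"
    then obtain T where T: "T \<in> C" "S \<subseteq> T" "card T = 3" using extend_cone by blast
    obtain i j k where ijk: "T = {i, j, k}" "i < j" "j < k" using triangle_cases[OF T(3)] .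
    have range: "i < n" "j < n" "k < n" using in_range[OF T(1)] ijk(1) by auto
    obtain u1 where u1: "u1 \<bullet> v p = 0" "\<forall>j\<in>T. u1 \<bullet> v j = g j" using fl T(1) unfolding flat_def by blast
    define u where "u = u1 - u0"
    have u: "u \<bullet> v p = 0" "u \<bullet> v i = g' i" "u \<bullet> v j = g' j" "u \<bullet> v k = g' k"
      using u1 u0(1) ijk(1) by (simp_all add: u_def g'_def inner_diff_left)
    obtain u' where "\<forall>j\<in>T. u' \<bullet> v j = of_int (\<psi> j)" using dual_functional[OF T(1), of "\<lambda>j. of_int (\<psi> j)"] by blast
    then have u': "u' \<bullet> v i = real d * of_rat (f (g' i))" "u' \<bullet> v j = real d * of_rat (f (g' j))"
      "u' \<bullet> v k = real d * of_rat (f (g' k))" and u'T: "\<forall>j\<in>T. u' \<bullet> v j = of_int (\<psi> j)"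
      using ijk(1) \<psi> range by auto
    have "(v j \<times> v k) \<bullet> v p \<in> \<int>" "(v k \<times> v i) \<bullet> v p \<in> \<int>" "(v i \<times> v j) \<bullet> v p \<in> \<int>"
      by (intro cross_integral integral range p)+
    then obtain a b c :: int where abc: "(v j \<times> v k) \<bullet> v p = of_int a" "(v k \<times> v i) \<bullet> v p = of_int b"
      "(v i \<times> v j) \<bullet> v p = of_int c" by (auto elim!: Ints_cases)
    define D where "D = (v i \<times> v j) \<bullet> v k"
    have D: "D \<noteq> 0" unfolding D_def using T(1) ijk by (intro triangle_off_plane) auto
    \<comment> \<open>The integers on the right express orthogonality to \<open>v p\<close> as an
      integer relation between the values of \<open>g'\<close> on the triangle, and the additive map
      \<open>f\<close> preserves it.\<close>
    have eq: "D *\<^sub>R v p = of_int a *\<^sub>R v i + of_int b *\<^sub>R v j + of_int c *\<^sub>R v k"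
      unfolding D_def cramer3[of "v i" "v j" "v k" "v p"] abc ..
    have "u \<bullet> (D *\<^sub>R v p) = of_int a * g' i + of_int b * g' j + of_int c * g' k"
      unfolding eq by (simp add: inner_add_right u)
    then have "of_int a * g' i + of_int b * g' j + of_int c * g' k = 0" using u(1) by simp
    then have "f (of_int a * g' i + of_int b * g' j + of_int c * g' k) = 0" using f0 by simp
    then have "of_int a * f (g' i) + of_int b * f (g' j) + of_int c * f (g' k) = 0"
      by (simp only: f(1,2))
    then have "real_of_rat (of_int a * f (g' i) + of_int b * f (g' j) + of_int c * f (g' k)) = 0" by simp
    then have z: "of_int a * of_rat (f (g' i)) + of_int b * of_rat (f (g' j)) + of_int c * of_rat (f (g' k)) = (0 :: real)"
      by (simp add: of_rat_add of_rat_mult)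
    have "u' \<bullet> (D *\<^sub>R v p) = real d * (of_int a * of_rat (f (g' i)) + of_int b * of_rat (f (g' j)) + of_int c * of_rat (f (g' k)))"
      unfolding eq by (simp add: inner_add_right u' algebra_simps)
    then have "D * (u' \<bullet> v p) = 0" unfolding z by simp
    then have "u' \<bullet> v p = 0" using D by simp
    then show "\<exists>u. u \<bullet> v p = 0 \<and> (\<forall>j\<in>S. u \<bullet> v j = of_int (\<psi> j))"
      using u'T T(2) by (intro exI[of _ u']) auto
  qed
  moreover have "\<not> (\<exists>w. \<forall>i<n. of_int (\<psi> i) = w \<bullet> v i)"
  proof
    assume "\<exists>w. \<forall>i<n. of_int (\<psi> i) = w \<bullet> v i"
    then obtain w where w: "\<forall>i<n. of_int (\<psi> i) = w \<bullet> v i" by blast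
    have "w = 0"
    proof (rule triangle_linear_unique[OF S0])
      fix l assume l: "l \<in> S0"
      then have "l < n" using in_range[OF S0(1)] by auto
      moreover have "g' l = 0" using u0(2) l by (simp add: g'_def)
      ultimately show "w \<bullet> v l = 0 \<bullet> v l" using \<psi>[of l] w f0 by simp
    qed
    then have "real d * of_rat (f (g' j0)) = 0" using \<psi>[OF j0(1)] w j0(1) by simp
    then show False using d(1) f(3) by simp
  qed
  ultimately show thesis by (rule that)
qed

text \<open>\<open>flat\<close> does not distinguish \<open>e\<close> from \<open>- e\<close>, so
  \<open>flat_direction\<close> applies to both: if neither produces a plane, both span rays, and
  these form an antipodal pair.\<close>

lemma flat_imp_infinite:
  assumes fl: "flat e g" and e: "e \<noteq> 0" and nonlin: "\<not> (\<exists>w. \<forall>i<n. g i = w \<bullet> v i)"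
  shows "infinite (H_trivial_bundles n v C)"
proof -
  have fl': "flat (- e) g" using fl by (simp add: flat_uminus)
  consider i k where "{i, k} \<in> C" "i \<noteq> k" "\<forall>x. interp (\<lambda>j. \<bar>(v i \<times> v k) \<bullet> v j\<bar>) x = \<bar>(v i \<times> v k) \<bullet> x\<bar>"
    | p q \<alpha> \<beta> where "p < n" "q < n" "\<alpha> > 0" "\<beta> > 0" "e = \<alpha> *\<^sub>R v p" "- e = \<beta> *\<^sub>R v q"
    using flat_direction[OF fl e nonlin] flat_direction[OF fl' _ nonlin] e by auto
  then show ?thesis
  proof cases
    case 1
    then show ?thesis by (rule infinite_bundles_edge_plane)
  next
    case 2
    have "flat (v p) g" using fl flat_scale[of \<alpha> "v p" g] 2 by simp
    then obtain \<psi> :: "nat \<Rightarrow> int" where \<psi>: "flat (v p) (\<lambda>i. of_int (\<psi> i))"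
      "\<not> (\<exists>w. \<forall>i<n. of_int (\<psi> i) = w \<bullet> v i)"
      using flat_integral[OF 2(1) _ nonlin] by blast
    have "v q = inverse \<beta> *\<^sub>R (\<beta> *\<^sub>R v q)" using 2 by simp
    also have "\<dots> = - (\<alpha> / \<beta>) *\<^sub>R v p" unfolding 2(6)[symmetric] 2(5) by (simp add: field_simps)
    finally show ?thesis
      using infinite_bundles_antipodal[OF 2(1,2) _ _ \<psi>(2) flat_invariant[OF \<psi>(1)], of "\<alpha> / \<beta>"] 2(3,4) by simp
  qed
qed

section \<open>From a low-dimensional gradient polytope to bundles\<close>

lemma piecewise_linear_interp:
  assumes "piecewise_linear v C \<Psi>"
  shows "\<Psi> x = interp (\<lambda>i. \<Psi> (v i)) x"
proof -
  obtain S where S: "S \<in> C" "x \<in> cone_of v S" using cones_cover by blast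
  obtain u where u: "\<forall>x\<in>cone_of v S. \<Psi> x = u \<bullet> x" using assms S(1) unfolding piecewise_linear_def by blast
  have "interp (\<lambda>i. \<Psi> (v i)) x = u \<bullet> x"
  proof (rule interp_on_cone[OF S(1) _ S(2)])
    fix j assume "j \<in> S"
    then have "v j \<in> cone_of v S" using vertex_in_cone_iff[OF S(1)] in_range[OF S(1)] by auto
    then show "u \<bullet> v j = \<Psi> (v j)" using u by simp
  qed
  then show ?thesis using u S(2) by simp
qed

lemma lowdim_Lambda_imp_infinite:
  assumes pl: "piecewise_linear v C \<Psi>" and nonlin: "\<not> (\<exists>u. \<forall>x. \<Psi> x = u \<bullet> x)"
    and dim: "aff_dim (Lambda_psi v C \<Psi>) < 3"
  shows "infinite (H_trivial_bundles n v C)"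
proof -
  let ?L = "Lambda_psi v C \<Psi>"
  let ?G = "{u. \<exists>S. maximal_cone C S \<and> (\<forall>x\<in>cone_of v S. \<Psi> x = u \<bullet> x)}"
  have GL: "?G \<subseteq> ?L" unfolding Lambda_psi_def by (rule hull_subset)
  obtain T where T: "T \<in> C" "card T = 3" using extend_cone[OF empty_cone] by blast
  obtain a where a: "\<forall>x\<in>cone_of v T. \<Psi> x = a \<bullet> x" using pl T(1) unfolding piecewise_linear_def by blast
  have aL: "a \<in> ?L" using GL a T maximal_cone_iff by blast
  have "aff_dim ?L < DIM(real^3)" using dim by simp
  then obtain e b where e: "e \<noteq> 0" "?L \<subseteq> {x. e \<bullet> x = b}"
    using aff_lowdim_subset_hyperplane by blast
  have eL: "e \<bullet> u = e \<bullet> a" if "u \<in> ?L" for u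
    using subsetD[OF e(2) that] subsetD[OF e(2) aL] by simp
  \<comment> \<open>The multiple of \<open>e\<close> whose product with \<open>e\<close> equals that
    of all gradients, so that subtracting it makes them orthogonal to \<open>e\<close>.\<close>
  define \<mu> where "\<mu> = ((e \<bullet> a) / (e \<bullet> e)) *\<^sub>R e"
  have \<mu>: "\<mu> \<bullet> e = e \<bullet> a" using e(1) by (simp add: \<mu>_def)
  define g where "g i = \<Psi> (v i) - \<mu> \<bullet> v i" for i
  show ?thesis
  proof (rule flat_imp_infinite[OF _ e(1)])
    show "flat e g"
      unfolding flat_def
    proof
      fix S assume "S \<in> C"
      then obtain T where T: "T \<in> C" "S \<subseteq> T" "card T = 3" using extend_cone by blast
      obtain u where u: "\<forall>x\<in>cone_of v T. \<Psi> x = u \<bullet> x" using pl T(1) unfolding piecewise_linear_def by blast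
      have "u \<in> ?L" using GL u T maximal_cone_iff by blast
      then have "(u - \<mu>) \<bullet> e = 0" using eL[of u] \<mu> by (simp add: inner_diff_left inner_commute[of u e])
      moreover have "(u - \<mu>) \<bullet> v j = g j" if "j \<in> S" for j
      proof -
        have "v j \<in> cone_of v T" using vertex_in_cone_iff[OF T(1)] in_range[OF T(1)] T(2) that by auto
        then show ?thesis using u by (simp add: g_def inner_diff_left)
      qed
      ultimately show "\<exists>u. u \<bullet> e = 0 \<and> (\<forall>j\<in>S. u \<bullet> v j = g j)" by blast
    qed
    show "\<not> (\<exists>w. \<forall>i<n. g i = w \<bullet> v i)"
    proof
      assume "\<exists>w. \<forall>i<n. g i = w \<bullet> v i"
      then obtain w where w: "\<forall>i<n. g i = w \<bullet> v i" by blast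
      have "\<Psi> x = (w + \<mu>) \<bullet> x" for x
      proof -
        have "interp (\<lambda>i. \<Psi> (v i)) x = interp (\<lambda>i. (w + \<mu>) \<bullet> v i) x"
          unfolding interp_def using w by (intro sum.cong) (auto simp: g_def inner_add_left algebra_simps)
        then show ?thesis using piecewise_linear_interp[OF pl, of x] by (simp add: interp_linear)
      qed
      then show False using nonlin by blast
    qed
  qed
qed

end

section \<open>Piecewise linear functions from bundles\<close>

lemma convergent_subsequence_coordinates:
  fixes x :: "nat \<Rightarrow> nat \<Rightarrow> real"
  assumes "\<And>k i. i < N \<Longrightarrow> \<bar>x k i\<bar> \<le> 1"
  shows "\<exists>s \<psi>. strict_mono s \<and> (\<forall>i<N. (\<lambda>k. x (s k) i) \<longlonglongrightarrow> \<psi> i)"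
  using assms
proof (induction N)
  case 0
  then show ?case by (intro exI[of _ id]) (auto simp: strict_mono_def)
next
  case (Suc N)
  then obtain s \<psi> where s: "strict_mono s" "\<forall>i<N. (\<lambda>k. x (s k) i) \<longlonglongrightarrow> \<psi> i" by force
  have "bounded (range (\<lambda>k. x (s k) N))"
    using Suc.prems[of N] by (auto simp: bounded_real)
  then obtain l r where r: "strict_mono r" "((\<lambda>k. x (s k) N) \<circ> r) \<longlonglongrightarrow> l"
    using bounded_imp_convergent_subsequence by blast
  have "(\<lambda>k. x ((s \<circ> r) k) i) \<longlonglongrightarrow> (\<psi>(N := l)) i" if "i < Suc N" for i
  proof (cases "i = N")
    case True
    then show ?thesis using r(2) by (simp add: o_def)
  next
    case False
    then have "(\<lambda>k. x (s k) i) \<longlonglongrightarrow> \<psi> i" using s(2) that by simp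
    from LIMSEQ_subseq_LIMSEQ[OF this r(1)] show ?thesis using False by (simp add: o_def)
  qed
  then show ?case using strict_mono_o[OF s(1) r(1)] by blast
qed

text \<open>Rounding down moves each of the three coordinates by at most 1, and the norm is bounded
  by the sum of these.\<close>

lemma round_to_lattice:
  fixes w :: "real^3"
  obtains w' :: "real^3" where "\<forall>k. w' $ k \<in> \<int>" "norm (w' - w) \<le> 3"
proof
  let ?w = "(\<chi> k. of_int \<lfloor>w $ k\<rfloor>) :: real^3"
  show "\<forall>k. ?w $ k \<in> \<int>" by simp
  have "norm (?w - w) \<le> (\<Sum>k\<in>UNIV. \<bar>(?w - w) $ k\<bar>)" by (rule norm_le_l1_cart)
  also have "\<dots> \<le> (\<Sum>k\<in>(UNIV :: 3 set). 1)"
  proof (rule sum_mono)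
    fix k :: 3
    show "\<bar>(?w - w) $ k\<bar> \<le> 1" by (simp, linarith)
  qed
  finally show "norm (?w - w) \<le> 3" by simp
qed

text \<open>Fixes what small means in the genericity arguments: adding \<open>\<delta>\<close> times
  \<open>c\<close>, with either sign, changes the sign of no nonzero entry of
  \<open>f\<close>.\<close>

lemma small_perturbation:
  fixes f c :: "nat \<Rightarrow> real"
  obtains \<delta> where "\<delta> > 0" "\<And>j. j < N \<Longrightarrow> f j \<noteq> 0 \<Longrightarrow> \<delta> * \<bar>c j\<bar> < \<bar>f j\<bar>"
proof -
  have "\<exists>\<delta>>0. \<forall>j<N. f j \<noteq> 0 \<longrightarrow> \<delta> * \<bar>c j\<bar> < \<bar>f j\<bar>"
  proof (induction N)
    case (Suc N)
    then obtain \<delta> where \<delta>: "\<delta> > 0" "\<forall>j<N. f j \<noteq> 0 \<longrightarrow> \<delta> * \<bar>c j\<bar> < \<bar>f j\<bar>" by blast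
    define \<delta>' where "\<delta>' = (if f N = 0 then \<delta> else min \<delta> (\<bar>f N\<bar> / (\<bar>c N\<bar> + 1)))"
    have pos: "\<delta>' > 0" "\<delta>' \<le> \<delta>" using \<delta>(1) by (auto simp: \<delta>'_def add_nonneg_pos)
    moreover have "\<delta>' * \<bar>c j\<bar> < \<bar>f j\<bar>" if j: "j < Suc N" "f j \<noteq> 0" for j
    proof (cases "j = N")
      case True
      have "\<delta>' * \<bar>c N\<bar> < \<delta>' * (\<bar>c N\<bar> + 1)" using pos by simp
      also have "\<dots> \<le> (\<bar>f N\<bar> / (\<bar>c N\<bar> + 1)) * (\<bar>c N\<bar> + 1)"
        using True j by (intro mult_right_mono) (auto simp: \<delta>'_def)
      also have "\<dots> = \<bar>f N\<bar>" by (simp add: add_nonneg_pos)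
      finally show ?thesis using True by simp
    next
      case False
      have "\<delta>' * \<bar>c j\<bar> \<le> \<delta> * \<bar>c j\<bar>" using pos(2) by (intro mult_right_mono) auto
      then show ?thesis using \<delta>(2) j False by (metis le_less_trans less_antisym)
    qed
    ultimately show ?case by blast
  qed (intro exI[of _ 1], simp)
  then show thesis using that by blast
qed

context fan
begin

section \<open>Rescaled limits of H-trivial classes\<close>

lemma good_compl: "good I \<Longrightarrow> I \<subseteq> {..<n} \<Longrightarrow> good ({..<n} - I)"
  unfolding good_def by (simp add: double_diff)

lemma good_acyclic: "good I \<Longrightarrow> I \<subseteq> {..<n} \<Longrightarrow> acyclic (K I) {..<n}"
  using acyclic_iff unfolding good_def by blast

lemma pic_class_eq: "r' \<in> pic_class n v r \<Longrightarrow> pic_class n v r' = pic_class n v r"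
proof -
  have *: "pic_class n v a \<subseteq> pic_class n v b"
    if w: "\<forall>k. w $ k \<in> \<int>" "\<forall>i<n. of_int (a i) - of_int (b i) = w \<bullet> v i" for a b and w :: "real^3"
  proof
    fix r'' assume "r'' \<in> pic_class n v a"
    then obtain w' :: "real^3" where w': "\<forall>i\<ge>n. r'' i = 0" "\<forall>k. w' $ k \<in> \<int>" "\<forall>i<n. of_int (r'' i) - of_int (a i) = w' \<bullet> v i"
      unfolding pic_class_def by auto
    have "of_int (r'' i) - of_int (b i) = (w + w') \<bullet> v i" if "i < n" for i
    proof -
      have "(of_int (r'' i) - of_int (b i) :: real) = (of_int (a i) - of_int (b i)) + (of_int (r'' i) - of_int (a i))" by simp
      then show ?thesis using w(2) w'(3) that by (simp add: inner_add_left)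
    qed
    then show "r'' \<in> pic_class n v b"
      unfolding pic_class_def using w(1) w' by (intro CollectI conjI exI[of _ "w + w'"]) auto
  qed
  assume "r' \<in> pic_class n v r"
  then obtain w :: "real^3" where w: "\<forall>k. w $ k \<in> \<int>" "\<forall>i<n. of_int (r' i) - of_int (r i) = w \<bullet> v i"
    unfolding pic_class_def by auto
  have "\<forall>k. (- w) $ k \<in> \<int>" "\<forall>i<n. of_int (r i) - of_int (r' i) = (- w) \<bullet> v i"
    using w by (auto simp: algebra_simps)
  then show ?thesis using *[OF w] *[of "- w" r r'] by blast
qed

lemma inner_integral:
  assumes "\<And>k. w $ k \<in> \<int>" "i < n"
  shows "w \<bullet> v i \<in> \<int>"
  using assms integral by (simp add: inner_vec_def sum_3)

text \<open>Values on a cone can be cancelled by a real functional; rounding it to the lattice costs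
  at most 3 in norm, which explains \<open>D\<close>. So every class has a representative bounded on
  \<open>S0\<close>, uniformly in the class.\<close>

lemma infinite_representatives:
  assumes inf: "infinite (H_trivial_bundles n v C)" and S0: "S0 \<in> C"
  defines "D \<equiv> 3 * (\<Sum>i<n. norm (v i))"
  shows "infinite {r. (\<forall>i\<ge>n. r i = (0 :: int)) \<and> (\<forall>j\<in>S0. of_int \<bar>r j\<bar> \<le> D) \<and>
    (\<forall>w. (\<forall>k. w $ k \<in> \<int>) \<longrightarrow> good {i. i < n \<and> of_int (r i) + w \<bullet> v i \<ge> 0})}" (is "infinite ?X")
proof
  assume fin: "finite ?X"
  have "H_trivial_bundles n v C \<subseteq> pic_class n v ` ?X"
  proof
    fix B assume "B \<in> H_trivial_bundles n v C"
    then obtain r where r: "B = pic_class n v r" "H_trivial n v C r"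
      unfolding H_trivial_bundles_def by auto
    obtain w0 where w0: "\<forall>j\<in>S0. w0 \<bullet> v j = - of_int (r j)" using dual_functional[OF S0, of "\<lambda>j. - of_int (r j)"] by blast
    obtain w :: "real^3" where w: "\<forall>k. w $ k \<in> \<int>" "norm (w - w0) \<le> 3" by (rule round_to_lattice[of w0])
    define r' where "r' i = (if i < n then r i + \<lfloor>w \<bullet> v i\<rfloor> else 0)" for i
    have fl: "of_int \<lfloor>w \<bullet> v i\<rfloor> = w \<bullet> v i" if "i < n" for i
      using inner_integral[OF w(1)[rule_format] that] by (auto elim: Ints_cases)
    have r': "of_int (r' i) - of_int (r i) = w \<bullet> v i" if "i < n" for i
      using fl[OF that] that by (simp add: r'_def)
    have cls: "r' \<in> pic_class n v r"
      unfolding pic_class_def using r' w(1) by (intro CollectI conjI exI[of _ w]) (auto simp: r'_def)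
    have "of_int \<bar>r' j\<bar> \<le> D" if j: "j \<in> S0" for j
    proof -
      have jn: "j < n" using in_range[OF S0] j by auto
      have "of_int (r' j) = (w - w0) \<bullet> v j"
        using r'[OF jn] w0 j by (simp add: inner_diff_left algebra_simps)
      then have "of_int \<bar>r' j\<bar> = \<bar>(w - w0) \<bullet> v j\<bar>" by simp
      also have "\<dots> \<le> norm (w - w0) * norm (v j)" by (rule Cauchy_Schwarz_ineq2)
      also have "\<dots> \<le> 3 * norm (v j)" using w(2) by (intro mult_right_mono) auto
      also have "norm (v j) \<le> (\<Sum>i<n. norm (v i))" using jn by (intro member_le_sum) auto
      finally show ?thesis by (simp add: D_def)
    qed
    moreover have "good {i. i < n \<and> of_int (r' i) + w1 \<bullet> v i \<ge> 0}" if w1: "\<forall>k. w1 $ k \<in> \<int>" for w1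
    proof -
      define r'' where "r'' i = (if i < n then r' i + \<lfloor>w1 \<bullet> v i\<rfloor> else 0)" for i
      have eq: "of_int (r'' i) = of_int (r' i) + w1 \<bullet> v i" if "i < n" for i
        using inner_integral[of w1, OF _ that] w1 that by (auto simp: r''_def elim: Ints_cases)
      have "r'' \<in> pic_class n v r'"
        unfolding pic_class_def using eq w1 by (intro CollectI conjI exI[of _ w1]) (auto simp: r''_def)
      then have "good {i. i < n \<and> r'' i \<ge> 0}"
        using r(2) pic_class_eq[OF cls] unfolding H_trivial_iff by simp
      moreover have "{i. i < n \<and> r'' i \<ge> 0} = {i. i < n \<and> of_int (r' i) + w1 \<bullet> v i \<ge> 0}"
        using eq by (metis (no_types, lifting) of_int_0_le_iff)
      ultimately show ?thesis by simp
    qed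
    moreover have "\<forall>i\<ge>n. r' i = 0" by (simp add: r'_def)
    ultimately have "r' \<in> ?X" by simp
    moreover have "B = pic_class n v r'" using pic_class_eq[OF cls] r(1) by simp
    ultimately show "B \<in> pic_class n v ` ?X" by (intro image_eqI[of B "pic_class n v" r'])
  qed
  then have "finite (H_trivial_bundles n v C)" by (rule finite_subset[OF _ finite_imageI[OF fin]])
  then show False using inf by simp
qed

text \<open>\<open>good\<close> asks for both sides to be nonempty, so no generic translate by a
  linear function has constant sign on the rays; hence the name. Only generic \<open>w\<close> are
  tested, since signs at zeros do not pass to limits.\<close>

definition saddle :: "(nat \<Rightarrow> real) \<Rightarrow> bool" where
  "saddle \<psi> \<longleftrightarrow> (\<forall>w. (\<forall>i<n. \<psi> i + w \<bullet> v i \<noteq> 0) \<longrightarrow> good {i. i < n \<and> \<psi> i + w \<bullet> v i > 0})"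

text \<open>There are only finitely many integer vectors of bounded size, so the representatives are
  unbounded. Dividing by the largest entry gives a limit that is 0 on \<open>S0\<close>, where
  entries stay bounded, yet has a nonzero entry.\<close>

lemma infinite_imp_saddle:
  assumes inf: "infinite (H_trivial_bundles n v C)" and S0: "S0 \<in> C"
  obtains \<psi> where "saddle \<psi>" "\<forall>j\<in>S0. \<psi> j = 0" "\<exists>i<n. \<psi> i \<noteq> 0"
proof -
  define D where "D = 3 * (\<Sum>i<n. norm (v i))"
  define X where "X = {r. (\<forall>i\<ge>n. r i = (0 :: int)) \<and> (\<forall>j\<in>S0. of_int \<bar>r j\<bar> \<le> D) \<and>
    (\<forall>w. (\<forall>k. w $ k \<in> \<int>) \<longrightarrow> good {i. i < n \<and> of_int (r i) + w \<bullet> v i \<ge> 0})}"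
  have infX: "infinite X" unfolding X_def D_def by (rule infinite_representatives[OF inf S0])
  have ex: "\<exists>r\<in>X. \<exists>i<n. \<bar>r i\<bar> > int k" for k
  proof (rule ccontr)
    assume "\<not> ?thesis"
    then have le: "\<bar>r i\<bar> \<le> int k" if "r \<in> X" "i < n" for r i
      using that by (meson not_less)
    have "r i \<in> {- int k..int k}" if "r \<in> X" "i < n" for r i
      using le[OF that] by (simp add: abs_le_iff)
    moreover have "r i = 0" if "r \<in> X" "\<not> i < n" for r i
      using that unfolding X_def by simp
    ultimately have "X \<subseteq> {r. \<forall>i. (i \<in> {..<n} \<longrightarrow> r i \<in> {- int k..int k}) \<and> (i \<notin> {..<n} \<longrightarrow> r i = 0)}"
      by auto
    moreover have "finite {r. \<forall>i. (i \<in> {..<n} \<longrightarrow> r i \<in> {- int k..int k}) \<and> (i \<notin> {..<n} \<longrightarrow> r i = (0::int))}"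
      by (rule finite_set_of_finite_funs) auto
    ultimately show False using infX finite_subset by blast
  qed
  have "\<forall>k. \<exists>r. r \<in> X \<and> (\<exists>i<n. \<bar>r i\<bar> > int k)"
    using ex by (simp add: Bex_def)
  from choice[OF this] obtain R where "\<forall>k. R k \<in> X \<and> (\<exists>i<n. \<bar>R k i\<bar> > int k)" ..
  then have R: "\<And>k. R k \<in> X" "\<And>k. \<exists>i<n. \<bar>R k i\<bar> > int k" by simp_all
  define M where "M k = Max ((\<lambda>i. \<bar>R k i\<bar>) ` {..<n})" for k
  have ne: "(\<lambda>i. \<bar>R k i\<bar>) ` {..<n} \<noteq> {}" for k using n_pos by auto
  have MR: "\<bar>R k i\<bar> \<le> M k" if "i < n" for k i unfolding M_def using that by (intro Max_ge) auto
  have Mk: "M k > int k" for k using R(2)[of k] MR[of _ k] by (meson le_less_trans less_le_trans)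
  have Matt: "\<exists>i<n. \<bar>R k i\<bar> = M k" for k
    using Max_in[OF _ ne, of k] unfolding M_def by fastforce
  define x where "x k i = real_of_int (R k i) / of_int (M k)" for k i
  have Mpos: "M k > 0" for k using Mk[of k] by linarith
  have x1: "\<bar>x k i\<bar> \<le> 1" if "i < n" for k i
  proof -
    have "of_int \<bar>R k i\<bar> \<le> (of_int (M k) :: real)" using MR[OF that] by (simp only: of_int_le_iff)
    then show ?thesis using Mpos[of k] by (simp add: x_def)
  qed
  obtain s \<psi> where s: "strict_mono s" "\<forall>i<n. (\<lambda>k. x (s k) i) \<longlonglongrightarrow> \<psi> i"
    using convergent_subsequence_coordinates[of n x] x1 by blast
  have invM: "(\<lambda>k. c / of_int (M (s k))) \<longlonglongrightarrow> 0" for c :: real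
  proof (rule real_tendsto_divide_at_top[OF tendsto_const])
    show "filterlim (\<lambda>k. real_of_int (M (s k))) at_top sequentially"
    proof (rule filterlim_at_top_mono[OF filterlim_real_sequentially], rule always_eventually, rule allI)
      fix k
      have "int k \<le> int (s k)" using seq_suble[OF s(1), of k] by simp
      then have "int k \<le> M (s k)" using Mk[of "s k"] by linarith
      then have "real_of_int (int k) \<le> real_of_int (M (s k))" by (simp only: of_int_le_iff)
      then show "real k \<le> real_of_int (M (s k))" by simp
    qed
  qed
  have "\<psi> j = 0" if j: "j \<in> S0" for j
  proof -
    have jn: "j < n" using in_range[OF S0] j by auto
    have "(\<lambda>k. x (s k) j) \<longlonglongrightarrow> 0"
    proof (rule Lim_null_comparison[OF always_eventually invM[of D]], rule allI)
      fix k
      have "of_int \<bar>R (s k) j\<bar> \<le> D" using R(1)[of "s k"] j unfolding X_def by blast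
      then show "norm (x (s k) j) \<le> D / of_int (M (s k))"
        using Mpos[of "s k"] by (simp add: x_def divide_right_mono)
    qed
    then show ?thesis using s(2) jn LIMSEQ_unique by blast
  qed
  moreover have "\<exists>i<n. \<psi> i \<noteq> 0"
  proof (rule ccontr)
    assume "\<not> ?thesis"
    then have "\<forall>i\<in>{..<n}. eventually (\<lambda>k. \<bar>x (s k) i\<bar> < 1) sequentially"
      using s(2) by (auto dest!: tendstoD[where e = 1] simp: dist_real_def)
    then have "eventually (\<lambda>k. \<forall>i\<in>{..<n}. \<bar>x (s k) i\<bar> < 1) sequentially"
      by (intro eventually_ball_finite) auto
    then obtain k where k: "\<forall>i\<in>{..<n}. \<bar>x (s k) i\<bar> < 1" using eventually_happens' sequentially_bot by blast
    obtain i where i: "i < n" "\<bar>R (s k) i\<bar> = M (s k)" using Matt by blast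
    have "\<bar>x (s k) i\<bar> = of_int \<bar>R (s k) i\<bar> / of_int (M (s k))" using Mpos[of "s k"] by (simp add: x_def)
    then have "\<bar>x (s k) i\<bar> = 1" unfolding i(2) using Mpos[of "s k"] by simp
    then show False using k[rule_format, of i] i(1) by simp
  qed
  moreover have "saddle \<psi>"
    unfolding saddle_def
  proof (intro allI impI)
    fix w assume nz: "\<forall>i<n. \<psi> i + w \<bullet> v i \<noteq> 0"
    \<comment> \<open>A real \<open>w\<close> is reached by rounding its dilations to the lattice:
      the error stays at most 3 in norm while the divisor tends to infinity.\<close>
    have "\<forall>k. \<exists>w' :: real^3. (\<forall>l. w' $ l \<in> \<int>) \<and> norm (w' - of_int (M (s k)) *\<^sub>R w) \<le> 3"
      by (intro allI) (rule round_to_lattice, blast)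
    from choice[OF this] obtain W :: "nat \<Rightarrow> real^3" where
      "\<forall>k. (\<forall>l. W k $ l \<in> \<int>) \<and> norm (W k - of_int (M (s k)) *\<^sub>R w) \<le> 3" ..
    then have W: "\<And>k l. W k $ l \<in> \<int>" "\<And>k. norm (W k - of_int (M (s k)) *\<^sub>R w) \<le> 3" by simp_all
    define y where "y k i = (of_int (R (s k) i) + W k \<bullet> v i) / of_int (M (s k))" for k i
    have lim: "(\<lambda>k. y k i) \<longlonglongrightarrow> \<psi> i + w \<bullet> v i" if "i < n" for i
    proof -
      define z where "z k = ((W k - of_int (M (s k)) *\<^sub>R w) \<bullet> v i) / of_int (M (s k))" for k
      have "z \<longlonglongrightarrow> 0"
      proof (rule Lim_null_comparison[OF always_eventually invM[of "3 * norm (v i)"]], rule allI)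
        fix k
        have "\<bar>(W k - of_int (M (s k)) *\<^sub>R w) \<bullet> v i\<bar> \<le> norm (W k - of_int (M (s k)) *\<^sub>R w) * norm (v i)"
          by (rule Cauchy_Schwarz_ineq2)
        also have "\<dots> \<le> 3 * norm (v i)" using W(2) by (intro mult_right_mono) auto
        finally show "norm (z k) \<le> 3 * norm (v i) / of_int (M (s k))"
          using Mpos[of "s k"] by (simp add: z_def divide_right_mono)
      qed
      then have "(\<lambda>k. x (s k) i + w \<bullet> v i + z k) \<longlonglongrightarrow> \<psi> i + w \<bullet> v i + 0"
        using s(2) that by (intro tendsto_add tendsto_const) auto
      moreover have "y k i = x (s k) i + w \<bullet> v i + z k" for k
        using Mpos[of "s k"] by (simp add: y_def x_def z_def inner_diff_left field_simps)
      ultimately show ?thesis by simp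
    qed
    have "eventually (\<lambda>k. 0 < y k i \<longleftrightarrow> 0 < \<psi> i + w \<bullet> v i) sequentially \<and> eventually (\<lambda>k. y k i \<noteq> 0) sequentially" if i: "i < n" for i
    proof (cases "\<psi> i + w \<bullet> v i > 0")
      case True
      from order_tendstoD(1)[OF lim[OF i] this] show ?thesis
        using True by (auto elim: eventually_mono)
    next
      case False
      then have "\<psi> i + w \<bullet> v i < 0" using nz i by (metis linorder_neqE)
      from order_tendstoD(2)[OF lim[OF i] this] show ?thesis
        using False by (auto elim: eventually_mono)
    qed
    then have "eventually (\<lambda>k. \<forall>i\<in>{..<n}. (0 < y k i \<longleftrightarrow> 0 < \<psi> i + w \<bullet> v i) \<and> y k i \<noteq> 0) sequentially"
      by (intro eventually_ball_finite ballI eventually_conj) auto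
    then obtain k where k: "\<forall>i\<in>{..<n}. (0 < y k i \<longleftrightarrow> 0 < \<psi> i + w \<bullet> v i) \<and> y k i \<noteq> 0"
      using eventually_happens' sequentially_bot by blast
    have "good {i. i < n \<and> of_int (R (s k) i) + W k \<bullet> v i \<ge> 0}"
      using R(1)[of "s k"] W(1) unfolding X_def by blast
    moreover have eq: "of_int (R (s k) i) + W k \<bullet> v i \<ge> 0 \<longleftrightarrow> \<psi> i + w \<bullet> v i > 0" if "i < n" for i
    proof -
      have "of_int (R (s k) i) + W k \<bullet> v i \<ge> 0 \<longleftrightarrow> y k i \<ge> 0"
        using Mpos[of "s k"] by (simp add: y_def zero_le_divide_iff)
      then show ?thesis using k that by (auto simp: less_le)
    qed
    ultimately show "good {i. i < n \<and> \<psi> i + w \<bullet> v i > 0}"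
      by (simp only: eq cong: conj_cong)
  qed
  ultimately show thesis using that by blast
qed

section \<open>Saddles and the propagation of bends\<close>

lemma saddle_uminus:
  assumes "saddle \<psi>"
  shows "saddle (\<lambda>i. - \<psi> i)"
  unfolding saddle_def
proof (intro allI impI)
  fix w assume nz: "\<forall>i<n. - \<psi> i + w \<bullet> v i \<noteq> 0"
  then have nz': "\<forall>i<n. \<psi> i + (- w) \<bullet> v i \<noteq> 0" by (auto simp: algebra_simps)
  then have "good {i. i < n \<and> \<psi> i + (- w) \<bullet> v i > 0}" using assms unfolding saddle_def by blast
  then have "good ({..<n} - {i. i < n \<and> \<psi> i + (- w) \<bullet> v i > 0})" by (rule good_compl) auto
  moreover have "{..<n} - {i. i < n \<and> \<psi> i + (- w) \<bullet> v i > 0} = {i. i < n \<and> - \<psi> i + w \<bullet> v i > 0}"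
    using nz by (auto simp: less_le)
  ultimately show "good {i. i < n \<and> - \<psi> i + w \<bullet> v i > 0}" by simp
qed

text \<open>When \<open>i\<close> is the only zero, a small change of \<open>w\<close> along
  \<open>v i\<close> gives it either sign and alters no other. Both neighbouring chambers are
  generic, so both sets are good.\<close>

lemma saddle_crossing:
  assumes sd: "saddle \<psi>" and i: "i < n" "\<psi> i + w \<bullet> v i = 0"
    and nz: "\<And>j. j < n \<Longrightarrow> j \<noteq> i \<Longrightarrow> \<psi> j + w \<bullet> v j \<noteq> 0"
  shows "good {j. j < n \<and> \<psi> j + w \<bullet> v j > 0}" "good (insert i {j. j < n \<and> \<psi> j + w \<bullet> v j > 0})"
proof -
  define f where "f j = \<psi> j + w \<bullet> v j" for j
  define p where "p = (1 / (v i \<bullet> v i)) *\<^sub>R v i"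
  have pi: "p \<bullet> v i = 1" using nonzero[OF i(1)] by (simp add: p_def)
  obtain \<delta> where \<delta>: "\<delta> > 0" "\<And>j. j < n \<Longrightarrow> f j \<noteq> 0 \<Longrightarrow> \<delta> * \<bar>p \<bullet> v j\<bar> < \<bar>f j\<bar>"
    by (rule small_perturbation[of n f "\<lambda>j. p \<bullet> v j"]) blast
  have val: "\<psi> j + (w + c *\<^sub>R p) \<bullet> v j = f j + c * (p \<bullet> v j)" for c j
    by (simp add: f_def inner_add_left)
  have sgn: "f j + c * (p \<bullet> v j) \<noteq> 0 \<and> (f j + c * (p \<bullet> v j) > 0 \<longleftrightarrow> f j > 0)"
    if "j < n" "j \<noteq> i" "\<bar>c\<bar> = \<delta>" for j c
  proof -
    have "\<bar>c * (p \<bullet> v j)\<bar> < \<bar>f j\<bar>"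
      using \<delta>(2)[OF that(1)] nz[OF that(1,2)] that(3) by (simp add: f_def abs_mult)
    then show ?thesis by linarith
  qed
  have fi: "f i = 0" using i(2) by (simp add: f_def)
  have nz': "\<psi> j + (w + c *\<^sub>R p) \<bullet> v j \<noteq> 0" if "j < n" "\<bar>c\<bar> = \<delta>" for j c
    unfolding val using sgn[OF that(1) _ that(2)] fi pi that \<delta>(1) by (cases "j = i") auto
  have good: "good {j. j < n \<and> f j + c * (p \<bullet> v j) > 0}" if "\<bar>c\<bar> = \<delta>" for c
    using sd[unfolded saddle_def, THEN spec, of "w + c *\<^sub>R p"] nz'[OF _ that] by (simp only: val) simp
  have "{j. j < n \<and> f j + (- \<delta>) * (p \<bullet> v j) > 0} = {j. j < n \<and> f j > 0}"
  proof (intro Collect_cong conj_cong refl)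
    fix j assume j: "j < n"
    show "f j + (- \<delta>) * (p \<bullet> v j) > 0 \<longleftrightarrow> f j > 0"
      using sgn[OF j, of "- \<delta>"] fi pi \<delta>(1) by (cases "j = i") auto
  qed
  moreover have "{j. j < n \<and> f j + \<delta> * (p \<bullet> v j) > 0} = insert i {j. j < n \<and> f j > 0}"
  proof (rule set_eqI)
    fix j
    show "j \<in> {j. j < n \<and> f j + \<delta> * (p \<bullet> v j) > 0} \<longleftrightarrow> j \<in> insert i {j. j < n \<and> f j > 0}"
      using sgn[of j \<delta>] fi pi \<delta>(1) i(1) by (cases "j = i") auto
  qed
  ultimately show "good {j. j < n \<and> \<psi> j + w \<bullet> v j > 0}" "good (insert i {j. j < n \<and> \<psi> j + w \<bullet> v j > 0})"
    using good[of \<delta>] good[of "- \<delta>"] \<delta>(1) by (simp_all add: f_def)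
qed

text \<open>A convex bend: up to a linear function, \<open>\<psi>\<close> vanishes on the edge and
  is positive at the apexes of both adjacent triangles. A concave bend is a bend of the negated
  function.\<close>

definition bent :: "(nat \<Rightarrow> real) \<Rightarrow> nat \<Rightarrow> nat \<Rightarrow> bool" where
  "bent \<psi> i k \<longleftrightarrow> (\<exists>w. \<psi> i + w \<bullet> v i = 0 \<and> \<psi> k + w \<bullet> v k = 0 \<and>
    (\<forall>a. a \<noteq> i \<longrightarrow> a \<noteq> k \<longrightarrow> {i, k, a} \<in> C \<longrightarrow> \<psi> a + w \<bullet> v a > 0))"

lemma bent_sym: "bent \<psi> i k \<longleftrightarrow> bent \<psi> k i"
proof -
  have "bent \<psi> k i" if "bent \<psi> i k" for i k
    using that unfolding bent_def by (metis insert_commute)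
  then show ?thesis by blast
qed

text \<open>A bend of a saddle continues straight through the end of an edge.\<close>
lemma saddle_bend_continues:
  assumes sd: "saddle \<psi>" and ik: "{i, k} \<in> C" "i \<noteq> k" and bent: "bent \<psi> i k"
    and lone: "\<And>j. j < n \<Longrightarrow> j \<noteq> i \<Longrightarrow> \<not> collinear {0, v i, v j}"
  shows "\<exists>l \<alpha> \<gamma>. {i, l} \<in> C \<and> l \<noteq> i \<and> v l = \<alpha> *\<^sub>R v i + \<gamma> *\<^sub>R v k \<and> \<gamma> < 0 \<and> bent \<psi> i l"
proof -
  let ?m = "v i \<times> v k"
  have range: "i < n" "k < n" using edge_range[OF ik(1)] by auto
  have m0: "?m \<noteq> 0" by (rule edge_cross_nonzero[OF ik])
  obtain w where w: "\<psi> i + w \<bullet> v i = 0" "\<psi> k + w \<bullet> v k = 0"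
    "\<And>a. a \<noteq> i \<Longrightarrow> a \<noteq> k \<Longrightarrow> {i, k, a} \<in> C \<Longrightarrow> \<psi> a + w \<bullet> v a > 0"
    using bent unfolding bent_def by blast
  \<comment> \<open>Tilting by a small multiple of the normal keeps the edge at 0 and the apexes
    positive, and leaves zeros of \<open>f\<close> only in the plane of the edge.\<close>
  obtain t where t: "t > 0" "\<And>j. j < n \<Longrightarrow> \<psi> j + w \<bullet> v j \<noteq> 0 \<Longrightarrow> t * \<bar>?m \<bullet> v j\<bar> < \<bar>\<psi> j + w \<bullet> v j\<bar>"
    by (rule small_perturbation[of n "\<lambda>j. \<psi> j + w \<bullet> v j" "\<lambda>j. ?m \<bullet> v j"]) blast
  define w' where "w' = w + t *\<^sub>R ?m"
  define f where "f j = \<psi> j + w' \<bullet> v j" for j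
  have f_eq: "f j = (\<psi> j + w \<bullet> v j) + t * (?m \<bullet> v j)" for j
    by (simp add: f_def w'_def inner_add_left)
  have f_ik: "f i = 0" "f k = 0" by (simp_all add: f_eq w(1,2) dot_cross_self)
  have f_sgn: "f j > 0 \<longleftrightarrow> \<psi> j + w \<bullet> v j > 0" "f j \<noteq> 0" if "j < n" "\<psi> j + w \<bullet> v j \<noteq> 0" for j
  proof -
    have "\<bar>t * (?m \<bullet> v j)\<bar> < \<bar>\<psi> j + w \<bullet> v j\<bar>" using t(2)[OF that] t(1) by (simp add: abs_mult)
    then show "f j > 0 \<longleftrightarrow> \<psi> j + w \<bullet> v j > 0" "f j \<noteq> 0" unfolding f_eq by linarith+
  qed
  have f_pos: "f a > 0" if "a \<noteq> i" "a \<noteq> k" "{i, k, a} \<in> C" for a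
    using f_sgn(1)[of a] w(3)[OF that] in_range[OF that(3)] by auto
  have f_plane: "?m \<bullet> v j = 0" if "j < n" "f j = 0" for j
  proof -
    have "\<psi> j + w \<bullet> v j = 0" using f_sgn(2)[OF that(1)] that(2) by blast
    then show ?thesis using that(2) t(1) by (simp add: f_eq)
  qed
  obtain p where p: "\<forall>j\<in>{i, k}. p \<bullet> v j = (if j = k then 1 else 0)"
    using dual_functional[OF ik(1), of "\<lambda>j. if j = k then 1 else 0"] by auto
  then have p': "p \<bullet> v i = 0" "p \<bullet> v k = 1" using ik(2) by auto
  have in_plane: "\<exists>\<alpha>. v j = \<alpha> *\<^sub>R v i + (p \<bullet> v j) *\<^sub>R v k" if "?m \<bullet> v j = 0" for j
  proof -
    obtain \<alpha> \<gamma> where "v j = \<alpha> *\<^sub>R v i + \<gamma> *\<^sub>R v k" using in_plane_cross[OF m0 \<open>?m \<bullet> v j = 0\<close>] .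
    moreover from this have "p \<bullet> v j = \<gamma>" by (simp add: inner_add_right p')
    ultimately show ?thesis by blast
  qed
  \<comment> \<open>Here a ray collinear with \<open>v i\<close> would interfere: it could remain a
    second zero under every perturbation along \<open>p\<close>.\<close>
  have p_nz: "p \<bullet> v j \<noteq> 0" if j: "j < n" "j \<noteq> i" "f j = 0" for j
  proof
    assume "p \<bullet> v j = 0"
    then obtain \<alpha> where "v j = \<alpha> *\<^sub>R v i" using in_plane[OF f_plane[OF j(1,3)]] by auto
    then have "collinear {0, v i, v j}" by (auto simp: collinear_lemma)
    then show False using lone[OF j(1,2)] by blast
  qed
  obtain \<delta> where \<delta>: "\<delta> > 0" "\<And>j. j < n \<Longrightarrow> f j \<noteq> 0 \<Longrightarrow> \<delta> * \<bar>p \<bullet> v j\<bar> < \<bar>f j\<bar>"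
    by (rule small_perturbation[of n f "\<lambda>j. p \<bullet> v j"]) blast
  have val: "\<psi> j + (w' + c *\<^sub>R p) \<bullet> v j = f j + c * (p \<bullet> v j)" for c j
    by (simp add: f_def inner_add_left)
  have sgn: "f j + c * (p \<bullet> v j) \<noteq> 0" "f j + c * (p \<bullet> v j) > 0 \<longleftrightarrow> f j > 0"
    if "j < n" "f j \<noteq> 0" "\<bar>c\<bar> = \<delta>" for j c
  proof -
    have "\<bar>c * (p \<bullet> v j)\<bar> < \<bar>f j\<bar>" using \<delta>(2)[OF that(1,2)] that(3) by (simp add: abs_mult)
    then show "f j + c * (p \<bullet> v j) \<noteq> 0" "f j + c * (p \<bullet> v j) > 0 \<longleftrightarrow> f j > 0" by linarith+
  qed
  have nz: "f j + c * (p \<bullet> v j) \<noteq> 0" if "j < n" "j \<noteq> i" "\<bar>c\<bar> = \<delta>" for j c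
    using sgn(1)[OF that(1) _ that(3)] p_nz[OF that(1,2)] \<delta>(1) that(3) by (cases "f j = 0") auto
  \<comment> \<open>Negative sets at two points of the wall of \<open>i\<close>: for
    \<open>c = - \<delta>\<close> the ray \<open>k\<close> is negative, for
    \<open>c = \<delta>\<close> it is positive.\<close>
  define N where "N c = {j. j < n \<and> f j + c * (p \<bullet> v j) < 0}" for c
  have N: "good (N c)" "good (insert i (N c))" if c: "\<bar>c\<bar> = \<delta>" for c
  proof -
    let ?P = "{j. j < n \<and> \<psi> j + (w' + c *\<^sub>R p) \<bullet> v j > 0}"
    have vi: "f i + c * (p \<bullet> v i) = 0" by (simp add: f_ik p')
    have "good ?P" "good (insert i ?P)"
      by (rule saddle_crossing[OF sd range(1)]; use nz[OF _ _ c] vi in \<open>simp add: val\<close>)+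
    moreover have "?P \<subseteq> {..<n}" "insert i ?P \<subseteq> {..<n}" using range by auto
    ultimately have g: "good ({..<n} - ?P)" "good ({..<n} - insert i ?P)" using good_compl by blast+
    have P: "j \<in> ?P \<longleftrightarrow> \<not> f j + c * (p \<bullet> v j) < 0" if "j < n" "j \<noteq> i" for j
      using nz[OF that c] that unfolding val by auto
    have "i \<notin> ?P" "i \<notin> N c" using vi by (auto simp: val N_def)
    then have "{..<n} - ?P = insert i (N c)" "{..<n} - insert i ?P = N c"
      using P range(1) unfolding N_def by blast+
    then show "good (N c)" "good (insert i (N c))" using g by simp_all
  qed
  have Nn: "N c \<subseteq> {..<n}" "i \<notin> N c" for c by (auto simp: N_def f_ik p')
  \<comment> \<open>A second negative neighbour of \<open>i\<close> would, by
    \<open>acyclic_edge_in_triangle\<close>, force an apex of the bent edge to be negative.\<close>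
  have only_k: "k' = k" if k': "k' \<in> N (- \<delta>)" "{i, k'} \<in> C" for k'
  proof (rule ccontr)
    assume "k' \<noteq> k"
    have k: "k \<in> N (- \<delta>)" using range \<delta>(1) by (simp add: N_def f_ik p')
    have ac: "acyclic (K (N (- \<delta>))) {..<n}" "acyclic (K (insert i (N (- \<delta>)))) {..<n}"
      using N[of "- \<delta>"] \<delta>(1) Nn range(1) by (auto intro!: good_acyclic)
    obtain x where x: "x \<in> N (- \<delta>)" "x \<noteq> k" "{i, k, x} \<in> C"
      using acyclic_edge_in_triangle[OF ac Nn k k'(1) _ ik(1) k'(2)] \<open>k' \<noteq> k\<close> by auto
    have "x \<noteq> i" using x(1) Nn(2) by auto
    then have "f x > 0" using f_pos x by blast
    then have "f x + (- \<delta>) * (p \<bullet> v x) > 0" using sgn(2)[of x "- \<delta>"] x(1) \<delta>(1) by (auto simp: N_def)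
    then show False using x(1) by (simp add: N_def)
  qed
  \<comment> \<open>After the opposite perturbation \<open>i\<close> still needs a negative
    neighbour. It was not negative before, so it is a zero of \<open>f\<close> in the plane of the
    edge, with a negative coefficient at \<open>v k\<close>.\<close>
  have "\<exists>l\<in>N \<delta>. {i, l} \<in> C"
  proof (rule ccontr)
    assume no: "\<not> ?thesis"
    have ci: "conn (insert i (N \<delta>))" "N \<delta> \<noteq> {}" using N[of \<delta>] \<delta>(1) by (auto simp: good_def conn_def)
    have "{i} = insert i (N \<delta>)"
      using ci(1)[unfolded conn_def, THEN conjunct2, THEN spec, of "{i}"] no by auto
    then show False using ci(2) Nn(2)[of \<delta>] by auto
  qed
  then obtain l where l: "l \<in> N \<delta>" "{i, l} \<in> C" by blast
  have ln: "l < n" "l \<noteq> i" using l(1) Nn[of \<delta>] by auto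
  have neg: "f l + \<delta> * (p \<bullet> v l) < 0" using l(1) by (simp add: N_def)
  have "l \<noteq> k" using neg \<delta>(1) by (auto simp: f_ik p')
  then have "l \<notin> N (- \<delta>)" using only_k l(2) by blast
  then have "\<not> f l + (- \<delta>) * (p \<bullet> v l) < 0" using ln by (simp add: N_def)
  then have fl: "f l = 0" using neg sgn(2)[OF ln(1), of \<delta>] sgn(2)[OF ln(1), of "- \<delta>"] sgn(1)[OF ln(1), of "- \<delta>"] \<delta>(1)
    by fastforce
  have \<gamma>: "p \<bullet> v l < 0" using neg fl \<delta>(1) by (simp add: mult_less_0_iff)
  obtain \<alpha> where \<alpha>: "v l = \<alpha> *\<^sub>R v i + (p \<bullet> v l) *\<^sub>R v k" using in_plane[OF f_plane[OF ln(1) fl]] by blast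
  have "bent \<psi> i l"
    unfolding bent_def
  proof (intro exI[of _ w'] conjI allI impI)
    show "\<psi> i + w' \<bullet> v i = 0" "\<psi> l + w' \<bullet> v l = 0" using f_ik fl by (simp_all add: f_def)
    fix a assume a: "a \<noteq> i" "a \<noteq> l" "{i, l, a} \<in> C"
    have an: "a < n" using in_range[OF a(3)] by auto
    have "v i \<times> v l = (p \<bullet> v l) *\<^sub>R ?m"
      by (subst \<alpha>) (simp add: cross_add_right cross_mult_right)
    then have "?m \<bullet> v a \<noteq> 0" using triangle_off_plane[OF a(3) _ a(1,2)] ln(2) by auto
    then have fa: "f a \<noteq> 0" using f_plane[OF an] by blast
    \<comment> \<open>A negative apex would already be negative at \<open>- \<delta>\<close>, as a
      neighbour of \<open>i\<close> different from \<open>k\<close>.\<close>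
    have "\<not> f a < 0"
    proof
      assume "f a < 0"
      then have "f a + (- \<delta>) * (p \<bullet> v a) < 0"
        using sgn[OF an fa, of "- \<delta>"] \<delta>(1) by (metis abs_minus_cancel abs_of_pos linorder_neqE order_less_asym)
      then have "a \<in> N (- \<delta>)" using an by (simp add: N_def)
      moreover have "{i, a} \<in> C" by (rule face[OF a(3)]) auto
      ultimately have "a = k" by (rule only_k)
      then show False using fa f_ik by simp
    qed
    then show "\<psi> a + w' \<bullet> v a > 0" using fa by (simp add: f_def)
  qed
  then show ?thesis using l(2) ln(2) \<alpha> \<gamma> by blast
qed

section \<open>Planes that are unions of cones\<close>

lemma h_add_vertex:
  assumes "h y a > 0" "t \<ge> 0"
  shows "h (y + t *\<^sub>R v a) j = h y j + (if j = a then t else 0)"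
proof -
  have "h (y + t *\<^sub>R v a) = (\<lambda>j. h y j + (if j = a then t else 0))"
  proof (rule h_unique)
    show "{i. h y i + (if i = a then t else 0) \<noteq> 0} \<in> C"
      by (rule face[OF h_carrier[of y]]) (use assms in \<open>auto split: if_splits\<close>)
    have "(\<Sum>j<n. (h y j + (if j = a then t else 0)) *\<^sub>R v j)
        = (\<Sum>j<n. h y j *\<^sub>R v j) + (\<Sum>j<n. if j = a then t *\<^sub>R v a else 0)"
      unfolding sum.distrib[symmetric] by (intro sum.cong) (auto simp: scaleR_add_left)
    also have "\<dots> = y + t *\<^sub>R v a"
      using h_pos_in_range[OF assms(1)] by (simp add: h_sum)
    finally show "y + t *\<^sub>R v a = (\<Sum>j<n. (h y j + (if j = a then t else 0)) *\<^sub>R v j)" ..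
  qed (use assms h_nonneg[of y] in auto)
  then show ?thesis by simp
qed

text \<open>Adding a multiple of \<open>v a\<close>, which is already in the carrier, moves
  \<open>y\<close> into the cone of the edge and changes no other coordinate.\<close>

lemma carrier_in_edge:
  assumes ab: "{a, b} \<in> C" "a \<noteq> b" and y: "h y a > 0" "y = \<xi> *\<^sub>R v a + \<eta> *\<^sub>R v b" "\<eta> \<ge> 0" and j: "h y j \<noteq> 0"
  shows "j \<in> {a, b}"
proof (rule ccontr)
  assume "j \<notin> {a, b}"
  have "y + \<bar>\<xi>\<bar> *\<^sub>R v a = (\<Sum>l\<in>{a, b}. (if l = a then \<xi> + \<bar>\<xi>\<bar> else \<eta>) *\<^sub>R v l)"
    using ab(2) by (simp add: y(2) algebra_simps)
  moreover have "(if l = a then \<xi> + \<bar>\<xi>\<bar> else \<eta>) \<ge> 0" for l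
    using y(3) by auto
  ultimately have "h (y + \<bar>\<xi>\<bar> *\<^sub>R v a) j = 0"
    using h_cone[OF ab(1), of "\<lambda>l. if l = a then \<xi> + \<bar>\<xi>\<bar> else \<eta>"] \<open>j \<notin> {a, b}\<close> by auto
  then show False using h_add_vertex[OF y(1), of "\<bar>\<xi>\<bar>" j] j \<open>j \<notin> {a, b}\<close> by auto
qed

text \<open>Bends in the plane continue through each of their ends, so the carrier of a point of the
  plane stays in the set \<open>A\<close> of these ends once it touches it. The plane without 0 is
  connected, hence all carriers stay in \<open>A\<close>, and the plane is a union of cones.\<close>

lemma bent_plane_carriers:
  assumes sd: "saddle \<psi>" and m: "m \<noteq> 0"
    and lone: "\<And>i j. i < n \<Longrightarrow> j < n \<Longrightarrow> i \<noteq> j \<Longrightarrow> m \<bullet> v i = 0 \<Longrightarrow> \<not> collinear {0, v i, v j}"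
    and pq: "{p, q} \<in> C" "p \<noteq> q" "m \<bullet> v p = 0" "m \<bullet> v q = 0" "bent \<psi> p q"
    and y: "m \<bullet> y = 0" "h y j \<noteq> 0"
  shows "m \<bullet> v j = 0"
proof -
  define A where "A = {a. m \<bullet> v a = 0 \<and> (\<exists>b. {a, b} \<in> C \<and> a \<noteq> b \<and> m \<bullet> v b = 0 \<and> bent \<psi> a b)}"
  have pA: "p \<in> A" using pq by (auto simp: A_def)
  have carrier: "j \<in> A" if a: "a \<in> A" "m \<bullet> y = 0" "h y a > 0" "h y j \<noteq> 0" for a y j
  proof -
    obtain b where b: "m \<bullet> v a = 0" "{a, b} \<in> C" "a \<noteq> b" "m \<bullet> v b = 0" "bent \<psi> a b"
      using a(1) unfolding A_def by blast
    have an: "a < n" using in_range[OF b(2)] by simp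
    have ba: "{b, a} \<in> C" using b(2) by (simp add: insert_commute)
    have bA: "b \<in> A" using b ba by (auto simp: A_def bent_sym[of \<psi> b a])
    have ab0: "v a \<times> v b \<noteq> 0" by (rule edge_cross_nonzero[OF b(2,3)])
    obtain \<sigma> where \<sigma>: "m = \<sigma> *\<^sub>R (v a \<times> v b)"
      using orthogonal_imp_multiple_cross[OF ab0 b(1,4)] .
    then have "\<sigma> \<noteq> 0" using m by auto
    then have "(v a \<times> v b) \<bullet> y = 0" using a(2) by (simp add: \<sigma>)
    then obtain \<xi> \<eta> where y: "y = \<xi> *\<^sub>R v a + \<eta> *\<^sub>R v b" using in_plane_cross[OF ab0] by blast
    show ?thesis
    proof (cases "\<eta> \<ge> 0")
      case True
      then have "j \<in> {a, b}" using carrier_in_edge[OF b(2,3) a(3) y _ a(4)] by blast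
      then show ?thesis using a(1) bA by auto
    next
      \<comment> \<open>\<open>y\<close> lies beyond \<open>v a\<close>, where the continuation of
        the bend supplies the other edge of the plane at \<open>a\<close>.\<close>
      case False
      obtain l \<alpha> \<gamma> where l: "{a, l} \<in> C" "l \<noteq> a" "v l = \<alpha> *\<^sub>R v a + \<gamma> *\<^sub>R v b" "\<gamma> < 0" "bent \<psi> a l"
        using saddle_bend_continues[OF sd b(2,3,5)] lone[OF an _ _ b(1)] by blast
      have ml: "m \<bullet> v l = 0" using l(3) b(1,4) by (simp add: inner_add_right)
      have la: "{l, a} \<in> C" using l(1) by (simp add: insert_commute)
      have lA: "l \<in> A" using l(2,5) la ml b(1) by (auto simp: A_def bent_sym[of \<psi> l a])
      have "(\<eta> / \<gamma>) *\<^sub>R v l = (\<eta> / \<gamma> * \<alpha>) *\<^sub>R v a + \<eta> *\<^sub>R v b"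
        using l(4) by (subst l(3)) (simp add: scaleR_add_right)
      then have y': "y = (\<xi> - \<eta> / \<gamma> * \<alpha>) *\<^sub>R v a + (\<eta> / \<gamma>) *\<^sub>R v l"
        unfolding y by (simp add: scaleR_diff_left)
      have "\<eta> / \<gamma> \<ge> 0" using False l(4) by (simp add: divide_nonpos_neg)
      then have "j \<in> {a, l}" using carrier_in_edge[OF l(1) l(2)[symmetric] a(3) y' _ a(4)] by blast
      then show ?thesis using a(1) lA by auto
    qed
  qed
  let ?H = "{x. m \<bullet> x = 0} - {0}"
  have "connected ?H"
    by (intro path_connected_imp_connected path_connected_punctured_convex convex_hyperplane)
       (use m in \<open>simp add: aff_dim_hyperplane\<close>)
  then have "\<exists>a\<in>A. h y a > 0"
  proof (rule connected_cut)
    show "\<exists>i\<in>A \<union> ({..<n} - A). h x i > 0" if "x \<in> ?H" for x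
      using h_pos_ex[of x] that by auto
    show "\<not> (h x i > 0 \<and> h x j > 0)" if "x \<in> ?H" "i \<in> A" "j \<in> {..<n} - A" for x i j
      using carrier[of i x j] that by force
    have pn: "p < n" using in_range[OF pq(1)] by simp
    show "v p \<in> ?H" using pq(3) nonzero[OF pn] by simp
    show "\<exists>i\<in>A. h (v p) i > 0" using pA h_vertex[OF pn, of p] by (intro bexI[of _ p]) auto
    have "y \<noteq> 0" using y(2) h_zero by auto
    then show "y \<in> ?H" using y(1) by simp
  qed
  then obtain a where "a \<in> A" "h y a > 0" by blast
  then have "j \<in> A" using carrier y by blast
  then show ?thesis by (simp add: A_def)
qed

section \<open>Bends and low-dimensional gradient polytopes\<close>

lemma exists_lowdim:
  assumes nonlin: "\<not> (\<exists>w. \<forall>i<n. g i = w \<bullet> v i)" and e: "e \<noteq> 0"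
    and c: "\<And>T u. T \<in> C \<Longrightarrow> card T = 3 \<Longrightarrow> \<forall>j\<in>T. u \<bullet> v j = g j \<Longrightarrow> e \<bullet> u = c"
  shows "\<exists>\<Psi>. piecewise_linear v C \<Psi> \<and> \<not> (\<exists>u. \<forall>x. \<Psi> x = u \<bullet> x) \<and> aff_dim (Lambda_psi v C \<Psi>) < 3"
proof (intro exI conjI)
  show "piecewise_linear v C (interp g)"
    unfolding piecewise_linear_def
  proof (intro conjI ballI continuous_interp)
    fix S assume S: "S \<in> C"
    obtain u where "\<forall>j\<in>S. u \<bullet> v j = g j" using dual_functional[OF S] by blast
    then show "\<exists>u. \<forall>x\<in>cone_of v S. interp g x = u \<bullet> x"
      using interp_on_cone[OF S] by blast
  qed
  show "\<not> (\<exists>u. \<forall>x. interp g x = u \<bullet> x)"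
    using nonlin linear_on_vertices by blast
  have "{u. \<exists>S. maximal_cone C S \<and> (\<forall>x\<in>cone_of v S. interp g x = u \<bullet> x)} \<subseteq> {u. e \<bullet> u = c}"
  proof clarify
    fix u S assume S: "maximal_cone C S" "\<forall>x\<in>cone_of v S. interp g x = u \<bullet> x"
    then have SC: "S \<in> C" "card S = 3" by (simp_all add: maximal_cone_iff)
    have "u \<bullet> v j = g j" if "j \<in> S" for j
    proof -
      have "j < n" using in_range[OF SC(1)] that by auto
      then show ?thesis using S(2) vertex_in_cone_iff[OF SC(1)] that interp_vertex by metis
    qed
    then show "e \<bullet> u = c" using c[OF SC] by blast
  qed
  then have "Lambda_psi v C (interp g) \<subseteq> {u. e \<bullet> u = c}"
    unfolding Lambda_psi_def by (intro hull_minimal convex_hyperplane)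
  then have "aff_dim (Lambda_psi v C (interp g)) \<le> aff_dim {u. e \<bullet> u = c}"
    by (rule aff_dim_subset)
  then show "aff_dim (Lambda_psi v C (interp g)) < 3"
    using e by (simp add: aff_dim_hyperplane)
qed

text \<open>Both linear pieces agree on the edge, so their gradients differ by a multiple of its
  normal; the sign of this multiple, taken relative to the sides of \<open>a\<close> and
  \<open>b\<close>, decides between convex and concave.\<close>

lemma kink_between_linear_pieces:
  assumes ab: "{i, k, a} \<in> C" "{i, k, b} \<in> C" "card {i, k, a} = 3" "card {i, k, b} = 3"
    and ua: "\<forall>j\<in>{i, k, a}. ua \<bullet> v j = \<psi> j" and ub: "\<forall>j\<in>{i, k, b}. ub \<bullet> v j = \<psi> j" and ne: "ua \<noteq> ub"
  obtains \<sigma> where "ua - ub = \<sigma> *\<^sub>R (v i \<times> v k)" "bent \<psi> i k \<or> bent (\<lambda>j. - \<psi> j) i k"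
proof -
  let ?m = "v i \<times> v k"
  have dist: "i \<noteq> k" "a \<noteq> i" "a \<noteq> k" "b \<noteq> i" "b \<noteq> k" using ab(3,4) by (auto simp: card_insert_if split: if_splits)
  have ik: "{i, k} \<in> C" by (rule face[OF ab(1)]) auto
  have m0: "?m \<noteq> 0" by (rule edge_cross_nonzero[OF ik dist(1)])
  obtain \<sigma> where \<sigma>: "ua - ub = \<sigma> *\<^sub>R ?m"
    by (rule orthogonal_imp_multiple_cross[OF m0, of "ua - ub"]) (use ua ub in \<open>auto simp: inner_diff_left\<close>)
  have \<sigma>0: "\<sigma> \<noteq> 0" using \<sigma> ne by auto
  have "a \<noteq> b"
  proof
    assume "a = b"
    then have "ua = ub" using ua ub by (intro triangle_linear_unique[OF ab(1,3)]) auto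
    then show False using ne by blast
  qed
  obtain a' b' where ab': "{i, k, a'} \<in> C" "{i, k, b'} \<in> C" "?m \<bullet> v a' > 0" "?m \<bullet> v b' < 0"
    "\<forall>x. {i, k, x} \<in> C \<longrightarrow> x \<noteq> i \<longrightarrow> x \<noteq> k \<longrightarrow> x = a' \<or> x = b'"
    by (rule edge_triangles[OF ik dist(1)])
  have cases: "a = a' \<and> b = b' \<or> a = b' \<and> b = a'"
    using ab'(5) ab(1,2) dist \<open>a \<noteq> b\<close> by metis
  obtain u where ua': "ua = u + (\<sigma> / 2) *\<^sub>R ?m" and ub': "ub = u - (\<sigma> / 2) *\<^sub>R ?m"
    by (rule midpoint_decomposition[OF \<sigma>])
  have f: "\<psi> i = u \<bullet> v i" "\<psi> k = u \<bullet> v k" "\<psi> a = u \<bullet> v a + (\<sigma> / 2) * (?m \<bullet> v a)"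
    "\<psi> b = u \<bullet> v b - (\<sigma> / 2) * (?m \<bullet> v b)"
    using ua ub by (simp_all add: ua' ub' inner_add_left inner_diff_left dot_cross_self)
  \<comment> \<open>Corrects the sign according to which of \<open>a\<close> and \<open>b\<close>
    lies on the positive side, so that both apexes deviate from \<open>u\<close> by a positive
    multiple of the same \<open>\<tau>\<close>.\<close>
  define \<tau> where "\<tau> = (if a = a' then \<sigma> else - \<sigma>)"
  have fx: "\<exists>y>0. \<psi> x = u \<bullet> x' + \<tau> * y" if "x \<noteq> i" "x \<noteq> k" "{i, k, x} \<in> C" "x' = v x" for x x'
  proof -
    have "x = a' \<or> x = b'" using ab'(5) that by blast
    then consider "x = a" | "x = b" using cases by auto
    then show ?thesis
    proof cases
      case 1
      then show ?thesis using f(3) cases ab'(3,4) that(4) \<open>a \<noteq> b\<close>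
        by (intro exI[of _ "\<bar>?m \<bullet> v a\<bar> / 2"]) (auto simp: \<tau>_def)
    next
      case 2
      then show ?thesis using f(4) cases ab'(3,4) that(4) \<open>a \<noteq> b\<close>
        by (intro exI[of _ "\<bar>?m \<bullet> v b\<bar> / 2"]) (auto simp: \<tau>_def)
    qed
  qed
  have \<tau>0: "\<tau> \<noteq> 0" using \<sigma>0 by (simp add: \<tau>_def)
  have "bent \<psi> i k \<or> bent (\<lambda>j. - \<psi> j) i k"
  proof (cases "\<tau> > 0")
    case True
    have "bent \<psi> i k"
      unfolding bent_def
    proof (intro exI[of _ "- u"] conjI allI impI)
      fix x assume "x \<noteq> i" "x \<noteq> k" "{i, k, x} \<in> C"
      then obtain y where "y > 0" "\<psi> x = u \<bullet> v x + \<tau> * y" using fx by blast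
      then show "\<psi> x + (- u) \<bullet> v x > 0" using True by simp
    qed (simp_all add: f(1,2))
    then show ?thesis ..
  next
    case False
    have "bent (\<lambda>j. - \<psi> j) i k"
      unfolding bent_def
    proof (intro exI[of _ u] conjI allI impI)
      fix x assume "x \<noteq> i" "x \<noteq> k" "{i, k, x} \<in> C"
      then obtain y where "y > 0" "\<psi> x = u \<bullet> v x + \<tau> * y" using fx by blast
      then show "- \<psi> x + u \<bullet> v x > 0" using False \<tau>0 by (simp add: mult_neg_pos)
    qed (simp_all add: f(1,2))
    then show ?thesis ..
  qed
  then show thesis using that[OF \<sigma>] by blast
qed

text \<open>A cone with rays on both sides of the plane would contain a point of the plane whose
  carrier leaves it, against \<open>bent_plane_carriers\<close>. Hence the fold along the plane is
  piecewise linear, with only two gradients, both orthogonal to \<open>v p\<close>.\<close>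

lemma bent_plane_imp_lowdim:
  assumes sd: "saddle \<psi>" and pq: "{p, q} \<in> C" "p \<noteq> q" "bent \<psi> p q"
    and lone: "\<And>i j. i < n \<Longrightarrow> j < n \<Longrightarrow> i \<noteq> j \<Longrightarrow> (v p \<times> v q) \<bullet> v i = 0 \<Longrightarrow> \<not> collinear {0, v i, v j}"
  shows "\<exists>\<Psi>. piecewise_linear v C \<Psi> \<and> \<not> (\<exists>u. \<forall>x. \<Psi> x = u \<bullet> x) \<and> aff_dim (Lambda_psi v C \<Psi>) < 3"
proof -
  let ?m = "v p \<times> v q"
  have m0: "?m \<noteq> 0" by (rule edge_cross_nonzero[OF pq(1,2)])
  have pn: "p < n" using in_range[OF pq(1)] by simp
  have same_side: "\<not> (?m \<bullet> v c > 0 \<and> ?m \<bullet> v d < 0)" if S: "S \<in> C" "c \<in> S" "d \<in> S" for S c d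
  proof
    assume cd: "?m \<bullet> v c > 0 \<and> ?m \<bullet> v d < 0"
    have cdC: "{c, d} \<in> C" using S by (intro face[OF S(1)]) auto
    have ne: "c \<noteq> d" using cd by auto
    define y where "y = (- (?m \<bullet> v d)) *\<^sub>R v c + (?m \<bullet> v c) *\<^sub>R v d"
    have my: "?m \<bullet> y = 0" by (simp add: y_def inner_add_right inner_diff_right)
    have "y = (\<Sum>l\<in>{c, d}. (if l = c then - (?m \<bullet> v d) else ?m \<bullet> v c) *\<^sub>R v l)"
      using ne by (simp add: y_def)
    then have "h y c = - (?m \<bullet> v d)"
      using h_cone[OF cdC, of "\<lambda>l. if l = c then - (?m \<bullet> v d) else ?m \<bullet> v c"] cd by auto
    then have hc: "h y c \<noteq> 0" using cd by simp
    have "?m \<bullet> v c = 0"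
      by (rule bent_plane_carriers[OF sd m0 _ pq(1,2) _ _ pq(3) my hc]) (use lone in \<open>simp_all add: dot_cross_self\<close>)
    then show False using cd by simp
  qed
  show ?thesis
  proof (rule exists_lowdim[of "\<lambda>i. \<bar>?m \<bullet> v i\<bar>" "v p" 0])
    show "v p \<noteq> 0" by (rule nonzero[OF pn])
    have pieces: "u = ?m \<or> u = - ?m" if T: "T \<in> C" "card T = 3" "\<forall>j\<in>T. u \<bullet> v j = \<bar>?m \<bullet> v j\<bar>" for T u
    proof (cases "\<exists>c\<in>T. ?m \<bullet> v c > 0")
      case True
      then have "?m \<bullet> v j \<ge> 0" if "j \<in> T" for j using same_side[OF T(1) _ that] by force
      then have "u = ?m" using T(3) by (intro triangle_linear_unique[OF T(1,2)]) auto
      then show ?thesis ..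
    next
      case False
      then have "?m \<bullet> v j \<le> 0" if "j \<in> T" for j using that by force
      then have "u = - ?m" using T(3) by (intro triangle_linear_unique[OF T(1,2)]) auto
      then show ?thesis ..
    qed
    show "v p \<bullet> u = 0" if "T \<in> C" "card T = 3" "\<forall>j\<in>T. u \<bullet> v j = \<bar>?m \<bullet> v j\<bar>" for T u
      using pieces[OF that] by (auto simp: dot_cross_self)
    show "\<not> (\<exists>w. \<forall>i<n. \<bar>?m \<bullet> v i\<bar> = w \<bullet> v i)"
    proof
      assume "\<exists>w. \<forall>i<n. \<bar>?m \<bullet> v i\<bar> = w \<bullet> v i"
      then obtain w where w: "\<forall>i<n. \<bar>?m \<bullet> v i\<bar> = w \<bullet> v i" by blast
      obtain a b where ab: "{p, q, a} \<in> C" "{p, q, b} \<in> C" "?m \<bullet> v a > 0" "?m \<bullet> v b < 0"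
        by (rule edge_triangles[OF pq(1,2)])
      have "w \<bullet> v a = \<bar>?m \<bullet> v a\<bar>" "w \<bullet> v b = \<bar>?m \<bullet> v b\<bar>" "w \<bullet> v p = 0" "w \<bullet> v q = 0"
        using w in_range[OF ab(1)] in_range[OF ab(2)] by (auto simp: dot_cross_self)
      moreover obtain \<sigma> where "w = \<sigma> *\<^sub>R ?m"
        using orthogonal_imp_multiple_cross[OF m0 calculation(3,4)] .
      ultimately have "\<sigma> * (?m \<bullet> v a) > 0" "\<sigma> * (?m \<bullet> v b) > 0" using ab by auto
      then show False using ab(3,4) by (auto simp: zero_less_mult_iff)
    qed
  qed
qed

text \<open>Otherwise the plane of every bend contains a ray with a collinear partner. At most one
  line carries such rays, so the normals of all bends are orthogonal to one direction
  \<open>e\<close>, and the product of \<open>e\<close> with the gradient is the same on all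
  triangles.\<close>

lemma saddle_imp_lowdim:
  assumes sd: "saddle \<psi>" and nonlin: "\<not> (\<exists>w. \<forall>i<n. \<psi> i = w \<bullet> v i)"
    and pairs: "card {{i, j} | i j. i < n \<and> j < n \<and> i \<noteq> j \<and> collinear {0, v i, v j}} \<le> 1" (is "card ?P \<le> 1")
  shows "\<exists>\<Psi>. piecewise_linear v C \<Psi> \<and> \<not> (\<exists>u. \<forall>x. \<Psi> x = u \<bullet> x) \<and> aff_dim (Lambda_psi v C \<Psi>) < 3"
proof (rule ccontr)
  assume no: "\<not> ?thesis"
  have special: "\<exists>c j. c < n \<and> j < n \<and> c \<noteq> j \<and> (v i \<times> v k) \<bullet> v c = 0 \<and> collinear {0, v c, v j}"
    if "{i, k} \<in> C" "i \<noteq> k" "bent \<psi> i k \<or> bent (\<lambda>j. - \<psi> j) i k" for i k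
    using that(3) bent_plane_imp_lowdim[OF sd that(1,2)] bent_plane_imp_lowdim[OF saddle_uminus[OF sd] that(1,2)] no by blast
  have "?P \<subseteq> Pow {..<n}" by auto
  then have finP: "finite ?P" by (rule finite_subset) simp
  have "\<exists>e\<noteq>0. \<forall>c j m. c < n \<longrightarrow> j < n \<longrightarrow> c \<noteq> j \<longrightarrow> collinear {0, v c, v j} \<longrightarrow> m \<bullet> v c = 0 \<longrightarrow> m \<bullet> e = 0"
  proof (cases "?P = {}")
    case True
    \<comment> \<open>Without collinear rays the condition on \<open>e\<close> is void, and any
      nonzero vector will do.\<close>
    then show ?thesis using nonzero[OF n_pos] by (intro exI[of _ "v 0"]) blast
  next
    case False
    then obtain p p' where p: "p < n" "p' < n" "p \<noteq> p'" "collinear {0, v p, v p'}" by blast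
    obtain t where t: "v p' = t *\<^sub>R v p" using p nonzero by (auto simp: collinear_lemma)
    have t0: "t \<noteq> 0" using t nonzero[OF p(2)] by auto
    have "m \<bullet> v p = 0" if c: "c < n" "j < n" "c \<noteq> j" "collinear {0, v c, v j}" "m \<bullet> v c = 0" for c j m
    proof -
      have "{c, j} \<in> ?P" "{p, p'} \<in> ?P" using c p by blast+
      then have "{c, j} = {p, p'}" using pairs card_le_Suc0_iff_eq[OF finP] by auto
      then have "c = p \<or> c = p'" by auto
      then show ?thesis using c(5) t t0 by auto
    qed
    then show ?thesis using nonzero[OF p(1)] by blast
  qed
  then obtain e where e: "e \<noteq> 0"
    "\<And>c j m. c < n \<Longrightarrow> j < n \<Longrightarrow> c \<noteq> j \<Longrightarrow> collinear {0, v c, v j} \<Longrightarrow> m \<bullet> v c = 0 \<Longrightarrow> m \<bullet> e = 0" by blast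
  define U where "U T = (SOME u. \<forall>j\<in>T. u \<bullet> v j = \<psi> j)" for T
  have U: "\<forall>j\<in>T. U T \<bullet> v j = \<psi> j" if "T \<in> C" for T
    unfolding U_def by (rule someI_ex[OF dual_functional[OF that]])
  obtain T0 where T0: "T0 \<in> C" "card T0 = 3" using extend_cone[OF empty_cone] by blast
  have const: "e \<bullet> U T = e \<bullet> U T0" if T: "T \<in> C" "card T = 3" for T
  proof (rule constant_on_triangles[OF _ T(1) T0(1) T(2) T0(2)])
    fix i k a b assume ab: "{i, k, a} \<in> C" "{i, k, b} \<in> C" "card {i, k, a} = 3" "card {i, k, b} = 3"
    show "e \<bullet> U {i, k, a} = e \<bullet> U {i, k, b}"
    proof (cases "U {i, k, a} = U {i, k, b}")
      case False
      obtain \<sigma> where \<sigma>: "U {i, k, a} - U {i, k, b} = \<sigma> *\<^sub>R (v i \<times> v k)" "bent \<psi> i k \<or> bent (\<lambda>j. - \<psi> j) i k"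
        by (rule kink_between_linear_pieces[OF ab U[OF ab(1)] U[OF ab(2)] False])
      have ik: "{i, k} \<in> C" by (rule face[OF ab(1)]) auto
      have "i \<noteq> k" using ab(3) by (auto simp: card_insert_if split: if_splits)
      from special[OF ik this \<sigma>(2)] obtain c j where
        "c < n" "j < n" "c \<noteq> j" "(v i \<times> v k) \<bullet> v c = 0" "collinear {0, v c, v j}" by blast
      then have "(v i \<times> v k) \<bullet> e = 0" using e(2) by blast
      then have "e \<bullet> (U {i, k, a} - U {i, k, b}) = 0" unfolding \<sigma>(1) by (simp add: inner_commute)
      then show ?thesis by (simp add: inner_diff_right)
    qed simp
  qed
  have "e \<bullet> u = e \<bullet> U T0" if "T \<in> C" "card T = 3" "\<forall>j\<in>T. u \<bullet> v j = \<psi> j" for T u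
  proof -
    have "u = U T" using U[OF that(1)] that(3) by (intro triangle_linear_unique[OF that(1,2)]) auto
    then show ?thesis using const[OF that(1,2)] by simp
  qed
  then show False using exists_lowdim[OF nonlin e(1)] no by blast
qed

lemma infinite_imp_lowdim:
  assumes inf: "infinite (H_trivial_bundles n v C)"
    and pairs: "card {{i, j} | i j. i < n \<and> j < n \<and> i \<noteq> j \<and> collinear {0, v i, v j}} \<le> 1"
  shows "\<exists>\<Psi>. piecewise_linear v C \<Psi> \<and> \<not> (\<exists>u. \<forall>x. \<Psi> x = u \<bullet> x) \<and> aff_dim (Lambda_psi v C \<Psi>) < 3"
proof -
  obtain S0 where S0: "S0 \<in> C" "card S0 = 3" using extend_cone[OF empty_cone] by blast
  obtain \<psi> where \<psi>: "saddle \<psi>" "\<forall>j\<in>S0. \<psi> j = 0" "\<exists>i<n. \<psi> i \<noteq> 0"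
    by (rule infinite_imp_saddle[OF inf S0(1)])
  have "\<not> (\<exists>w. \<forall>i<n. \<psi> i = w \<bullet> v i)"
  proof
    assume "\<exists>w. \<forall>i<n. \<psi> i = w \<bullet> v i"
    then obtain w where w: "\<forall>i<n. \<psi> i = w \<bullet> v i" by blast
    have "w = 0"
    proof (rule triangle_linear_unique[OF S0])
      fix j assume "j \<in> S0"
      moreover have "j < n" using in_range[OF S0(1)] calculation by auto
      ultimately show "w \<bullet> v j = 0 \<bullet> v j" using w \<psi>(2) by auto
    qed
    then show False using w \<psi>(3) by auto
  qed
  then show ?thesis by (rule saddle_imp_lowdim[OF \<psi>(1) _ pairs])
qed

end

text \<open>\<open>\<psi>\<close> is asked to be nonlinear because a linear function has a single
  gradient, so its polytope is a point on every fan. Bundles are counted as classes, so an infinite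
  set of them means pairwise non-isomorphic bundles.\<close>

theorem theorem4p12:
  fixes n :: nat and v :: "nat \<Rightarrow> real^3" and C :: "nat set set"
  assumes "complete_stacky_fan n v C"
    and "card {{i, j} | i j. i < n \<and> j < n \<and> i \<noteq> j \<and> collinear {0, v i, v j}} \<le> 1"
  shows "infinite (H_trivial_bundles n v C) \<longleftrightarrow>
         (\<exists>\<psi>. piecewise_linear v C \<psi> \<and> \<not> (\<exists>u. \<forall>x. \<psi> x = u \<bullet> x) \<and>
               aff_dim (Lambda_psi v C \<psi>) < 3)"
proof -
  interpret fan n v C by unfold_locales (rule assms(1))
  show ?thesis
    using infinite_imp_lowdim[OF _ assms(2)] lowdim_Lambda_imp_infinite by blast
qed

end
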